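(* Let $w$ be a word over $[\pm n]$. The connected component of the crystal $G_n$ containing $w$ is isomorphic to the connected component containing $w^\star$. Consequently $P(w)$ and $P(w^\star)$ have the same shape and opposite weights. Moreover, the component containing $w^\star$ is the dual of the component containing $w$, the duality being realized by the map $u\mapsto u^\star$.
   Context: $[\pm n]=\{1,\dots,n,\overline n,\dots,\overline1\}$ ($\overline i=-i$), ordered $1<\dots<n<\overline n<\dots<\overline1$. For $w=w_1\cdots w_k$, $w^\star=\overline{w_k}\cdots\overline{w_1}$. The weight $\mathrm{wt}(w)\in\mathbb Z^n$ has $i$-th entry (number of $i$'s) minus (number of $\overline i$'s). $G_n$ is the crystal whose vertices are all words over $[\pm n]$, with weight $\mathrm{wt}$ and operators $e_i,f_i$ ($i\in[n]$) given by the signature rule: replace each letter in $\{i,\overline{i+1}\}$ by $+$ and each letter in $\{i+1,\overline i\}$ by $-$ (for $i=n$: $n\mapsto+$, $\overline n\mapsto-$), ignore others, cancel adjacent pairs $+-$ repeatedly; $f_i$ changes the letter of the leftmost uncancelled $+$ ($i\mapsto i+1$ if $i<n$, $\overline{i+1}\mapsto\overline i$, $n\mapsto\overline n$ if $i=n$), or is $0$; $e_i$ is the inverse, acting on the rightmost uncancelled $-$, or is $0$. Its crystal graph has an arrow $u\xrightarrow{i}f_i(u)$. The dual of a connected component $\mathfrak C$ is the crystal $\mathfrak C^\vee$ obtained by reversing all arrows and negating all weights; a map $u\mapsto u^\star$ realizes it if it is a bijection with $\mathrm{wt}(u^\star)=-\mathrm{wt}(u)$ and $f_i(u)=u'$ iff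 $e_i(u^\star)=u'^\star$. $P(w)$ is the unique Kashiwara–Nakashima tableau of partition shape whose column reading is Knuth (plactic) equivalent to $w$ under the type $C$ Knuth relations; its weight equals $\mathrm{wt}(w)$. *)

theory Defs
  imports Main
begin

section \<open>Words over $[\pm n]$\<close>

text \<open>
  The letter $i$ is the integer \<open>i\<close> and the barred letter $\overline i$ is the integer \<open>- i\<close>,
  so that barring is negation.  The order $1 < \dots < n < \overline n < \dots < \overline 1$
  is the integer order on letters of equal sign, with the barred letters put last.
\<close>

definition letters :: "nat \<Rightarrow> int set" where
  "letters n = {x. x \<noteq> 0 \<and> \<bar>x\<bar> \<le> int n}"

definition letter_less :: "int \<Rightarrow> int \<Rightarrow> bool"  (infix "\<prec>" 50) where
  "x \<prec> y \<longleftrightarrow> (0 < x \<and> y < 0) \<or> ((0 < x \<longleftrightarrow> 0 < y) \<and> x < y)"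

definition letter_le :: "int \<Rightarrow> int \<Rightarrow> bool"  (infix "\<preceq>" 50) where
  "x \<preceq> y \<longleftrightarrow> x \<prec> y \<or> x = y"

definition star :: "int list \<Rightarrow> int list" where
  "star w = rev (map uminus w)"

text \<open>
  A vector of $\mathbb Z^n$ is a function on \<open>nat\<close> read at the arguments \<open>1, \<dots>, n\<close>; the weight
  of a word over \<open>letters n\<close> is \<open>0\<close> at all other arguments.
\<close>

definition wt :: "int list \<Rightarrow> nat \<Rightarrow> int" where
  "wt w i = int (count_list w (int i)) - int (count_list w (- int i))"


section \<open>Crystals\<close>

text \<open>
  The index set of every crystal below is \<open>{1..n}\<close>, with \<open>n\<close> an explicit parameter.
  The value \<open>None\<close> of a crystal operator is the symbol $0$.
\<close>

record 'v crystal =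
  vert :: "'v set"
  wgt :: "'v \<Rightarrow> nat \<Rightarrow> int"
  cr_e :: "nat \<Rightarrow> 'v \<Rightarrow> 'v option"
  cr_f :: "nat \<Rightarrow> 'v \<Rightarrow> 'v option"

definition crystal_arrow :: "nat \<Rightarrow> 'v crystal \<Rightarrow> 'v \<Rightarrow> 'v \<Rightarrow> bool" where
  "crystal_arrow n C u v \<longleftrightarrow> u \<in> vert C \<and> v \<in> vert C \<and> (\<exists>i\<in>{1..n}. cr_f C i u = Some v)"

definition component :: "nat \<Rightarrow> 'v crystal \<Rightarrow> 'v \<Rightarrow> 'v crystal" where
  "component n C v = C\<lparr>vert := {u. equivclp (crystal_arrow n C) v u}\<rparr>"

definition dual_crystal :: "'v crystal \<Rightarrow> 'v crystal" where
  "dual_crystal C = C\<lparr>wgt := (\<lambda>u i. - wgt C u i), cr_e := cr_f C, cr_f := cr_e C\<rparr>"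

definition crystal_iso :: "nat \<Rightarrow> ('v \<Rightarrow> 'w) \<Rightarrow> 'v crystal \<Rightarrow> 'w crystal \<Rightarrow> bool" where
  "crystal_iso n \<phi> C D \<longleftrightarrow>
     bij_betw \<phi> (vert C) (vert D) \<and>
     (\<forall>u\<in>vert C. wgt D (\<phi> u) = wgt C u \<and>
       (\<forall>i\<in>{1..n}. cr_e D i (\<phi> u) = map_option \<phi> (cr_e C i u) \<and>
                   cr_f D i (\<phi> u) = map_option \<phi> (cr_f C i u)))"

definition crystal_isomorphic :: "nat \<Rightarrow> 'v crystal \<Rightarrow> 'w crystal \<Rightarrow> bool" where
  "crystal_isomorphic n C D \<longleftrightarrow> (\<exists>\<phi>. crystal_iso n \<phi> C D)"


section \<open>The signature rule and the crystal of words\<close>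

datatype sign = Plus | Minus

definition letter_sign :: "nat \<Rightarrow> nat \<Rightarrow> int \<Rightarrow> sign option" where
  "letter_sign n i x =
     (if x = int i \<or> (i < n \<and> x = - (int i + 1)) then Some Plus
      else if (i < n \<and> x = int i + 1) \<or> x = - int i then Some Minus
      else None)"

text \<open>The signature of a word: the positions (from \<open>0\<close>) of its signed letters, with their signs.\<close>

definition signature :: "nat \<Rightarrow> nat \<Rightarrow> int list \<Rightarrow> (nat \<times> sign) list" where
  "signature n i w = [(k, the (letter_sign n i (w ! k))). k \<leftarrow> [0..<length w], letter_sign n i (w ! k) \<noteq> None]"

text \<open>
  Repeated cancellation of adjacent pairs $+-$.  A reduced tail has the form
  $-\cdots-+\cdots+$, so a \<open>Plus\<close> put in front of it cancels exactly when the tail starts with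
  \<open>Minus\<close>.
\<close>

fun cancel :: "(nat \<times> sign) list \<Rightarrow> (nat \<times> sign) list" where
  "cancel [] = []"
| "cancel (a # s) =
     (case cancel s of
        [] \<Rightarrow> [a]
      | b # t \<Rightarrow> if snd a = Plus \<and> snd b = Minus then t else a # b # t)"

definition lower_letter :: "nat \<Rightarrow> nat \<Rightarrow> int \<Rightarrow> int" where
  "lower_letter n i x =
     (if x = int i then (if i < n then int i + 1 else - int n)
      else if x = - (int i + 1) then - int i
      else x)"

definition raise_letter :: "nat \<Rightarrow> nat \<Rightarrow> int \<Rightarrow> int" where
  "raise_letter n i x =
     (if x = - int i then (if i < n then - (int i + 1) else int n)
      else if x = int i + 1 then int i
      else x)"

definition f_op :: "nat \<Rightarrow> nat \<Rightarrow> int list \<Rightarrow> int list option" where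
  "f_op n i w =
     (case [k. (k, s) \<leftarrow> cancel (signature n i w), s = Plus] of
        [] \<Rightarrow> None
      | ks \<Rightarrow> Some (w[hd ks := lower_letter n i (w ! hd ks)]))"

definition e_op :: "nat \<Rightarrow> nat \<Rightarrow> int list \<Rightarrow> int list option" where
  "e_op n i w =
     (case [k. (k, s) \<leftarrow> cancel (signature n i w), s = Minus] of
        [] \<Rightarrow> None
      | ks \<Rightarrow> Some (w[last ks := raise_letter n i (w ! last ks)]))"

definition word_crystal :: "nat \<Rightarrow> int list crystal" where
  "word_crystal n = \<lparr>vert = lists (letters n), wgt = wt, cr_e = e_op n, cr_f = f_op n\<rparr>"


section \<open>Kashiwara--Nakashima tableaux\<close>

text \<open>
  A column is the list of its entries from top to bottom.  A tableau is the list of its columns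
  from left to right.
\<close>

definition is_column :: "nat \<Rightarrow> int list \<Rightarrow> bool" where
  "is_column n C \<longleftrightarrow> set C \<subseteq> letters n \<and> sorted_wrt (\<prec>) C"

text \<open>
  The one-column condition: whenever $i$ is in row $a$ from the top and $\overline i$ in row $b$
  from the bottom, $a + b \le i$ (rows counted from \<open>1\<close>).
\<close>

definition admissible :: "nat \<Rightarrow> int list \<Rightarrow> bool" where
  "admissible n C \<longleftrightarrow> is_column n C \<and>
     (\<forall>a<length C. \<forall>b<length C. 0 < C ! a \<and> C ! b = - (C ! a) \<longrightarrow>
        int (a + 1) + int (length C - b) \<le> C ! a)"

text \<open>
  The unbarred letters $z_1 > \dots > z_r$ occurring in \<open>C\<close> together with their barred partner,
  and the greedily chosen letters $t_1 > \dots > t_r$: $t_k$ is the greatest unbarred letter with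
  $t_k < \min(t_{k-1}, z_k)$ such that neither $t_k$ nor $\overline{t_k}$ occurs in \<open>C\<close>.
  The one-column condition guarantees that these letters exist; the \<open>Max\<close> of an empty set
  is only met for non-admissible columns, for which \<open>split_letters\<close> is not used.
\<close>

definition paired_letters :: "int list \<Rightarrow> int list" where
  "paired_letters C = rev (sorted_list_of_set {z \<in> set C. 0 < z \<and> - z \<in> set C})"

fun split_letters_from :: "int list \<Rightarrow> int \<Rightarrow> int list \<Rightarrow> int list" where
  "split_letters_from C b [] = []"
| "split_letters_from C b (z # zs) =
     (let t = Max {t. 0 < t \<and> t < min b z \<and> t \<notin> set C \<and> - t \<notin> set C}
      in t # split_letters_from C t zs)"

definition split_letters :: "int list \<Rightarrow> int list" where
  "split_letters C =
     (case paired_letters C of [] \<Rightarrow> [] | z # zs \<Rightarrow> split_letters_from C z (z # zs))"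

definition split_map :: "int list \<Rightarrow> int \<Rightarrow> int" where
  "split_map C z = (case map_of (zip (paired_letters C) (split_letters C)) z of
                      None \<Rightarrow> z | Some t \<Rightarrow> t)"

definition reorder :: "int list \<Rightarrow> int list" where
  "reorder C = sort (filter (\<lambda>x. 0 < x) C) @ sort (filter (\<lambda>x. x < 0) C)"

text \<open>$\ell C$ replaces each $z_k$ by $t_k$; $rC$ replaces each $\overline{z_k}$ by $\overline{t_k}$.\<close>

definition left_column :: "int list \<Rightarrow> int list" where
  "left_column C = reorder (map (split_map C) C)"

definition right_column :: "int list \<Rightarrow> int list" where
  "right_column C = reorder (map (\<lambda>x. - split_map C (- x)) C)"

definition semistandard :: "nat \<Rightarrow> int list list \<Rightarrow> bool" where
  "semistandard n T \<longleftrightarrow>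
     (\<forall>C\<in>set T. C \<noteq> [] \<and> is_column n C) \<and>
     sorted_wrt (\<lambda>C D. length D \<le> length C \<and> (\<forall>r<length D. C ! r \<preceq> D ! r)) T"

definition split_form :: "int list list \<Rightarrow> int list list" where
  "split_form T = concat (map (\<lambda>C. [left_column C, right_column C]) T)"

definition KN_tableau :: "nat \<Rightarrow> int list list \<Rightarrow> bool" where
  "KN_tableau n T \<longleftrightarrow>
     semistandard n T \<and> (\<forall>C\<in>set T. admissible n C) \<and> semistandard n (split_form T)"

text \<open>The shape as a Young diagram: the set of cells (row, column), counted from \<open>0\<close>.\<close>

definition shape :: "int list list \<Rightarrow> (nat \<times> nat) set" where
  "shape T = {(r, c). c < length T \<and> r < length (T ! c)}"

text \<open>Columns are read from right to left, each from top to bottom.\<close>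

definition column_reading :: "int list list \<Rightarrow> int list" where
  "column_reading T = concat (rev T)"

definition tableau_wt :: "int list list \<Rightarrow> nat \<Rightarrow> int" where
  "tableau_wt T = wt (column_reading T)"


section \<open>The plactic congruence of type C\<close>

definition N_count :: "int list \<Rightarrow> int \<Rightarrow> nat" where
  "N_count w z = length (filter (\<lambda>x. x \<preceq> z \<or> - z \<preceq> x) w)"

definition minimal_nonadmissible :: "nat \<Rightarrow> int list \<Rightarrow> bool" where
  "minimal_nonadmissible n w \<longleftrightarrow> is_column n w \<and> \<not> admissible n w \<and>
     (\<forall>u v x. w = u @ v @ x \<and> v \<noteq> w \<longrightarrow> admissible n v)"

definition contractible_letter :: "int list \<Rightarrow> int \<Rightarrow> bool" where
  "contractible_letter w z \<longleftrightarrow>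
     0 < z \<and> z \<in> set w \<and> - z \<in> set w \<and> int (N_count w z) = z + 1"

text \<open>Lecouvey's relations for the type C plactic monoid.\<close>

inductive knuth_rel :: "nat \<Rightarrow> int list \<Rightarrow> int list \<Rightarrow> bool" for n where
  R1a: "\<lbrakk>{x, y, z} \<subseteq> letters n; x \<preceq> y; y \<prec> z; z \<noteq> - x\<rbrakk>
        \<Longrightarrow> knuth_rel n [y, z, x] [y, x, z]"
| R1b: "\<lbrakk>{x, y, z} \<subseteq> letters n; x \<prec> y; y \<preceq> z; z \<noteq> - x\<rbrakk>
        \<Longrightarrow> knuth_rel n [x, z, y] [z, x, y]"
| R2a: "\<lbrakk>1 < x; x \<le> int n; y \<in> letters n; x \<preceq> y; y \<preceq> - x\<rbrakk>
        \<Longrightarrow> knuth_rel n [y, - (x - 1), x - 1] [y, x, - x]"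
| R2b: "\<lbrakk>1 < x; x \<le> int n; y \<in> letters n; x \<preceq> y; y \<preceq> - x\<rbrakk>
        \<Longrightarrow> knuth_rel n [x, - x, y] [- (x - 1), x - 1, y]"
| R3: "\<lbrakk>minimal_nonadmissible n w; contractible_letter w z;
         \<forall>z'. contractible_letter w z' \<longrightarrow> z \<le> z'\<rbrakk>
        \<Longrightarrow> knuth_rel n w (filter (\<lambda>x. x \<noteq> z \<and> x \<noteq> - z) w)"

inductive knuth_step :: "nat \<Rightarrow> int list \<Rightarrow> int list \<Rightarrow> bool" for n where
  "\<lbrakk>knuth_rel n l r; u \<in> lists (letters n); v \<in> lists (letters n)\<rbrakk>
   \<Longrightarrow> knuth_step n (u @ l @ v) (u @ r @ v)"

definition plactic_equiv :: "nat \<Rightarrow> int list \<Rightarrow> int list \<Rightarrow> bool" where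
  "plactic_equiv n = equivclp (knuth_step n)"

definition P_tableau :: "nat \<Rightarrow> int list \<Rightarrow> int list list" where
  "P_tableau n w = (THE T. KN_tableau n T \<and> plactic_equiv n (column_reading T) w)"

end

(*
  The plactic relations commute with the crystal operators, so plactically equivalent words generate
  isomorphic components.  Every highest weight word is plactically equivalent to a product of columns
  1 2 ... h, and Kashiwara-Nakashima tableaux of a fixed shape are stable under e_i and f_i with
  exactly one highest weight element, whose columns are 1 2 ... h.  Hence every plactic class
  contains exactly one tableau, and its shape determines the component.  Since star exchanges e_i and
  f_i and preserves the plactic congruence, the shape of P(star w) is found by applying star to the lowest
  weight tableau of the shape of P(w): its columns are the words star (1 2 ... h), so the result is
  again a product of the columns 1 2 ... h of that shape.

  Stability of tableaux is shown by eliminating the split columns: with P_C(q) and N_C(q) counting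
  the letters 1, ..., q and their bars in C, and h_C(q) = P_C(q) + N_C(q) - q, the condition rC <= lD
  is a family of linear inequalities between P_C, N_D, h_C and h_D.
*)
theory Submission
  imports Defs "HOL-Library.Multiset"
begin

section \<open>Crystal operators as recursive functions\<close>

text \<open>That the shape determines the component up to isomorphism hides a rigidity statement.
  The isomorphism sends a word to the plactically equivalent word of the other component, and this
  is a well-defined injective map only if a plactic class meets a component at most once. Climbing
  with the \<open>e_op\<close> reduces this to the uniqueness of the highest weight word of a
  component. That in turn comes from prefixes: an operator acts on a prefix as the same operator or
  leaves it alone, so the shapes of \<open>P_tableau\<close> of all prefixes are constant along the
  component.

  Two obstacles shape the compatibility of the relations with \<open>f_op\<close>. The relations are
  not stable one by one: an instance of R1 may be carried to one of R2, so they are treated as a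
  single relation on triples. And R3 concerns columns of any length, in which \<open>f_op\<close>
  may move the contracted letter; the function \<open>excess\<close> (called h_C above) locates this
  letter and controls its motion.

  Only \<open>f_op\<close> and \<open>phi\<close> are studied directly on relations and columns; the
  statements on \<open>e_op\<close> and \<open>eps\<close> are obtained from them through
  \<open>star\<close>.\<close>

abbreviation (input) words :: "nat \<Rightarrow> int list set" where
  "words n \<equiv> lists (letters n)"

definition plus_of :: "nat \<Rightarrow> nat \<Rightarrow> int \<Rightarrow> nat" where
  "plus_of n i x = (if letter_sign n i x = Some Plus then 1 else 0)"

definition minus_of :: "nat \<Rightarrow> nat \<Rightarrow> int \<Rightarrow> nat" where
  "minus_of n i x = (if letter_sign n i x = Some Minus then 1 else 0)"

text \<open>\<open>eps\<close> and \<open>phi\<close> are the string lengths of crystal theory.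
  Truncated subtraction carries the cancellation: a \<open>Plus\<close> put in front uses up one
  uncancelled \<open>Minus\<close> of the tail, if there is one.\<close>

primrec eps :: "nat \<Rightarrow> nat \<Rightarrow> int list \<Rightarrow> nat" where
  "eps n i [] = 0"
| "eps n i (x # w) = minus_of n i x + (eps n i w - plus_of n i x)"

primrec phi :: "nat \<Rightarrow> nat \<Rightarrow> int list \<Rightarrow> nat" where
  "phi n i [] = 0"
| "phi n i (x # w) = phi n i w + (plus_of n i x - eps n i w)"

section \<open>Uncancelled signs and the recursive form of the operators\<close>

definition marked :: "sign \<Rightarrow> (nat \<times> sign) list \<Rightarrow> nat list" where
  "marked a s = [k. (k, b) \<leftarrow> s, b = a]"

abbreviation "minuses \<equiv> marked Minus"
abbreviation "pluses \<equiv> marked Plus"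

lemma marked_simps [simp]:
  "marked a [] = []" "marked a ((k, b) # s) = (if a = b then [k] else []) @ marked a s"
  "marked a (s @ t) = marked a s @ marked a t"
  by (simp_all add: marked_def)

lemma sign_not [simp]: "(a \<noteq> Plus) = (a = Minus)" "(a \<noteq> Minus) = (a = Plus)"
  by (cases a; simp)+

lemma cancel_map_fst: "cancel (map (apfst g) s) = map (apfst g) (cancel s)"
  by (induction s) (auto split: list.splits)

lemma marked_map [simp]: "marked a (map (apfst g) s) = map g (marked a s)"
  by (induction s) (auto simp: marked_def split: prod.splits)

lemma cancel_normal_form: "\<exists>a b. cancel s = map (\<lambda>k. (k, Minus)) a @ map (\<lambda>k. (k, Plus)) b"
proof (induction s)
  case Nil
  then show ?case by simp
next
  case (Cons x s)
  then obtain a b where ab: "cancel s = map (\<lambda>k. (k, Minus)) a @ map (\<lambda>k. (k, Plus)) b" by blast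
  obtain k t where x: "x = (k, t)" by force
  show ?case
  proof (cases t)
    case Minus
    then have "cancel (x # s) = map (\<lambda>k. (k, Minus)) (k # a) @ map (\<lambda>k. (k, Plus)) b"
      using ab x by (auto split: list.splits)
    then show ?thesis by blast
  next
    case Plus
    show ?thesis
    proof (cases a)
      case Nil
      then have "cancel (x # s) = map (\<lambda>k. (k, Minus)) [] @ map (\<lambda>k. (k, Plus)) (k # b)"
        using ab x Plus by (auto split: list.splits)
      then show ?thesis by blast
    next
      case (Cons m a')
      then have "cancel (x # s) = map (\<lambda>k. (k, Minus)) a' @ map (\<lambda>k. (k, Plus)) b"
        using ab x Plus by simp
      then show ?thesis by blast
    qed
  qed
qed

lemma marked_const [simp]: "marked a (map (\<lambda>k. (k, b)) ks) = (if a = b then ks else [])"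
  by (induction ks) auto

lemma cancel_Cons_Minus:
  "minuses (cancel ((k, Minus) # s)) = k # minuses (cancel s)"
  "pluses (cancel ((k, Minus) # s)) = pluses (cancel s)"
  by (auto split: list.splits)

lemma cancel_Cons_Plus:
  "minuses (cancel ((k, Plus) # s)) = tl (minuses (cancel s))"
  "pluses (cancel ((k, Plus) # s)) =
    (if minuses (cancel s) = [] then k # pluses (cancel s) else pluses (cancel s))"
proof -
  obtain a b where ab: "cancel s = map (\<lambda>k. (k, Minus)) a @ map (\<lambda>k. (k, Plus)) b"
    using cancel_normal_form by blast
  show "minuses (cancel ((k, Plus) # s)) = tl (minuses (cancel s))"
    using ab by (cases a; cases b) auto
  show "pluses (cancel ((k, Plus) # s)) =
    (if minuses (cancel s) = [] then k # pluses (cancel s) else pluses (cancel s))"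
    using ab by (cases a; cases b) auto
qed

lemma signature_Nil [simp]: "signature n i [] = []"
  by (simp add: signature_def)

lemma signature_Cons:
  "signature n i (x # w) =
     (case letter_sign n i x of None \<Rightarrow> [] | Some s \<Rightarrow> [(0, s)]) @ map (apfst Suc) (signature n i w)"
proof -
  have "[0..<length (x # w)] = 0 # map Suc [0..<length w]"
    by (metis length_Cons map_Suc_upt upt_conv_Cons zero_less_Suc)
  then show ?thesis
    by (auto simp: signature_def map_concat comp_def split: option.splits
        intro!: arg_cong[where f = concat] map_cong)
qed

definition mpos :: "nat \<Rightarrow> nat \<Rightarrow> int list \<Rightarrow> nat list" where
  "mpos n i w = minuses (cancel (signature n i w))"

definition ppos :: "nat \<Rightarrow> nat \<Rightarrow> int list \<Rightarrow> nat list" where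
  "ppos n i w = pluses (cancel (signature n i w))"

lemma mpos_Nil [simp]: "mpos n i [] = []" by (simp add: mpos_def)
lemma ppos_Nil [simp]: "ppos n i [] = []" by (simp add: ppos_def)

lemma mpos_Cons:
  "mpos n i (x # w) =
     (case letter_sign n i x of None \<Rightarrow> map Suc (mpos n i w)
      | Some Plus \<Rightarrow> tl (map Suc (mpos n i w))
      | Some Minus \<Rightarrow> 0 # map Suc (mpos n i w))"
  by (auto simp: mpos_def signature_Cons cancel_Cons_Minus cancel_Cons_Plus cancel_map_fst
      simp del: cancel.simps(2) split: option.splits sign.splits)

lemma ppos_Cons:
  "ppos n i (x # w) =
     (if letter_sign n i x = Some Plus \<and> mpos n i w = [] then 0 # map Suc (ppos n i w)
      else map Suc (ppos n i w))"
proof (cases "letter_sign n i x")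
  case None
  then show ?thesis by (simp add: ppos_def signature_Cons cancel_map_fst)
next
  case (Some a)
  then show ?thesis
    by (cases a) (auto simp: mpos_def ppos_def signature_Cons cancel_Cons_Minus cancel_Cons_Plus
        cancel_map_fst simp del: cancel.simps(2))
qed

lemma length_mpos: "length (mpos n i w) = eps n i w"
  by (induction w) (auto simp: mpos_Cons minus_of_def plus_of_def split: option.splits sign.splits)

lemma length_ppos: "length (ppos n i w) = phi n i w"
  by (induction w) (auto simp: ppos_Cons plus_of_def length_mpos[symmetric] Suc_le_eq)

lemma f_op_ppos:
  "f_op n i w = (if ppos n i w = [] then None
     else Some (w[hd (ppos n i w) := lower_letter n i (w ! hd (ppos n i w))]))"
  unfolding f_op_def ppos_def[unfolded marked_def, symmetric] by (auto split: list.splits)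

lemma e_op_mpos:
  "e_op n i w = (if mpos n i w = [] then None
     else Some (w[last (mpos n i w) := raise_letter n i (w ! last (mpos n i w))]))"
  unfolding e_op_def mpos_def[unfolded marked_def, symmetric] by (auto split: list.splits)

lemma f_op_Nil [simp]: "f_op n i [] = None" by (simp add: f_op_ppos)
lemma e_op_Nil [simp]: "e_op n i [] = None" by (simp add: e_op_mpos)

text \<open>The head holds the leftmost uncancelled \<open>Plus\<close> exactly when the tail has no
  uncancelled \<open>Minus\<close> left to cancel it. With this form the positions in the signature
  are no longer needed.\<close>

lemma f_op_Cons:
  "f_op n i (x # w) = (if plus_of n i x > eps n i w then Some (lower_letter n i x # w)
     else map_option ((#) x) (f_op n i w))"
  by (auto simp: f_op_ppos ppos_Cons plus_of_def length_mpos[symmetric] hd_map)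

lemma e_op_Cons:
  "e_op n i (x # w) = (if eps n i w > plus_of n i x then map_option ((#) x) (e_op n i w)
     else if minus_of n i x = 1 then Some (raise_letter n i x # w) else None)"
proof -
  \<comment> \<open>A \<open>Plus\<close> at the head cancels the leftmost \<open>Minus\<close> of
    the tail, while \<open>e_op\<close> acts on the rightmost; the latter survives as soon as there
    are two.\<close>
  have *: "xs \<noteq> [] \<Longrightarrow> length xs \<noteq> Suc 0 \<Longrightarrow> tl xs \<noteq> [] \<and> last (tl xs) = last xs" for xs :: "nat list"
    by (cases xs) auto
  show ?thesis
    by (cases "mpos n i w"; cases "tl (mpos n i w)")
      (auto simp: e_op_mpos mpos_Cons plus_of_def minus_of_def length_mpos[symmetric] last_map
       split: option.splits sign.splits)
qed

lemma plus_of_minus_of [simp]: "plus_of n i x * minus_of n i x = 0"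
  by (simp add: plus_of_def minus_of_def)

lemma plus_of_iff: "plus_of n i x = Suc 0 \<longleftrightarrow> x = int i \<or> i < n \<and> x = - (int i + 1)"
  unfolding plus_of_def letter_sign_def by simp

lemma plus_of_le: "plus_of n i x \<le> 1" and minus_of_le: "minus_of n i x \<le> 1"
  by (simp_all add: plus_of_def minus_of_def)

text \<open>The tensor product rule: the uncancelled \<open>Plus\<close> signs of \<open>u\<close>
  meet the uncancelled \<open>Minus\<close> signs of \<open>v\<close>, and nothing else can
  cancel.\<close>

lemma eps_append: "eps n i (u @ v) = eps n i u + (eps n i v - phi n i u)"
  and phi_append: "phi n i (u @ v) = phi n i v + (phi n i u - eps n i v)"
proof (induction u)
  case (Cons x u)
  case 1 show ?case using Cons by simp
next
  case (Cons x u)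
  case 2 show ?case using Cons by simp
qed auto

lemma f_op_None_iff: "f_op n i w = None \<longleftrightarrow> phi n i w = 0"
  by (simp add: f_op_ppos length_ppos[symmetric])

lemma e_op_None_iff: "e_op n i w = None \<longleftrightarrow> eps n i w = 0"
  by (simp add: e_op_mpos length_mpos[symmetric])

lemma f_op_append:
  "f_op n i (u @ v) = (if phi n i u > eps n i v then map_option (\<lambda>u'. u' @ v) (f_op n i u)
     else map_option ((@) u) (f_op n i v))"
proof (induction u)
  case (Cons x u)
  show ?case
    using Cons plus_of_le[of n i x]
    by (auto simp: f_op_Cons eps_append option.map_comp comp_def f_op_None_iff)
qed (cases "f_op n i v"; simp)

lemma lower_letter_props:
  assumes "plus_of n i x = 1" "1 \<le> i" "i \<le> n"
  shows "minus_of n i (lower_letter n i x) = 1" "raise_letter n i (lower_letter n i x) = x"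
    "lower_letter n i x \<in> letters n" "x \<in> letters n"
proof -
  have "x = int i \<or> i < n \<and> x = - (int i + 1)" using assms(1) by (simp add: plus_of_iff)
  then consider "x = int i" "i < n" | "x = int n" "i = n" | "x = - (int i + 1)" "i < n"
    using assms(3) le_neq_implies_less by blast
  note cases = this
  show "minus_of n i (lower_letter n i x) = 1" "raise_letter n i (lower_letter n i x) = x"
    "lower_letter n i x \<in> letters n" "x \<in> letters n"
    using assms(2,3) by (cases rule: cases;
      simp add: minus_of_def letter_sign_def lower_letter_def raise_letter_def letters_def)+
qed

lemma minus_of_iff: "1 \<le> i \<Longrightarrow> minus_of n i x = Suc 0 \<longleftrightarrow> x = - int i \<or> i < n \<and> x = int i + 1"
  unfolding minus_of_def letter_sign_def by auto

lemma minus_of_neg: "i \<ge> 1 \<Longrightarrow> minus_of n i (- x) = plus_of n i x"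
  and plus_of_neg: "i \<ge> 1 \<Longrightarrow> plus_of n i (- x) = minus_of n i x"
  by (auto simp: minus_of_def plus_of_def letter_sign_def)

lemma lower_letter_neg:
  "minus_of n i x = 1 \<Longrightarrow> 1 \<le> i \<Longrightarrow> i \<le> n \<Longrightarrow> lower_letter n i (- x) = - raise_letter n i x"
  by (auto simp: minus_of_def letter_sign_def lower_letter_def raise_letter_def split: if_splits)

lemma f_op_inverse:
  assumes "f_op n i w = Some w'" "1 \<le> i" "i \<le> n"
  shows "e_op n i w' = Some w \<and> eps n i w' = Suc (eps n i w) \<and> Suc (phi n i w') = phi n i w"
  using assms(1)
proof (induction w arbitrary: w')
  case (Cons x w)
  show ?case
  proof (cases "plus_of n i x > eps n i w")
    case True
    then have x: "plus_of n i x = 1" "eps n i w = 0" using plus_of_le[of n i x] by auto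
    note l = lower_letter_props[OF x(1) assms(2,3)]
    have "plus_of n i (lower_letter n i x) = 0" "minus_of n i x = 0"
      using l(1) x(1) plus_of_minus_of[of n i "lower_letter n i x"] plus_of_minus_of[of n i x] by auto
    then show ?thesis using Cons.prems True x l by (auto simp: f_op_Cons e_op_Cons)
  next
    case False
    then obtain v where v: "f_op n i w = Some v" "w' = x # v"
      using Cons.prems by (auto simp: f_op_Cons)
    show ?thesis using Cons.IH[OF v(1)] False v by (auto simp: e_op_Cons)
  qed
qed simp

section \<open>The involution \<open>star\<close> and the crystal operators\<close>

lemma star_Nil [simp]: "star [] = []" by (simp add: star_def)
lemma star_Cons: "star (x # w) = star w @ [- x]" by (simp add: star_def)
lemma star_append: "star (u @ v) = star v @ star u" by (simp add: star_def)
lemma star_star [simp]: "star (star w) = w" by (simp add: star_def rev_map comp_def)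
lemma star_eq_iff [simp]: "star u = star v \<longleftrightarrow> u = v" by (metis star_star)
lemma set_star: "set (star w) = uminus ` set w" by (simp add: star_def)
lemma length_star [simp]: "length (star w) = length w" by (simp add: star_def)

lemma star_letters [simp]: "star w \<in> words n \<longleftrightarrow> w \<in> words n"
  by (auto simp: in_lists_conv_set set_star letters_def)

text \<open>Barring swaps the two signs and reversal swaps their order, so cancelling pairs go to
  cancelling pairs and the roles of the uncancelled signs are exchanged.\<close>

lemma eps_star: "i \<ge> 1 \<Longrightarrow> eps n i (star w) = phi n i w"
  and phi_star: "i \<ge> 1 \<Longrightarrow> phi n i (star w) = eps n i w"
proof (induction w)
  case (Cons x w)
  case 1 show ?case using Cons 1 by (simp add: star_Cons eps_append minus_of_neg)
next
  case (Cons x w)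
  case 2 show ?case using Cons 2 by (simp add: star_Cons phi_append plus_of_neg minus_of_neg)
qed simp_all

lemma f_op_star:
  assumes "1 \<le> i" "i \<le> n"
  shows "f_op n i (star w) = map_option star (e_op n i w)"
proof (induction w)
  case (Cons x w)
  have "f_op n i [- x] = (if minus_of n i x = 1 then Some [- raise_letter n i x] else None)"
    using assms minus_of_le[of n i x] by (auto simp: f_op_Cons plus_of_neg lower_letter_neg)
  then show ?case
    using Cons assms minus_of_le[of n i x]
    by (auto simp: star_Cons f_op_append e_op_Cons phi_star minus_of_neg option.map_comp comp_def)
qed simp

lemma e_op_star:
  assumes "1 \<le> i" "i \<le> n"
  shows "e_op n i (star w) = map_option star (f_op n i w)"
  using f_op_star[OF assms, of "star w"]
  by (cases "e_op n i (star w)") (auto simp: option.map_comp comp_def option.map_ident)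

lemma e_op_inverse:
  assumes "e_op n i w = Some w'" "1 \<le> i" "i \<le> n"
  shows "f_op n i w' = Some w \<and> Suc (eps n i w') = eps n i w \<and> phi n i w' = Suc (phi n i w)"
  using f_op_inverse[of n i "star w" "star w'"] assms
  by (auto simp: f_op_star e_op_star eps_star phi_star)

lemma f_op_letters:
  assumes "f_op n i w = Some w'" "1 \<le> i" "i \<le> n" "w \<in> words n"
  shows "w' \<in> words n"
  using assms(1,4)
proof (induction w arbitrary: w')
  case (Cons x w)
  show ?case
  proof (cases "plus_of n i x > eps n i w")
    case True
    then have "plus_of n i x = 1" using plus_of_le[of n i x] by auto
    from lower_letter_props[OF this assms(2,3)] show ?thesis
      using Cons.prems True by (auto simp: f_op_Cons)
  qed (use Cons in \<open>auto simp: f_op_Cons\<close>)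
qed simp

lemma e_op_letters:
  assumes "e_op n i w = Some w'" "1 \<le> i" "i \<le> n" "w \<in> words n"
  shows "w' \<in> words n"
  using f_op_letters[of n i "star w" "star w'"] assms by (simp add: f_op_star)

lemma length_f_op: "f_op n i w = Some w' \<Longrightarrow> length w' = length w"
  by (auto simp: f_op_ppos split: if_splits)

lemma length_e_op: "e_op n i w = Some w' \<Longrightarrow> length w' = length w"
  by (auto simp: e_op_mpos split: if_splits)

section \<open>Weights and string lengths\<close>

lemma wt_Nil [simp]: "wt [] j = 0" by (simp add: wt_def)
lemma wt_append: "wt (u @ v) j = wt u j + wt v j" by (simp add: wt_def)

lemma wt_star: "wt (star w) = (\<lambda>j. - wt w j)"
proof -
  have "count_list (map uminus w) x = count_list w (- x)" for x :: int
    by (induction w) auto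
  then show ?thesis by (auto simp: wt_def star_def)
qed

text \<open>Each cancellation removes one sign of each kind, so the difference can be computed
  letter by letter on the whole signature.\<close>

lemma wt_eps_phi:
  assumes "1 \<le> i" "i \<le> n"
  shows "int (phi n i w) - int (eps n i w) = wt w i - (if i < n then wt w (Suc i) else 0)"
proof (induction w)
  case (Cons x w)
  have "int (phi n i (x # w)) - int (eps n i (x # w)) =
    int (plus_of n i x) - int (minus_of n i x) + (int (phi n i w) - int (eps n i w))"
    by simp
  also have "int (plus_of n i x) - int (minus_of n i x) = wt [x] i - (if i < n then wt [x] (Suc i) else 0)"
    using assms by (auto simp: plus_of_def minus_of_def letter_sign_def wt_def)
  finally show ?case using Cons wt_append[of "[x]" w] by simp
qed (simp add: wt_def)

lemma wt_outside:
  assumes "w \<in> words n" "i = 0 \<or> n < i"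
  shows "wt w i = 0"
proof (cases "i = 0")
  case False
  then have "int i \<notin> set w" "- int i \<notin> set w" using assms by (auto simp: letters_def in_lists_conv_set)
  then show ?thesis by (simp add: wt_def count_list_0_iff)
qed (simp add: wt_def)

text \<open>The equations \<open>wt_eps_phi\<close> form a triangular system for the weight, solved
  from \<open>i = n\<close> downwards.\<close>

lemma wt_eqI:
  assumes "u \<in> words n" "v \<in> words n"
    and "\<And>i. 1 \<le> i \<Longrightarrow> i \<le> n \<Longrightarrow> phi n i u = phi n i v \<and> eps n i u = eps n i v"
  shows "wt u = wt v"
proof
  have "k \<le> n \<Longrightarrow> 1 \<le> n - k \<Longrightarrow> wt u (n - k) = wt v (n - k)" for k
  proof (induction k)
    case 0
    then show ?case using wt_eps_phi[of n n u] wt_eps_phi[of n n v] assms(3)[of n] by simp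
  next
    case (Suc k)
    have "Suc (n - Suc k) = n - k" "n - Suc k < n" using Suc.prems by auto
    then show ?case using Suc wt_eps_phi[of "n - Suc k" n u] wt_eps_phi[of "n - Suc k" n v]
        assms(3)[of "n - Suc k"] by auto
  qed
  from this[of "n - i" for i] show "wt u i = wt v i" for i
    using wt_outside[OF assms(1), of i] wt_outside[OF assms(2), of i]
    by (cases "i = 0 \<or> n < i") (auto, metis One_nat_def Suc_leI diff_diff_cancel diff_le_self not_less)
qed

section \<open>Words of length three\<close>

text \<open>Letters are replaced by their positions \<open>1, \<dots>, 2 * n\<close> in the alphabet, so that barring becomes
  \<open>p \<mapsto> 2 * n + 1 - p\<close>.  With \<open>j = 2 * n - i\<close>, the positions of sign \<open>+\<close> are \<open>i\<close> and \<open>j\<close>, those of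
  sign \<open>-\<close> are \<open>i + 1\<close> and \<open>j + 1\<close>, and $f_i$ adds \<open>1\<close>; the case \<open>i = n\<close> is \<open>i = j\<close>.\<close>

definition f_triple :: "int \<Rightarrow> int \<Rightarrow> int \<times> int \<times> int \<Rightarrow> (int \<times> int \<times> int) option" where
  "f_triple i j = (\<lambda>(a, b, c).
     if (a = i \<or> a = j) \<and> \<not> (b = i + 1 \<or> b = j + 1) \<and> (c = i + 1 \<or> c = j + 1 \<longrightarrow> b = i \<or> b = j) then Some (a + 1, b, c)
     else if (b = i \<or> b = j) \<and> \<not> (c = i + 1 \<or> c = j + 1) then Some (a, b + 1, c)
     else if (c = i \<or> c = j) then Some (a, b, c + 1) else None)"

text \<open>For \<open>N = 2 * n + 1\<close> two letters are each other's bars exactly when their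
  positions add up to \<open>N\<close>. The two disjuncts are R1a and R2a written with positions; in
  \<open>ktriple_b\<close> they are R1b and R2b.\<close>

definition ktriple_a :: "int \<Rightarrow> int \<times> int \<times> int \<Rightarrow> int \<times> int \<times> int \<Rightarrow> bool" where
  "ktriple_a N = (\<lambda>(a, b, c) (a', b', c'). a = a' \<and>
     (c \<le> a \<and> a < b \<and> b + c \<noteq> N \<and> b' = c \<and> c' = b \<or>
      c < a \<and> a < b \<and> b + c = N \<and> b' = c + 1 \<and> c' = b - 1))"

definition ktriple_b :: "int \<Rightarrow> int \<times> int \<times> int \<Rightarrow> int \<times> int \<times> int \<Rightarrow> bool" where
  "ktriple_b N = (\<lambda>(a, b, c) (a', b', c'). c = c' \<and>
     (a < c \<and> c \<le> b \<and> a + b \<noteq> N \<and> a' = b \<and> b' = a \<or>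
      b' < c \<and> c < a' \<and> a' + b' = N \<and> a = b' + 1 \<and> b = a' - 1))"

definition ktriple :: "int \<Rightarrow> int \<times> int \<times> int \<Rightarrow> int \<times> int \<times> int \<Rightarrow> bool" where
  "ktriple N s t \<longleftrightarrow> ktriple_a N s t \<or> ktriple_b N s t"






definition unsigned :: "int \<Rightarrow> int \<Rightarrow> int \<Rightarrow> bool" where
  "unsigned i j c \<longleftrightarrow> c \<noteq> i \<and> c \<noteq> i + 1 \<and> c \<noteq> j \<and> c \<noteq> j + 1"

lemma letter_kinds:
  fixes c i j :: int
  assumes "c = i \<Longrightarrow> P" "c = i + 1 \<Longrightarrow> P" "c = j \<Longrightarrow> P" "c = j + 1 \<Longrightarrow> P" "unsigned i j c \<Longrightarrow> P"
  shows P
  using assms unfolding unsigned_def by blast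

text \<open>\<open>f_triple\<close> sees only whether a letter is at \<open>i\<close>,
  \<open>i + 1\<close>, \<open>j\<close>, \<open>j + 1\<close> or elsewhere, so five kinds per
  letter suffice. The conclusion needs the union of the relations: for \<open>c = i < j = b\<close>
  and an unsigned \<open>a\<close>, the images are \<open>(a, j + 1, i)\<close> and
  \<open>(a, i + 1, j)\<close>, an instance of R2a.\<close>

lemma f_triple_R1a:
  fixes i j a b c :: int
  assumes "i = j \<or> i + 2 \<le> j" "c \<le> a" "a < b" "b + c \<noteq> i + j + 1"
  shows "rel_option (ktriple (i + j + 1)) (f_triple i j (a, b, c)) (f_triple i j (a, c, b))"
  by (insert assms, (elim disjE; rule letter_kinds[where c = c and i = i and j = j];
      rule letter_kinds[where c = b and i = i and j = j];
      rule letter_kinds[where c = a and i = i and j = j]; hypsubst_thin?;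
      unfold f_triple_def ktriple_def ktriple_a_def ktriple_b_def unsigned_def; (auto; fail)?))

lemma f_triple_R1b:
  fixes i j a b c :: int
  assumes "i = j \<or> i + 2 \<le> j" "a < c" "c \<le> b" "a + b \<noteq> i + j + 1"
  shows "rel_option (ktriple (i + j + 1)) (f_triple i j (a, b, c)) (f_triple i j (b, a, c))"
  by (insert assms, (elim disjE; rule letter_kinds[where c = c and i = i and j = j];
      rule letter_kinds[where c = b and i = i and j = j];
      rule letter_kinds[where c = a and i = i and j = j]; hypsubst_thin?;
      unfold f_triple_def ktriple_def ktriple_a_def ktriple_b_def unsigned_def; (auto; fail)?))

lemma f_triple_R2a:
  fixes i j a b c :: int
  assumes "i = j \<or> i + 2 \<le> j" "c < a" "a < b" "b + c = i + j + 1"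
  shows "rel_option (ktriple (i + j + 1)) (f_triple i j (a, b, c)) (f_triple i j (a, c + 1, b - 1))"
proof -
  have c: "c = i + j + 1 - b" using assms by simp
  from assms show ?thesis unfolding c f_triple_def ktriple_def ktriple_a_def ktriple_b_def
    by (elim disjE) (auto split: if_splits)
qed

lemma f_triple_R2b:
  fixes i j a b c :: int
  assumes "i = j \<or> i + 2 \<le> j" "b < c" "c < a" "a + b = i + j + 1"
  shows "rel_option (ktriple (i + j + 1)) (f_triple i j (b + 1, a - 1, c)) (f_triple i j (a, b, c))"
proof -
  have b: "b = i + j + 1 - a" using assms by simp
  from assms show ?thesis unfolding b f_triple_def ktriple_def ktriple_a_def ktriple_b_def
    by (elim disjE) (auto split: if_splits)
qed

lemma f_triple_knuth:
  fixes i j :: int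
  assumes "i = j \<or> i + 2 \<le> j" "ktriple (i + j + 1) s t"
  shows "rel_option (ktriple (i + j + 1)) (f_triple i j s) (f_triple i j t)"
proof -
  obtain a b c a' b' c' where st: "s = (a, b, c)" "t = (a', b', c')" by (metis prod_cases3)
  consider (1) "c \<le> a" "a < b" "b + c \<noteq> i + j + 1" "t = (a, c, b)"
    | (2) "c < a" "a < b" "b + c = i + j + 1" "t = (a, c + 1, b - 1)"
    | (3) "a < c" "c \<le> b" "a + b \<noteq> i + j + 1" "t = (b, a, c)"
    | (4) "b' < c'" "c' < a'" "a' + b' = i + j + 1" "s = (b' + 1, a' - 1, c')"
    using assms(2) st unfolding ktriple_def ktriple_a_def ktriple_b_def by auto
  then show ?thesis
  proof cases
    case 1 then show ?thesis using f_triple_R1a[OF assms(1)] st by simp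
  next
    case 2 then show ?thesis using f_triple_R2a[OF assms(1)] st by simp
  next
    case 3 then show ?thesis using f_triple_R1b[OF assms(1)] st by simp
  next
    case 4 then show ?thesis using f_triple_R2b[OF assms(1)] st by simp
  qed
qed

definition pos :: "nat \<Rightarrow> int \<Rightarrow> int" where
  "pos n x = (if 0 < x then x else 2 * int n + 1 + x)"

lemma pos_less_iff: "x \<in> letters n \<Longrightarrow> y \<in> letters n \<Longrightarrow> pos n x < pos n y \<longleftrightarrow> x \<prec> y"
  by (auto simp: pos_def letters_def letter_less_def)

lemma pos_le_iff: "x \<in> letters n \<Longrightarrow> y \<in> letters n \<Longrightarrow> pos n x \<le> pos n y \<longleftrightarrow> x \<preceq> y"
  by (auto simp: pos_def letters_def letter_less_def letter_le_def)

lemma pos_eq_iff: "x \<in> letters n \<Longrightarrow> y \<in> letters n \<Longrightarrow> pos n x = pos n y \<longleftrightarrow> x = y"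
  by (auto simp: pos_def letters_def)

lemma pos_neg: "x \<in> letters n \<Longrightarrow> pos n (- x) = 2 * int n + 1 - pos n x"
  by (auto simp: pos_def letters_def)

lemma neg_letters [simp]: "- x \<in> letters n \<longleftrightarrow> x \<in> letters n"
  by (auto simp: letters_def)

lemma pos_plus_of:
  "x \<in> letters n \<Longrightarrow> 1 \<le> i \<Longrightarrow> i \<le> n \<Longrightarrow>
    plus_of n i x = Suc 0 \<longleftrightarrow> pos n x = int i \<or> pos n x = 2 * int n - int i"
  by (auto simp: plus_of_iff pos_def letters_def)

lemma pos_minus_of:
  "x \<in> letters n \<Longrightarrow> 1 \<le> i \<Longrightarrow> i \<le> n \<Longrightarrow>
    minus_of n i x = Suc 0 \<longleftrightarrow> pos n x = int i + 1 \<or> pos n x = 2 * int n - int i + 1"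
  by (auto simp: minus_of_iff pos_def letters_def)

lemma pos_lower:
  "x \<in> letters n \<Longrightarrow> 1 \<le> i \<Longrightarrow> i \<le> n \<Longrightarrow> plus_of n i x = Suc 0 \<Longrightarrow> pos n (lower_letter n i x) = pos n x + 1"
  by (auto simp: plus_of_iff pos_def letters_def lower_letter_def)

lemma f_op_triple:
  assumes "x \<in> letters n" "y \<in> letters n" "z \<in> letters n" "1 \<le> i" "i \<le> n"
  shows "rel_option (\<lambda>w s. \<exists>x y z. w = [x, y, z] \<and> w \<in> words n \<and> s = (pos n x, pos n y, pos n z))
    (f_op n i [x, y, z]) (f_triple (int i) (2 * int n - int i) (pos n x, pos n y, pos n z))"
proof -
  have *: "plus_of n i u = Suc 0 \<or> plus_of n i u = 0" "minus_of n i u = Suc 0 \<or> minus_of n i u = 0" for u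
    using plus_of_le[of n i u] minus_of_le[of n i u] by linarith+
  have l: "plus_of n i u = Suc 0 \<Longrightarrow> lower_letter n i u \<in> letters n" for u
    using lower_letter_props(3)[of n i u] assms by simp
  note pm = pos_plus_of[OF assms(1,4,5), symmetric] pos_plus_of[OF assms(2,4,5), symmetric] pos_plus_of[OF assms(3,4,5), symmetric]
    pos_minus_of[OF assms(1,4,5), symmetric] pos_minus_of[OF assms(2,4,5), symmetric] pos_minus_of[OF assms(3,4,5), symmetric]
  have "f_triple (int i) (2 * int n - int i) (pos n x, pos n y, pos n z) =
     (if plus_of n i x = Suc 0 \<and> minus_of n i y \<noteq> Suc 0 \<and> (minus_of n i z = Suc 0 \<longrightarrow> plus_of n i y = Suc 0) then Some (pos n x + 1, pos n y, pos n z)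
     else if plus_of n i y = Suc 0 \<and> minus_of n i z \<noteq> Suc 0 then Some (pos n x, pos n y + 1, pos n z)
     else if plus_of n i z = Suc 0 then Some (pos n x, pos n y, pos n z + 1) else None)"
    unfolding f_triple_def case_prod_conv pm by simp
  then show ?thesis
    using *(1)[of x] *(1)[of y] *(1)[of z] *(2)[of x] *(2)[of y] *(2)[of z]
      pos_lower[OF assms(1,4,5)] pos_lower[OF assms(2,4,5)] pos_lower[OF assms(3,4,5)] l assms(1-3)
      plus_of_minus_of[of n i x] plus_of_minus_of[of n i y] plus_of_minus_of[of n i z]
    by (elim disjE) (simp_all add: f_op_Cons)
qed

lemma ktriple_knuth_rel:
  assumes "ktriple (2 * int n + 1) (pos n a, pos n b, pos n c) (pos n a', pos n b', pos n c')"
    "{a, b, c, a', b', c'} \<subseteq> letters n"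
  shows "knuth_rel n [a, b, c] [a', b', c']"
proof -
  have L: "a \<in> letters n" "b \<in> letters n" "c \<in> letters n" "a' \<in> letters n" "b' \<in> letters n" "c' \<in> letters n"
    using assms(2) by auto
  have neg: "pos n u + pos n v = 2 * int n + 1 \<longleftrightarrow> v = - u" if "u \<in> letters n" "v \<in> letters n" for u v
    using that by (auto simp: pos_def letters_def)
  have "(a = a' \<and> c \<preceq> a \<and> a \<prec> b \<and> b \<noteq> - c \<and> b' = c \<and> c' = b) \<or>
     (a = a' \<and> c \<prec> a \<and> a \<prec> b \<and> b = - c \<and> pos n b' = 1 + pos n c \<and> pos n c' = pos n b - 1) \<or>
     (c = c' \<and> a \<prec> c \<and> c \<preceq> b \<and> b \<noteq> - a \<and> a' = b \<and> b' = a) \<or>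
     (c = c' \<and> b' \<prec> c \<and> c \<prec> a' \<and> a' = - b' \<and> pos n a = 1 + pos n b' \<and> pos n b = pos n a' - 1)"
    (is "?c1 \<or> ?c2 \<or> ?c3 \<or> ?c4")
    using assms(1) L neg[of c b] neg[of a b] neg[of b' a'] unfolding ktriple_def ktriple_a_def ktriple_b_def
    by (simp add: pos_less_iff pos_le_iff pos_eq_iff add.commute conj_disj_distribL disj_assoc)
  then consider (1) ?c1 | (2) ?c2 | (3) ?c3 | (4) ?c4 by blast
  then show ?thesis
  proof cases
    case 1
    then show ?thesis using knuth_rel.R1a[of c a b n] L by auto
  next
    case 2
    have "0 < c" using 2 L by (auto simp: letter_less_def letters_def)
    \<comment> \<open>The letter \<open>a\<close> lies strictly between \<open>c\<close> and its
      bar, and for \<open>c = n\<close> there is no room.\<close>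
    moreover have "c < int n"
      using 2 L \<open>0 < c\<close> by (auto simp: letter_less_def letters_def)
    ultimately have "b' = c + 1" "c' = - (c + 1)" using 2 L by (auto simp: pos_def letters_def split: if_splits)
    moreover have "c + 1 \<preceq> a" "a \<preceq> - (c + 1)"
      using 2 L \<open>0 < c\<close> by (auto simp: letter_less_def letter_le_def letters_def)
    ultimately show ?thesis using knuth_rel.R2a[of "c + 1" n a] L 2 \<open>0 < c\<close> \<open>c < int n\<close> by simp
  next
    case 3
    then show ?thesis using knuth_rel.R1b[of a c b n] L by auto
  next
    case 4
    have "0 < b'" using 4 L by (auto simp: letter_less_def letters_def)
    moreover have "b' < int n"
      using 4 L \<open>0 < b'\<close> by (auto simp: letter_less_def letters_def)
    ultimately have "a = b' + 1" "b = - (b' + 1)" using 4 L by (auto simp: pos_def letters_def split: if_splits)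
    moreover have "b' + 1 \<preceq> c" "c \<preceq> - (b' + 1)"
      using 4 L \<open>0 < b'\<close> by (auto simp: letter_less_def letter_le_def letters_def)
    ultimately show ?thesis using knuth_rel.R2b[of "b' + 1" n c] L 4 \<open>0 < b'\<close> \<open>b' < int n\<close> by simp
  qed
qed

lemma knuth_triple_f_op:
  assumes "ktriple (2 * int n + 1) (pos n a, pos n b, pos n c) (pos n a', pos n b', pos n c')"
    "{a, b, c, a', b', c'} \<subseteq> letters n" "1 \<le> i" "i \<le> n"
  shows "rel_option (knuth_rel n) (f_op n i [a, b, c]) (f_op n i [a', b', c'])"
proof -
  \<comment> \<open>The difference of the two \<open>Plus\<close> positions is
    \<open>2 * (n - i)\<close>, which is even and hence never \<open>1\<close>; so no
    \<open>Plus\<close> position coincides with a \<open>Minus\<close> position.\<close>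
  have "int i = 2 * int n - int i \<or> int i + 2 \<le> 2 * int n - int i" using assms by auto
  note K = f_triple_knuth[OF this, simplified, OF assms(1)]
  have L: "a \<in> letters n" "b \<in> letters n" "c \<in> letters n" "a' \<in> letters n" "b' \<in> letters n" "c' \<in> letters n"
    using assms(2) by auto
  note f = f_op_triple[OF L(1,2,3) assms(3,4)] and f' = f_op_triple[OF L(4,5,6) assms(3,4)]
  show ?thesis
    using K f f'
    by (auto simp: option_rel_Some1 option_rel_Some2 elim!: option.rel_cases intro!: ktriple_knuth_rel)
qed

section \<open>Columns\<close>

lemma is_column_pos: "is_column n C \<longleftrightarrow> set C \<subseteq> letters n \<and> sorted_wrt (<) (map (pos n) C)"
  unfolding is_column_def sorted_wrt_map
  by (auto elim!: sorted_wrt_mono_rel[rotated] simp: pos_less_iff subset_iff)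

lemma column_unique:
  assumes "is_column n C" "is_column n D" "set C = set D"
  shows "C = D"
proof -
  have "map (pos n) C = map (pos n) D"
    using assms by (intro strict_sorted_equal) (auto simp: is_column_pos)
  moreover have "inj_on (pos n) (set C \<union> set D)"
    using assms by (auto simp: inj_on_def is_column_pos subset_iff pos_eq_iff)
  ultimately show ?thesis by (metis map_inj_on)
qed

lemma column_distinct: "is_column n C \<Longrightarrow> distinct C"
  using strict_sorted_iff[of "map (pos n) C"] by (auto simp: is_column_pos distinct_map)

lemma column_filter: "is_column n C \<Longrightarrow> is_column n (filter p C)"
  by (auto simp: is_column_def sorted_wrt_filter)

lemma column_append:
  "is_column n (a @ b) \<longleftrightarrow> is_column n a \<and> is_column n b \<and> (\<forall>x\<in>set a. \<forall>y\<in>set b. pos n x < pos n y)"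
  by (auto simp: is_column_pos sorted_wrt_append)

lemma column_Cons:
  "is_column n (x # b) \<longleftrightarrow> x \<in> letters n \<and> is_column n b \<and> (\<forall>y\<in>set b. pos n x < pos n y)"
  by (auto simp: is_column_pos)

lemma column_star: "is_column n C \<Longrightarrow> is_column n (star C)"
proof (induction C)
  case (Cons x C)
  then have "set C \<subseteq> letters n" by (auto simp: is_column_def)
  then show ?case
    using Cons by (auto simp: star_Cons column_append column_Cons set_star pos_neg subset_iff is_column_def[of n "[]"])
qed (simp add: is_column_def)

text \<open>The new letter is one position higher, so the order can fail only by a collision with an
  equal letter of \<open>b\<close>.\<close>

lemma column_replace:
  assumes "is_column n (a @ x # b)" "y \<in> letters n" "pos n y = pos n x + 1" "y \<notin> set b"
  shows "is_column n (a @ y # b)"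
proof -
  have "pos n y < pos n z" if "z \<in> set b" for z
  proof -
    have "z \<in> letters n" "pos n x < pos n z" "z \<noteq> y"
      using assms that by (auto simp: column_append column_Cons) (simp add: is_column_def subset_iff)
    then show ?thesis using assms(2,3) pos_eq_iff[of z n y] by linarith
  qed
  then show ?thesis using assms by (fastforce simp: column_append column_Cons)
qed

section \<open>Signatures and lowering operators on a single column\<close>

lemma eps_filter: "eps n i (filter (\<lambda>x. letter_sign n i x \<noteq> None) w) = eps n i w"
  by (induction w) (auto simp: plus_of_def minus_of_def)

lemma phi_filter: "phi n i (filter (\<lambda>x. letter_sign n i x \<noteq> None) w) = phi n i w"
  by (induction w) (auto simp: plus_of_def eps_filter[simplified])

text \<open>The chosen \<open>Plus\<close> is uncancelled, so no \<open>Minus\<close> of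
  \<open>b\<close> gets past it: \<open>eps n i b = 0\<close>. A \<open>Plus\<close> left over in
  \<open>a\<close> would then be uncancelled too and further left, so
  \<open>phi n i a = 0\<close>.\<close>

lemma f_op_decomp:
  assumes "f_op n i w = Some w'"
  obtains a x b where "w = a @ x # b" "w' = a @ lower_letter n i x # b" "plus_of n i x = Suc 0"
    "phi n i a = 0" "eps n i b = 0"
  using assms
proof (induction w arbitrary: w' thesis)
  case (Cons x w)
  show ?case
  proof (cases "plus_of n i x > eps n i w")
    case True
    then show ?thesis using Cons.prems(1)[of "[]" x w] Cons.prems(2) plus_of_le[of n i x]
      by (auto simp: f_op_Cons)
  next
    case False
    then obtain v where v: "f_op n i w = Some v" "w' = x # v"
      using Cons.prems by (auto simp: f_op_Cons)
    obtain a y b where ab: "w = a @ y # b" "v = a @ lower_letter n i y # b" "plus_of n i y = Suc 0"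
      "phi n i a = 0" "eps n i b = 0" using Cons.IH[OF _ v(1)] by blast
    have "plus_of n i x - eps n i a = 0"
      using False ab plus_of_minus_of[of n i y] by (auto simp: eps_append)
    then show ?thesis using Cons.prems(1)[of "x # a" y b] ab v by simp
  qed
qed simp

lemma letter_sign_Some:
  "1 \<le> i \<Longrightarrow> i < n \<Longrightarrow> letter_sign n i x \<noteq> None \<longleftrightarrow> x \<in> {int i, int i + 1, - (int i + 1), - int i}"
  "1 \<le> n \<Longrightarrow> letter_sign n n x \<noteq> None \<longleftrightarrow> x \<in> {int n, - int n}"
  by (auto simp: letter_sign_def)

text \<open>A column contains each signed letter at most once and in a fixed order, so its signature
  is given by four membership tests.\<close>

lemma column_signed:
  assumes "is_column n C" "1 \<le> i" "i < n"
  shows "filter (\<lambda>x. letter_sign n i x \<noteq> None) C =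
     filter (\<lambda>x. x \<in> set C) [int i, int i + 1, - (int i + 1), - int i]"
proof (rule column_unique)
  show "is_column n (filter (\<lambda>x. x \<in> set C) [int i, int i + 1, - (int i + 1), - int i])"
    using assms by (intro column_filter) (auto simp: is_column_pos letters_def pos_def)
  show "set (filter (\<lambda>x. letter_sign n i x \<noteq> None) C) =
      set (filter (\<lambda>x. x \<in> set C) [int i, int i + 1, - (int i + 1), - int i])"
    unfolding set_filter letter_sign_Some(1)[OF assms(2,3)] by auto
qed (rule column_filter[OF assms(1)])

lemma column_signed_n:
  assumes "is_column n C" "1 \<le> n"
  shows "filter (\<lambda>x. letter_sign n n x \<noteq> None) C = filter (\<lambda>x. x \<in> set C) [int n, - int n]"
proof (rule column_unique)
  show "is_column n (filter (\<lambda>x. x \<in> set C) [int n, - int n])"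
    using assms by (intro column_filter) (auto simp: is_column_pos letters_def pos_def)
  show "set (filter (\<lambda>x. letter_sign n n x \<noteq> None) C) = set (filter (\<lambda>x. x \<in> set C) [int n, - int n])"
    unfolding set_filter letter_sign_Some(2)[OF assms(2)] by auto
qed (rule column_filter[OF assms(1)])

lemma sign_values [simp]:
  "1 \<le> i \<Longrightarrow> plus_of n i (int i) = 1" "1 \<le> i \<Longrightarrow> plus_of n i (- int i) = 0"
  "1 \<le> i \<Longrightarrow> minus_of n i (int i) = 0" "1 \<le> i \<Longrightarrow> minus_of n i (- int i) = 1"
  "1 \<le> i \<Longrightarrow> i < n \<Longrightarrow> plus_of n i (int i + 1) = 0" "1 \<le> i \<Longrightarrow> i < n \<Longrightarrow> plus_of n i (- int i - 1) = 1"
  "1 \<le> i \<Longrightarrow> i < n \<Longrightarrow> minus_of n i (int i + 1) = 1" "1 \<le> i \<Longrightarrow> i < n \<Longrightarrow> minus_of n i (- int i - 1) = 0"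
  by (auto simp: plus_of_def minus_of_def letter_sign_def)

lemma phi_column:
  assumes "is_column n C" "1 \<le> i" "i < n"
  shows "phi n i C =
     of_bool (int i \<in> set C \<and> int i + 1 \<notin> set C \<and> (- int i \<in> set C \<longrightarrow> - int i - 1 \<in> set C)) +
     of_bool (- int i - 1 \<in> set C \<and> - int i \<notin> set C)"
  using assms by (subst phi_filter[symmetric], subst column_signed) auto

lemma eps_column:
  assumes "is_column n C" "1 \<le> i" "i < n"
  shows "eps n i C =
     of_bool (- int i \<in> set C \<and> - int i - 1 \<notin> set C \<and> (int i \<in> set C \<longrightarrow> int i + 1 \<in> set C)) +
     of_bool (int i + 1 \<in> set C \<and> int i \<notin> set C)"
  using assms by (subst eps_filter[symmetric], subst column_signed) auto

lemma phi_column_n: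
  assumes "is_column n C" "1 \<le> n"
  shows "phi n n C = of_bool (int n \<in> set C \<and> - int n \<notin> set C)"
  using assms by (subst phi_filter[symmetric], subst column_signed_n) auto

lemma eps_column_n:
  assumes "is_column n C" "1 \<le> n"
  shows "eps n n C = of_bool (int n \<notin> set C \<and> - int n \<in> set C)"
  using assms by (subst eps_filter[symmetric], subst column_signed_n) auto

text \<open>The implication says that a \<open>- int i\<close> in the column is cancelled by
  \<open>- int i - 1\<close> and so spares the \<open>Plus\<close> of \<open>int i\<close>.
  \<open>up_bar\<close> and \<open>up_n\<close> are the other two ways in which \<open>f_op\<close>
  can act on a column.\<close>

definition up_i :: "nat \<Rightarrow> int list \<Rightarrow> int list \<Rightarrow> bool" where
  "up_i i C C' \<longleftrightarrow> int i \<in> set C \<and> int i + 1 \<notin> set C \<and> (- int i \<in> set C \<longrightarrow> - int i - 1 \<in> set C) \<and>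
     set C' = insert (int i + 1) (set C - {int i})"

definition up_bar :: "nat \<Rightarrow> int list \<Rightarrow> int list \<Rightarrow> bool" where
  "up_bar i C C' \<longleftrightarrow> - int i - 1 \<in> set C \<and> - int i \<notin> set C \<and> (int i \<in> set C \<longrightarrow> int i + 1 \<in> set C) \<and>
     set C' = insert (- int i) (set C - {- int i - 1})"

definition up_n :: "nat \<Rightarrow> int list \<Rightarrow> int list \<Rightarrow> bool" where
  "up_n n C C' \<longleftrightarrow> int n \<in> set C \<and> - int n \<notin> set C \<and> set C' = insert (- int n) (set C - {int n})"

lemma f_op_column:
  assumes "is_column n C" "f_op n i C = Some C'" "1 \<le> i" "i \<le> n"
  shows "is_column n C' \<and> (i < n \<and> up_i i C C' \<or> i < n \<and> up_bar i C C' \<or> i = n \<and> up_n n C C')"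
proof -
  obtain a x b where ab: "C = a @ x # b" "C' = a @ lower_letter n i x # b" "plus_of n i x = Suc 0"
    "phi n i a = 0" "eps n i b = 0" using f_op_decomp[OF assms(2)] .
  note low = lower_letter_props[OF ab(3)[folded One_nat_def] assms(3,4)]
  have col: "is_column n a" "is_column n b" and
    less: "\<And>y. y \<in> set a \<Longrightarrow> pos n y < pos n x" "\<And>y. y \<in> set b \<Longrightarrow> pos n x < pos n y"
    using assms(1) ab(1) by (auto simp: column_append column_Cons)
  have x: "x \<notin> set a" "x \<notin> set b" using less by auto
  have replaced: "is_column n C'" if "lower_letter n i x \<notin> set b"
    using column_replace[OF assms(1)[unfolded ab(1)] low(3) _ that] pos_lower[OF low(4) assms(3,4) ab(3)] ab(2) by simp
  have setC': "set C' = insert (lower_letter n i x) (set C - {x})"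
    using x ab(1,2) by auto
  consider "x = int i" "i < n" | "x = - int i - 1" "i < n" | "x = int n" "i = n"
    using ab(3) assms(4) by (cases "i = n") (auto simp: plus_of_iff)
  then show ?thesis
  proof cases
    case 1
    have "int i \<notin> set a" "int i + 1 \<notin> set a" "- int i \<notin> set a" "- int i - 1 \<notin> set a"
      using less(1) 1 assms(3) by (fastforce simp: pos_def)+
    moreover have "int i + 1 \<notin> set b" "- int i \<in> set b \<longrightarrow> - int i - 1 \<in> set b"
      using eps_column[OF col(2) assms(3) 1(2)] ab(5) x 1 by (auto split: if_splits)
    ultimately have "up_i i C C'"
      using setC' 1 ab(1) assms(3) by (auto simp: up_i_def lower_letter_def)
    moreover have "lower_letter n i x \<notin> set b" using \<open>int i + 1 \<notin> set b\<close> 1 by (simp add: lower_letter_def)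
    ultimately show ?thesis using replaced 1 by blast
  next
    case 2
    have "int i \<notin> set b" "int i + 1 \<notin> set b" "- int i \<notin> set a" "- int i - 1 \<notin> set a"
      using less 2 assms(3) by (fastforce simp: pos_def)+
    moreover have "- int i \<notin> set b"
      using eps_column[OF col(2) assms(3) 2(2)] ab(5) x 2 \<open>int i \<notin> set b\<close> by (auto split: if_splits)
    moreover have "int i \<in> set a \<longrightarrow> int i + 1 \<in> set a"
      using phi_column[OF col(1) assms(3) 2(2)] ab(4) x 2 \<open>- int i \<notin> set a\<close> by (auto split: if_splits)
    ultimately have "up_bar i C C'"
      using setC' 2 ab(1) assms(3) by (auto simp: up_bar_def lower_letter_def)
    moreover have "lower_letter n i x \<notin> set b" using \<open>- int i \<notin> set b\<close> 2 by (simp add: lower_letter_def)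
    ultimately show ?thesis using replaced 2 by blast
  next
    case 3
    have "- int n \<notin> set a" using less(1)[of "- int n"] 3 assms(3) by (auto simp: pos_def)
    moreover have "- int n \<notin> set b"
      using eps_column_n[OF col(2)] ab(5) x 3 assms(3) by (auto split: if_splits)
    ultimately have "up_n n C C'"
      using setC' 3 ab(1) assms(3) by (auto simp: up_n_def lower_letter_def)
    moreover have "lower_letter n i x \<notin> set b" using \<open>- int n \<notin> set b\<close> 3 by (simp add: lower_letter_def)
    ultimately show ?thesis using replaced 3 by blast
  qed
qed

section \<open>Counting functions of a column\<close>

primrec npos :: "int list \<Rightarrow> nat \<Rightarrow> int" where
  "npos C 0 = 0"
| "npos C (Suc q) = npos C q + of_bool (int q + 1 \<in> set C)"

primrec nneg :: "int list \<Rightarrow> nat \<Rightarrow> int" where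
  "nneg C 0 = 0"
| "nneg C (Suc q) = nneg C q + of_bool (- int q - 1 \<in> set C)"

text \<open>Equivalently, the number of \<open>z \<le> q\<close> with \<open>z\<close> and \<open>- z\<close> in \<open>C\<close> minus the number of \<open>t \<le> q\<close> with
  neither in \<open>C\<close>.\<close>

definition excess :: "int list \<Rightarrow> nat \<Rightarrow> int" where
  "excess C q = npos C q + nneg C q - int q"

lemma excess_0 [simp]: "excess C 0 = 0" by (simp add: excess_def)

lemma excess_Suc: "excess C (Suc q) =
  excess C q + of_bool (int q + 1 \<in> set C) + of_bool (- int q - 1 \<in> set C) - 1"
  by (simp add: excess_def)

lemma npos_star: "npos (star C) q = nneg C q"
  and nneg_star: "nneg (star C) q = npos C q"
  by (induction q) (auto simp: set_star image_iff equation_minus_iff add.commute minus_diff_commute)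

lemma excess_star: "excess (star C) q = excess C q"
  by (simp add: excess_def npos_star nneg_star)

lemma npos_card: "npos C q = int (card (set C \<inter> {0<..int q}))"
proof (induction q)
  case (Suc q)
  have "{0<..int (Suc q)} = insert (int q + 1) {0<..int q}" by auto
  then show ?case using Suc by (simp add: Int_insert_right)
qed simp

lemma nneg_card: "nneg C q = int (card (set C \<inter> {- int q..<0}))"
proof (induction q)
  case (Suc q)
  have "{- int (Suc q)..<0} = insert (- int q - 1) {- int q..<0}" by auto
  then show ?case using Suc by (simp add: Int_insert_right)
qed simp

abbreviation within :: "int list \<Rightarrow> nat \<Rightarrow> int set" where
  "within C q \<equiv> {x \<in> set C. x \<noteq> 0 \<and> \<bar>x\<bar> \<le> int q}"

lemma excess_card: "excess C q = int (card (within C q)) - int q"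
proof -
  have "within C q = (set C \<inter> {0<..int q}) \<union> (set C \<inter> {- int q..<0})"
    by auto
  moreover have "card ((set C \<inter> {0<..int q}) \<union> (set C \<inter> {- int q..<0})) =
      card (set C \<inter> {0<..int q}) + card (set C \<inter> {- int q..<0})"
    by (rule card_Un_disjoint) auto
  ultimately show ?thesis by (simp add: excess_def npos_card nneg_card)
qed

lemma length_column:
  assumes "is_column n C"
  shows "int (length C) = npos C n + nneg C n"
proof -
  have "set C = within C n" using assms by (auto simp: is_column_def letters_def)
  then have "excess C n = int (card (set C)) - int n" by (simp add: excess_card)
  then show ?thesis using distinct_card[OF column_distinct[OF assms]] by (simp add: excess_def)
qed

lemma up_i_counts:
  assumes "up_i i C C'" "1 \<le> i"
  shows "npos C' q = npos C q - of_bool (q = i)" "nneg C' q = nneg C q"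
proof -
  show "npos C' q = npos C q - of_bool (q = i)"
    using assms by (induction q) (auto simp: up_i_def add.commute minus_diff_commute)
  show "nneg C' q = nneg C q" using assms by (induction q) (auto simp: up_i_def add.commute minus_diff_commute)
qed

lemma up_bar_counts:
  assumes "up_bar i C C'" "1 \<le> i"
  shows "npos C' q = npos C q" "nneg C' q = nneg C q + of_bool (q = i)"
proof -
  show "npos C' q = npos C q" using assms by (induction q) (auto simp: up_bar_def add.commute minus_diff_commute)
  show "nneg C' q = nneg C q + of_bool (q = i)"
    using assms by (induction q) (auto simp: up_bar_def add.commute minus_diff_commute)
qed

lemma up_n_counts:
  assumes "up_n n C C'" "1 \<le> n" "q \<le> n"
  shows "npos C' q = npos C q - of_bool (q = n)" "nneg C' q = nneg C q + of_bool (q = n)"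
proof -
  show "npos C' q = npos C q - of_bool (q = n)"
    using assms by (induction q) (auto simp: up_n_def add.commute minus_diff_commute)
  show "nneg C' q = nneg C q + of_bool (q = n)" using assms by (induction q) (auto simp: up_n_def add.commute minus_diff_commute)
qed

lemma npos_prefix:
  assumes "is_column n (u @ z # v)" "0 < z"
  shows "npos (u @ z # v) (nat z) = int (length u) + 1"
proof -
  have u: "0 < x \<and> x \<le> z" if "x \<in> set u" for x
  proof -
    have "pos n x < pos n z" "x \<in> letters n" "z \<in> letters n"
      using assms that by (auto simp: column_append column_Cons) (auto simp: is_column_def)
    then show ?thesis using assms(2) by (auto simp: pos_def letters_def split: if_splits)
  qed
  have v: "\<not> (0 < x \<and> x \<le> z)" if "x \<in> set v" for x
  proof -
    have "pos n z < pos n x" using assms that by (auto simp: column_append column_Cons)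
    then show ?thesis using assms(2) by (auto simp: pos_def split: if_splits)
  qed
  have "set (u @ z # v) \<inter> {0<..int (nat z)} = set (u @ [z])" using u v assms(2) by auto
  moreover have "distinct (u @ [z])" using column_distinct[OF assms(1)] by auto
  ultimately show ?thesis using distinct_card[of "u @ [z]"] by (simp add: npos_card)
qed

lemma nneg_suffix:
  assumes "is_column n (u @ (- z) # v)" "0 < z"
  shows "nneg (u @ (- z) # v) (nat z) = int (length v) + 1"
  using npos_prefix[of n "star v" z "star u"] column_star[OF assms(1)] assms(2)
    npos_star[of "u @ (- z) # v" "nat z"]
  by (simp add: star_append star_Cons)

text \<open>For a pair \<open>z\<close>, \<open>- z\<close> the two row numbers are the values of
  \<open>npos\<close> and \<open>nneg\<close> at \<open>z\<close>, so the one-column condition there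
  is \<open>excess\<close> \<le> 0. Since \<open>excess\<close> increases only at pairs, the bound
  at pairs extends to all \<open>q\<close>.\<close>

lemma admissible_iff:
  assumes "is_column n C"
  shows "admissible n C \<longleftrightarrow> (\<forall>q\<le>n. excess C q \<le> 0)"
proof -
  have key: "int (a + 1) + int (length C - b) = npos C (nat z) + nneg C (nat z)"
    if "a < length C" "b < length C" "C ! a = z" "C ! b = - z" "0 < z" for a b z
    using that assms npos_prefix[of n "take a C" z "drop (Suc a) C"]
      nneg_suffix[of n "take b C" z "drop (Suc b) C"] id_take_nth_drop[of a C] id_take_nth_drop[of b C]
    by (auto simp: min_def)
  show ?thesis
  proof
    assume adm: "admissible n C"
    have "q \<le> n \<Longrightarrow> excess C q \<le> 0" for q
    proof (induction q)
      case (Suc q)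
      show ?case
      proof (cases "int q + 1 \<in> set C \<and> - int q - 1 \<in> set C")
        case True
        then obtain a b where ab: "a < length C" "b < length C" "C ! a = int q + 1" "C ! b = - (int q + 1)"
          unfolding in_set_conv_nth by auto
        then have "int (a + 1) + int (length C - b) \<le> C ! a"
          using adm by (auto simp: admissible_def)
        then show ?thesis using key[OF ab(1,2,3,4)] ab(3)
            by (simp add: excess_def nat_add_distrib del: npos.simps nneg.simps)
      next
        case False
        then show ?thesis using Suc by (auto simp: excess_Suc)
      qed
    qed simp
    then show "\<forall>q\<le>n. excess C q \<le> 0" by blast
  next
    assume h: "\<forall>q\<le>n. excess C q \<le> 0"
    have "int (a + 1) + int (length C - b) \<le> C ! a"
      if "a < length C" "b < length C" "0 < C ! a" "C ! b = - (C ! a)" for a b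
    proof -
      have "C ! a \<in> letters n" using assms that by (auto simp: is_column_def)
      then have "nat (C ! a) \<le> n" by (auto simp: letters_def)
      then have "excess C (nat (C ! a)) \<le> 0" using h by blast
      then show ?thesis using key[OF that(1,2) refl that(4,3)] that(3) by (simp add: excess_def)
    qed
    then show "admissible n C" using assms by (auto simp: admissible_def)
  qed
qed

text \<open>\<open>excess\<close> starts at \<open>0\<close> and rises by at most one per step, and
  only at a pair; its first positive value is therefore \<open>1\<close>, reached at a pair.\<close>

lemma first_positive_excess:
  assumes "0 < excess C q"
  obtains z where "1 \<le> z" "z \<le> q" "excess C z = 1" "\<And>p. p < z \<Longrightarrow> excess C p \<le> 0"
    "int z \<in> set C" "- int z \<in> set C"
proof -
  define z where "z = (LEAST p. 0 < excess C p)"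
  have z: "0 < excess C z" "\<And>p. p < z \<Longrightarrow> excess C p \<le> 0" "z \<le> q"
    using LeastI[of "\<lambda>p. 0 < excess C p", OF assms] not_less_Least[of _ "\<lambda>p. 0 < excess C p"]
      Least_le[of "\<lambda>p. 0 < excess C p", OF assms] by (auto simp: z_def not_less)
  obtain y where y: "z = Suc y" using z(1) by (cases z) auto
  have "excess C y \<le> 0" using z(2) y by simp
  moreover have "0 < excess C (Suc y)" using z(1) y by simp
  ultimately have "excess C z = 1 \<and> int z \<in> set C \<and> - int z \<in> set C"
    using y by (auto simp: excess_Suc add.commute minus_diff_commute of_bool_def split: if_splits)
  moreover have "1 \<le> z" using y by simp
  ultimately show ?thesis by (intro that[of z] z(2,3)) simp_all
qed

section \<open>The contraction relation\<close>

text \<open>A column is minimal non-admissible iff its maximal excess is \<open>1\<close>, and the letter contracted in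
  relation R3 is the first place where this maximum is attained.\<close>

definition contraction :: "nat \<Rightarrow> int list \<Rightarrow> nat \<Rightarrow> bool" where
  "contraction n w q \<longleftrightarrow> is_column n w \<and> 1 \<le> q \<and> q \<le> n \<and> excess w q = 1 \<and> (\<forall>p\<le>n. excess w p \<le> 1) \<and>
     (\<forall>p<q. excess w p \<le> 0)"

lemma contraction_pair:
  assumes "contraction n w q"
  shows "int q \<in> set w" "- int q \<in> set w"
proof -
  obtain p where p: "q = Suc p" using assms by (cases q) (auto simp: contraction_def)
  have "excess w p \<le> 0" "excess w q = 1" using assms p by (auto simp: contraction_def)
  then show "int q \<in> set w" "- int q \<in> set w" by (auto simp: p excess_Suc add.commute minus_diff_commute of_bool_def split: if_splits)
qed

text \<open>Turns the equation \<open>N_count w z = z + 1\<close> of a contractible letter into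
  \<open>excess w (nat z) = 1\<close>.\<close>

lemma N_count_column:
  assumes "is_column n w" "0 < z"
  shows "int (N_count w z) = excess w (nat z) + z"
proof -
  have "distinct (filter (\<lambda>x. x \<preceq> z \<or> - z \<preceq> x) w)" using column_distinct[OF assms(1)] by simp
  then have "N_count w z = card (set (filter (\<lambda>x. x \<preceq> z \<or> - z \<preceq> x) w))"
    unfolding N_count_def using distinct_card by metis
  moreover have "set (filter (\<lambda>x. x \<preceq> z \<or> - z \<preceq> x) w) = within w (nat z)"
    using assms by (auto simp: letter_le_def letter_less_def is_column_def letters_def subset_iff)
  ultimately show ?thesis using assms(2) by (simp add: excess_card)
qed

text \<open>Without its first letter the column is an admissible proper factor, and one letter
  changes \<open>excess\<close> by at most one.\<close>

lemma minimal_nonadmissible_excess: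
  assumes "minimal_nonadmissible n w" "p \<le> n"
  shows "excess w p \<le> 1"
proof -
  have w: "is_column n w" "\<not> admissible n w" using assms by (auto simp: minimal_nonadmissible_def)
  show ?thesis
  proof (cases w)
    case Nil
    have "excess [] q = - int q" for q by (simp add: excess_card)
    then show ?thesis by (simp add: Nil)
  next
    case (Cons x v)
    have "w = [x] @ v @ []" "v \<noteq> w" using Cons by auto
    then have "admissible n v" using assms unfolding minimal_nonadmissible_def by blast
    then have "excess v p \<le> 0" using admissible_iff[of n v] assms(2) by (auto simp: admissible_def)
    moreover have "card (within w p) \<le>
        card (insert x (within v p))"
      using Cons by (intro card_mono) auto
    then have "card (within w p) \<le>
        Suc (card (within v p))"
      by (simp add: card_insert_if split: if_splits)
    ultimately show ?thesis by (simp add: excess_card)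
  qed
qed

lemma knuth_R3_contraction:
  assumes "minimal_nonadmissible n w" "contractible_letter w z"
    "\<forall>z'. contractible_letter w z' \<longrightarrow> z \<le> z'"
  shows "contraction n w (nat z)"
proof -
  have w: "is_column n w" using assms by (auto simp: minimal_nonadmissible_def)
  have z: "0 < z" "excess w (nat z) = 1" "z \<in> set w" "- z \<in> set w"
    using assms(2) N_count_column[OF w, of z] by (auto simp: contractible_letter_def)
  have "excess w p \<le> 0" if "p < nat z" for p
  proof (rule ccontr)
    assume "\<not> excess w p \<le> 0"
    then obtain y where y: "1 \<le> y" "y \<le> p" "excess w y = 1" "int y \<in> set w" "- int y \<in> set w"
      using first_positive_excess[of w p] by (metis not_le)
    then have "contractible_letter w (int y)"
      using N_count_column[OF w, of "int y"] by (auto simp: contractible_letter_def)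
    then show False using assms(3) that y by force
  qed
  moreover have "nat z \<le> n" using z w by (auto simp: is_column_def letters_def)
  ultimately show ?thesis using z w minimal_nonadmissible_excess[OF assms(1)]
    by (auto simp: contraction_def)
qed

text \<open>A proper factor misses the first or the last letter \<open>y\<close> of the column, and
  \<open>y\<close> is at most \<open>z\<close> in absolute value for every pair \<open>z\<close>.
  Where the excess is positive there is a pair at or below, so \<open>y\<close> was counted there,
  and dropping it lowers the maximal value \<open>1\<close> to \<open>0\<close>.\<close>

lemma contraction_minimal:
  assumes "contraction n w q"
  shows "minimal_nonadmissible n w"
proof -
  have w: "is_column n w" and q: "excess w q = 1" "q \<le> n" "1 \<le> q" and h: "\<And>p. p \<le> n \<Longrightarrow> excess w p \<le> 1"
    using assms by (auto simp: contraction_def)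
  have bound: "excess v p \<le> 0"
    if v: "set v \<subseteq> set w" and y: "y \<in> set w - set v" and p: "p \<le> n"
     and ypos: "\<And>z. int z \<in> set w \<Longrightarrow> - int z \<in> set w \<Longrightarrow> \<bar>y\<bar> \<le> int z" for v y p
  proof (cases "excess w p \<le> 0")
    case True
    have "card (within v p) \<le> card (within w p)"
      using v by (intro card_mono) auto
    then show ?thesis using True by (simp add: excess_card)
  next
    case False
    then obtain z where z: "z \<le> p" "int z \<in> set w" "- int z \<in> set w"
      using first_positive_excess[of w p] by (metis not_le)
    then have "y \<in> within w p"
      using ypos[of z] y w by (auto simp: is_column_def letters_def)
    then have "card (within v p) < card (within w p)"
      using v y by (intro psubset_card_mono) auto
    then show ?thesis using h[OF p] by (simp add: excess_card)
  qed
  have "admissible n v" if uvx: "w = u @ v @ x" "v \<noteq> w" for u v x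
  proof -
    have v: "is_column n v" using w uvx by (auto simp: column_append)
    have d: "distinct (u @ v @ x)" using column_distinct[OF w] uvx by simp
    have "excess v p \<le> 0" if "p \<le> n" for p
    proof (cases u)
      case (Cons y u')
      show ?thesis
      proof (rule bound[of v y p])
        fix z assume z: "int z \<in> set w" "- int z \<in> set w"
        have w': "w = y # (u' @ v @ x)" using uvx Cons by simp
        have "pos n y \<le> pos n (int z)" "y \<in> letters n"
          using w z(1) unfolding w' column_Cons by (auto simp: order_less_imp_le)
        moreover have "int z \<in> letters n" using w z(1) by (auto simp: is_column_def)
        ultimately show "\<bar>y\<bar> \<le> int z" by (auto simp: pos_def letters_def split: if_splits)
      qed (use uvx d Cons that in auto)
    next
      case Nil
      then have "x \<noteq> []" using uvx by auto
      then obtain y x' where x: "x = x' @ [y]" by (metis append_butlast_last_id)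
      show ?thesis
      proof (rule bound[of v y p])
        fix z assume z: "int z \<in> set w" "- int z \<in> set w"
        have w': "w = (u @ v @ x') @ [y]" using uvx x by simp
        have "pos n (- int z) \<le> pos n y" "- int z \<in> letters n" "y \<in> letters n"
          using w z(2) unfolding w' column_append by (auto simp: is_column_def order_less_imp_le)
        then show "\<bar>y\<bar> \<le> int z" by (auto simp: pos_def letters_def split: if_splits)
      qed (use uvx d x that in auto)
    qed
    then show ?thesis using admissible_iff[OF v] by blast
  qed
  moreover have "\<not> admissible n w" using admissible_iff[OF w] q by fastforce
  ultimately show ?thesis using w by (auto simp: minimal_nonadmissible_def)
qed

lemma contraction_knuth_rel:
  assumes "contraction n w q"
  shows "knuth_rel n w (filter (\<lambda>x. x \<noteq> int q \<and> x \<noteq> - int q) w)"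
proof (rule knuth_rel.R3[OF contraction_minimal[OF assms]])
  have w: "is_column n w" and q: "excess w q = 1" "q \<le> n" "1 \<le> q" and h: "\<And>p. p < q \<Longrightarrow> excess w p \<le> 0"
    using assms by (auto simp: contraction_def)
  show "contractible_letter w (int q)"
    using contraction_pair[OF assms] q N_count_column[OF w, of "int q"]
    by (simp add: contractible_letter_def)
  show "\<forall>z'. contractible_letter w z' \<longrightarrow> int q \<le> z'"
  proof (intro allI impI)
    fix z assume "contractible_letter w z"
    then have "0 < z" "excess w (nat z) = 1" using N_count_column[OF w, of z] by (auto simp: contractible_letter_def)
    then show "int q \<le> z" using h[of "nat z"] by (metis nat_less_iff not_le zero_less_one less_imp_le)
  qed
qed

abbreviation del_pair :: "nat \<Rightarrow> int list \<Rightarrow> int list" where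
  "del_pair q w \<equiv> filter (\<lambda>x. x \<noteq> int q \<and> x \<noteq> - int q) w"

lemma excess_pred: "1 \<le> i \<Longrightarrow> excess C i = excess C (i - 1) + of_bool (int i \<in> set C) + of_bool (- int i \<in> set C) - 1"
  using excess_Suc[of C "i - 1"] by (simp add: of_nat_diff)

lemma excess_next: "excess C (i + 1) = excess C i + of_bool (int i + 1 \<in> set C) + of_bool (- int i - 1 \<in> set C) - 1"
  using excess_Suc[of C i] by simp

text \<open>The image of \<open>w\<close> is again a \<open>contraction\<close>, at some
  \<open>q'\<close>, and columns are determined by their letters, so it suffices to compare sets.
  The place moves in two cases only: from \<open>q = i\<close> to \<open>i + 1\<close> under
  \<open>up_i\<close>, and from \<open>q = i + 1\<close> to \<open>i\<close> under
  \<open>up_bar\<close>. In both, the operator acts on the shortened column through the other kind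
  of letter.\<close>

lemma contraction_f_op:
  assumes c: "contraction n w q" and i: "1 \<le> i" "i \<le> n"
  shows "rel_option (knuth_rel n) (f_op n i w) (f_op n i (del_pair q w))"
proof -
  have w: "is_column n w" and q: "excess w q = 1" "q \<le> n" "1 \<le> q"
    and h1: "\<And>p. p \<le> n \<Longrightarrow> excess w p \<le> 1" and h0: "\<And>p. p < q \<Longrightarrow> excess w p \<le> 0"
    using c by (auto simp: contraction_def)
  note pair = contraction_pair[OF c]
  have pair': "q = i + 1 \<Longrightarrow> int i + 1 \<in> set w \<and> - int i - 1 \<in> set w"
    using pair by (auto simp: add.commute minus_diff_commute)
  define r where "r = del_pair q w"
  have r: "is_column n r" "set r = set w - {int q, - int q}"
    using column_filter[OF w] by (auto simp: r_def)
  have mem: "int i \<in> set r \<longleftrightarrow> int i \<in> set w \<and> q \<noteq> i" "- int i \<in> set r \<longleftrightarrow> - int i \<in> set w \<and> q \<noteq> i"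
    "int i + 1 \<in> set r \<longleftrightarrow> int i + 1 \<in> set w \<and> q \<noteq> i + 1"
    "- int i - 1 \<in> set r \<longleftrightarrow> - int i - 1 \<in> set w \<and> q \<noteq> i + 1"
    using i(1) \<open>1 \<le> q\<close> by (auto simp: r(2))
  have sum: "int (i + 1) = int i + 1" "- int (i + 1) = - int i - 1" by simp_all
  show ?thesis
  proof (cases "f_op n i w")
    case None
    have "phi n i r = 0"
    proof (cases "i = n")
      case True
      then show ?thesis using phi_column_n[OF r(1)] phi_column_n[OF w] None i r(2) pair
        by (auto simp: f_op_None_iff split: if_splits)
    next
      case False
      then have i': "i < n" using i by simp
      note hi = excess_pred[OF i(1), of w] excess_next[of w i]
      have "\<not> (int i \<in> set w \<and> int i + 1 \<notin> set w \<and> (- int i \<in> set w \<longrightarrow> - int i - 1 \<in> set w))"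
        "\<not> (- int i - 1 \<in> set w \<and> - int i \<notin> set w)"
        using phi_column[OF w i(1) i'] None by (auto simp: f_op_None_iff split: if_splits)
      \<comment> \<open>Otherwise the excess would rise from \<open>1\<close> at \<open>i\<close> to
        \<open>2\<close> at \<open>i + 1\<close>.\<close>
      moreover have "\<not> (int i + 1 \<in> set w \<and> - int i - 1 \<in> set w)" if "q = i"
        using hi q(1) h1[of "i + 1"] i' that by auto
      moreover have "q = i \<Longrightarrow> int i \<in> set w \<and> - int i \<in> set w"
        using pair by auto
      ultimately show ?thesis
        using pair' unfolding phi_column[OF r(1) i(1) i'] mem by auto
    qed
    then show ?thesis using None by (simp add: f_op_None_iff[symmetric] r_def)
  next
    case (Some w')
    note fw = f_op_column[OF w Some i]
    have w': "is_column n w'" using fw by blast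
    have finish: ?thesis if r': "f_op n i r \<noteq> None"
      "\<And>r'. f_op n i r = Some r' \<Longrightarrow> set r' = set w' - {int q', - int q'}"
      and h': "1 \<le> q'" "q' \<le> n" "excess w' q' = 1" "\<And>p. p \<le> n \<Longrightarrow> excess w' p \<le> 1" "\<And>p. p < q' \<Longrightarrow> excess w' p \<le> 0"
      for q'
    proof -
      obtain r' where r'': "f_op n i r = Some r'" using r'(1) by auto
      have "r' = del_pair q' w'"
        using column_unique[of n r' "del_pair q' w'"] f_op_column[OF r(1) r'' i] r'(2)[OF r'']
          column_filter[OF w'] by auto
      moreover have "contraction n w' q'" using w' h' by (auto simp: contraction_def)
      ultimately show ?thesis using contraction_knuth_rel r'' Some r_def by simp
    qed
    show ?thesis
    proof (cases "i = n")
      case True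
      then have u: "up_n n w w'" using fw by blast
      then have "q \<noteq> n" using pair by (auto simp: up_n_def)
      show ?thesis
      proof (rule finish[of q])
        show "f_op n i r \<noteq> None"
          using u \<open>q \<noteq> n\<close> r phi_column_n[OF r(1)] i True by (auto simp: f_op_None_iff up_n_def)
        show "set r' = set w' - {int q, - int q}" if "f_op n i r = Some r'" for r'
          using f_op_column[OF r(1) that i] True u r(2) \<open>q \<noteq> n\<close> by (auto simp: up_n_def)
      qed (use q h1 h0 up_n_counts[OF u] i True in \<open>auto simp: excess_def\<close>)
    next
      case False
      then have i': "i < n" using i by simp
      have phir: "f_op n i r \<noteq> None \<longleftrightarrow>
          (int i \<in> set r \<and> int i + 1 \<notin> set r \<and> (- int i \<in> set r \<longrightarrow> - int i - 1 \<in> set r)) \<or>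
          (- int i - 1 \<in> set r \<and> - int i \<notin> set r)"
        using phi_column[OF r(1) i(1) i'] by (auto simp: f_op_None_iff)
      have fr: "up_i i r r' \<or> up_bar i r r'" if "f_op n i r = Some r'" for r'
        using f_op_column[OF r(1) that i] i' by auto
      note hi = excess_pred[OF i(1), of w] excess_next[of w i]
      from fw i' consider (a) "up_i i w w'" | (b) "up_bar i w w'" by blast
      then show ?thesis
      proof cases
        case a
        have hw': "excess w' p = excess w p - of_bool (p = i)" for p
          using up_i_counts[OF a i(1)] by (simp add: excess_def)
        have "q \<noteq> i + 1" using a pair' by (auto simp: up_i_def)
        show ?thesis
        proof (cases "q = i")
          case True
          have st: "int i \<in> set w" "- int i \<in> set w" "int i + 1 \<notin> set w" "- int i - 1 \<in> set w"
            using a True pair by (auto simp: up_i_def)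
          show ?thesis
          proof (rule finish[of "i + 1"])
            show "f_op n i r \<noteq> None" using phir st True unfolding mem by simp
            show "set r' = set w' - {int (i + 1), - int (i + 1)}" if "f_op n i r = Some r'" for r'
            proof -
              have "\<not> up_i i r r'" using True unfolding up_i_def mem by simp
              then have "set r' = insert (- int i) (set r - {- int i - 1})"
                using fr[OF that] by (auto simp: up_bar_def)
              moreover have "set w' = insert (int i + 1) (set w - {int i})" using a by (simp add: up_i_def)
              ultimately show ?thesis using i(1) st unfolding r(2) sum True by auto
            qed
            show "excess w' p \<le> 0" if "p < i + 1" for p
              using that h0[of p] q(1) True hw'[of p] by (cases "p = i") auto
            show "excess w' (i + 1) = 1" using hi(2) st q(1) True hw'[of "i + 1"] by simp
            show "excess w' p \<le> 1" if "p \<le> n" for p using h1[OF that] hw'[of p] by (cases "p = i") auto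
          qed (use i' in auto)
        next
          case qi: False
          show ?thesis
          proof (rule finish[of q])
            show "f_op n i r \<noteq> None" using phir a qi \<open>q \<noteq> i + 1\<close> unfolding mem by (simp add: up_i_def)
            show "set r' = set w' - {int q, - int q}" if "f_op n i r = Some r'" for r'
            proof -
              have "\<not> up_bar i r r'" using a qi \<open>q \<noteq> i + 1\<close> unfolding up_i_def up_bar_def mem by blast
              then have "set r' = insert (int i + 1) (set r - {int i})"
                using fr[OF that] by (auto simp: up_i_def)
              moreover have "set w' = insert (int i + 1) (set w - {int i})" using a by (simp add: up_i_def)
              ultimately show ?thesis using qi \<open>q \<noteq> i + 1\<close> unfolding r(2) by auto
            qed
            show "excess w' p \<le> 1" if "p \<le> n" for p using h1[OF that] hw'[of p] by (cases "p = i") auto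
            show "excess w' p \<le> 0" if "p < q" for p using h0[OF that] hw'[of p] by (cases "p = i") auto
          qed (use hw'[of q] q qi in auto)
        qed
      next
        case b
        have hw': "excess w' p = excess w p + of_bool (p = i)" for p
          using up_bar_counts[OF b i(1)] by (simp add: excess_def)
        have "q \<noteq> i" using b pair by (auto simp: up_bar_def)
        show ?thesis
        proof (cases "q = i + 1")
          case True
          have st: "- int i \<notin> set w" "int i + 1 \<in> set w" "- int i - 1 \<in> set w"
            using b True pair' by (auto simp: up_bar_def)
          \<comment> \<open>The pair at \<open>q = i + 1\<close> lifts the excess from
            \<open>0\<close> to \<open>1\<close>. As it is at most \<open>0\<close> at
            \<open>i - 1\<close>, it can be \<open>0\<close> at \<open>i\<close> without
            \<open>- int i\<close> only if \<open>int i\<close> occurs.\<close>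
          have "excess w i = 0" using hi(2) st q(1) True by simp
          have "excess w (i - 1) \<le> 0" using h0[of "i - 1"] True by simp
          then have "int i \<in> set w" using hi(1) \<open>excess w i = 0\<close> st by (auto simp: of_bool_def split: if_splits)
          show ?thesis
          proof (rule finish[of i])
            show "f_op n i r \<noteq> None" using phir st True \<open>int i \<in> set w\<close> unfolding mem by simp
            show "set r' = set w' - {int i, - int i}" if "f_op n i r = Some r'" for r'
            proof -
              have "\<not> up_bar i r r'" using True unfolding up_bar_def mem by simp
              then have "set r' = insert (int i + 1) (set r - {int i})"
                using fr[OF that] by (auto simp: up_i_def)
              moreover have "set w' = insert (- int i) (set w - {- int i - 1})" using b by (simp add: up_bar_def)
              ultimately show ?thesis using i(1) st unfolding r(2) True sum by auto
            qed
            show "excess w' p \<le> 1" if "p \<le> n" for p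
              using that h1[of p] hw'[of p] \<open>excess w i = 0\<close> by (cases "p = i") auto
            show "excess w' p \<le> 0" if "p < i" for p
              using that h0[of p] hw'[of p] True by simp
          qed (use i hw'[of i] \<open>excess w i = 0\<close> in auto)
        next
          case qi: False
          \<comment> \<open>The only value that grows is the one at \<open>i\<close>, and it grows
            just to the old value at a neighbour, so the bounds are inherited.\<close>
          have less: "excess w' i = excess w (i - 1) \<or> excess w' i = excess w (i + 1)"
            using hi b hw'[of i] by (auto simp: up_bar_def)
          have less1: "excess w (i - 1) \<le> 1" "excess w (i + 1) \<le> 1" using h1 i' by simp_all
          have less0: "excess w (i - 1) \<le> 0 \<and> excess w (i + 1) \<le> 0" if "i < q"
            using h0[of "i - 1"] h0[of "i + 1"] that qi by (simp add: less_imp_diff_less)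
          show ?thesis
          proof (rule finish[of q])
            show "f_op n i r \<noteq> None" using phir b qi \<open>q \<noteq> i\<close> unfolding mem by (simp add: up_bar_def)
            show "set r' = set w' - {int q, - int q}" if "f_op n i r = Some r'" for r'
            proof -
              have "\<not> up_i i r r'" using b qi \<open>q \<noteq> i\<close> unfolding up_i_def up_bar_def mem by blast
              then have "set r' = insert (- int i) (set r - {- int i - 1})"
                using fr[OF that] by (auto simp: up_bar_def)
              moreover have "set w' = insert (- int i) (set w - {- int i - 1})" using b by (simp add: up_bar_def)
              ultimately show ?thesis using qi \<open>q \<noteq> i\<close> unfolding r(2) by auto
            qed
            show "excess w' p \<le> 1" if "p \<le> n" for p
              using that h1[of p] less1 hw'[of p] less by (cases "p = i") auto
            show "excess w' p \<le> 0" if "p < q" for p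
              using that h0[of p] less0 hw'[of p] less by (cases "p = i") auto
          qed (use hw'[of q] q \<open>q \<noteq> i\<close> in auto)
        qed
      qed
    qed
  qed
qed

section \<open>Compatibility of the plactic congruence with the crystal operators\<close>

lemma knuth_rel_f_op:
  assumes "knuth_rel n l r" "1 \<le> i" "i \<le> n"
  shows "rel_option (knuth_rel n) (f_op n i l) (f_op n i r)"
  using assms(1)
proof cases
  case (R1a x y z)
  then show ?thesis using knuth_triple_f_op[of n y z x y x z i] assms
    by (auto simp: ktriple_def ktriple_a_def pos_less_iff pos_le_iff pos_def letters_def letter_less_def letter_le_def)
next
  case (R1b x y z)
  then show ?thesis using knuth_triple_f_op[of n x z y z x y i] assms
    by (auto simp: ktriple_def ktriple_b_def pos_def letters_def letter_less_def letter_le_def)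
next
  case (R2a x y)
  then show ?thesis using knuth_triple_f_op[of n y "- (x - 1)" "x - 1" y x "- x" i] assms
    by (auto simp: ktriple_def ktriple_a_def pos_def letters_def letter_less_def letter_le_def)
next
  case (R2b x y)
  then show ?thesis using knuth_triple_f_op[of n x "- x" y "- (x - 1)" "x - 1" y i] assms
    by (auto simp: ktriple_def ktriple_b_def pos_def letters_def letter_less_def letter_le_def)
next
  case (R3 z)
  then have "0 < z" by (auto simp: contractible_letter_def)
  then show ?thesis using contraction_f_op[OF knuth_R3_contraction[OF R3(2-4)] assms(2,3)] R3(1) by simp
qed

lemma letter_less_neg: "x \<in> letters n \<Longrightarrow> y \<in> letters n \<Longrightarrow> - x \<prec> - y \<longleftrightarrow> y \<prec> x"
  by (auto simp: letters_def letter_less_def)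

lemma letter_le_neg: "x \<in> letters n \<Longrightarrow> y \<in> letters n \<Longrightarrow> - x \<preceq> - y \<longleftrightarrow> y \<preceq> x"
  by (auto simp: letter_le_def letter_less_neg)

lemma contraction_star:
  assumes "contraction n w q"
  shows "contraction n (star w) q"
  using assms column_star by (auto simp: contraction_def excess_star)

lemma star_del_pair: "star (del_pair q w) = del_pair q (star w)"
  by (induction w) (auto simp: star_Cons)

lemma knuth_rel_letters:
  assumes "knuth_rel n l r"
  shows "l \<in> words n" "r \<in> words n"
  using assms by (cases; force simp: minimal_nonadmissible_def is_column_def letters_def)+

text \<open>\<open>star\<close> exchanges R1a with R1b and R2a with R2b, reversing their direction,
  and keeps R3 in its direction because \<open>excess\<close> is invariant; hence the
  disjunction.\<close>

lemma knuth_rel_star: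
  assumes "knuth_rel n l r"
  shows "knuth_rel n (star l) (star r) \<or> knuth_rel n (star r) (star l)"
  using assms
proof cases
  case (R1a x y z)
  then show ?thesis using knuth_rel.R1b[of "- z" "- y" "- x" n]
    by (auto simp: star_def letter_less_neg letter_le_neg)
next
  case (R1b x y z)
  then show ?thesis using knuth_rel.R1a[of "- z" "- y" "- x" n]
    by (auto simp: star_def letter_less_neg letter_le_neg)
next
  case (R2a x y)
  have "x \<in> letters n" using R2a by (auto simp: letters_def)
  then have "x \<preceq> - y" "- y \<preceq> - x"
    using R2a letter_le_neg[of y n x] letter_le_neg[of "-x" n y] by auto
  then show ?thesis using R2a knuth_rel.R2b[of x n "- y"] by (auto simp: star_def)
next
  case (R2b x y)
  have "x \<in> letters n" using R2b by (auto simp: letters_def)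
  then have "x \<preceq> - y" "- y \<preceq> - x"
    using R2b letter_le_neg[of y n x] letter_le_neg[of "-x" n y] by auto
  then show ?thesis using R2b knuth_rel.R2a[of x n "- y"] by (auto simp: star_def)
next
  case (R3 z)
  then have z: "int (nat z) = z" by (auto simp: contractible_letter_def)
  show ?thesis
    using contraction_knuth_rel[OF contraction_star[OF knuth_R3_contraction[OF R3(2-4)]]] R3(1)
      star_del_pair[of "nat z" l] unfolding z by simp
qed

text \<open>\<open>phi\<close> is the number of times \<open>f_op\<close> can be applied, and the
  relation survives every application.\<close>

lemma knuth_rel_phi:
  assumes "knuth_rel n l r" "1 \<le> i" "i \<le> n"
  shows "phi n i l = phi n i r"
  using assms(1)
proof (induction "phi n i l" arbitrary: l r)
  case 0
  then show ?case using knuth_rel_f_op[OF 0(2) assms(2,3)] f_op_None_iff[of n i l] f_op_None_iff[of n i r] by auto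
next
  case (Suc k)
  then obtain l' where l': "f_op n i l = Some l'" using f_op_None_iff[of n i l] by fastforce
  then obtain r' where r': "f_op n i r = Some r'" "knuth_rel n l' r'"
    using knuth_rel_f_op[OF Suc(3) assms(2,3)] by (auto simp: option_rel_Some1)
  have "k = phi n i l'" using f_op_inverse[OF l' assms(2,3)] Suc(2) by simp
  then show ?case using Suc(1)[OF _ r'(2)] Suc(2) f_op_inverse[OF r'(1) assms(2,3)] by simp
qed

lemma knuth_rel_eps:
  assumes "knuth_rel n l r" "1 \<le> i" "i \<le> n"
  shows "eps n i l = eps n i r"
  using knuth_rel_star[OF assms(1)] knuth_rel_phi[OF _ assms(2,3)] assms(2)
  by (metis phi_star)

text \<open>By the tensor product rule the surrounding words interact with the middle factor only
  through its \<open>phi\<close> and \<open>eps\<close>, which agree on both sides; so the operator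
  hits the same factor in both words.\<close>

lemma knuth_step_f_op:
  assumes "knuth_step n u v" "1 \<le> i" "i \<le> n"
  shows "phi n i u = phi n i v \<and> eps n i u = eps n i v \<and> rel_option (knuth_step n) (f_op n i u) (f_op n i v)"
  using assms(1)
proof cases
  case (1 l r a b)
  note eq = knuth_rel_phi[OF 1(3) assms(2,3)] knuth_rel_eps[OF 1(3) assms(2,3)]
  note rel = knuth_rel_f_op[OF 1(3) assms(2,3)]
  have st: "x \<in> words n \<Longrightarrow> y \<in> words n \<Longrightarrow> knuth_rel n l' r' \<Longrightarrow>
     knuth_step n (x @ l' @ y) (x @ r' @ y)" for x y l' r'
    by (rule knuth_step.intros)
  have fa: "a' \<in> words n" if "f_op n i a = Some a'" for a' using f_op_letters[OF that assms(2,3) 1(4)] .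
  have fb: "b' \<in> words n" if "f_op n i b = Some b'" for b' using f_op_letters[OF that assms(2,3) 1(5)] .
  show ?thesis
    using rel fa fb 1(3-5) eq
    by (cases "f_op n i a"; cases "f_op n i b")
      (auto simp: 1(1,2) phi_append eps_append f_op_append option_rel_Some1 option_rel_Some2
        option.rel_map intro: st elim!: option.rel_cases)
qed

lemma plactic_refl [simp]: "plactic_equiv n u u" by (simp add: plactic_equiv_def)
lemma plactic_sym: "plactic_equiv n u v \<Longrightarrow> plactic_equiv n v u"
  by (simp add: plactic_equiv_def equivclp_sym)
lemma plactic_trans [trans]: "plactic_equiv n u v \<Longrightarrow> plactic_equiv n v x \<Longrightarrow> plactic_equiv n u x"
  unfolding plactic_equiv_def by (rule equivclp_trans)
lemma plactic_step: "knuth_step n u v \<Longrightarrow> plactic_equiv n u v"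
  unfolding plactic_equiv_def by (rule r_into_equivclp)
lemma plactic_rel: "knuth_rel n u v \<Longrightarrow> plactic_equiv n u v"
  using knuth_step.intros[of n u v "[]" "[]"] by (auto intro: plactic_step)

lemma plactic_letters:
  assumes "plactic_equiv n u v"
  shows "u \<in> words n \<longleftrightarrow> v \<in> words n"
  using assms unfolding plactic_equiv_def
proof (induction rule: equivclp_induct)
  case (step y z)
  moreover have "y \<in> words n \<and> z \<in> words n" if "knuth_step n y z" for y z
    using that by cases (use knuth_rel_letters in auto)
  ultimately show ?case by blast
qed simp

lemma plactic_context:
  assumes "plactic_equiv n u v" "a \<in> words n" "b \<in> words n"
  shows "plactic_equiv n (a @ u @ b) (a @ v @ b)"
  using assms(1) unfolding plactic_equiv_def
proof (induction rule: equivclp_induct)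
  case (step y z)
  moreover have "knuth_step n (a @ y @ b) (a @ z @ b)" if "knuth_step n y z" for y z
    using that
  proof cases
    case (1 l r c d)
    then show ?thesis using knuth_step.intros[OF 1(3), of "a @ c" "d @ b"] assms(2,3) by simp
  qed
  ultimately show ?case by (meson equivclp_into_equivclp)
qed simp

lemma plactic_f_op:
  assumes "plactic_equiv n u v" "1 \<le> i" "i \<le> n"
  shows "phi n i u = phi n i v \<and> eps n i u = eps n i v \<and> rel_option (plactic_equiv n) (f_op n i u) (f_op n i v)"
  using assms(1) unfolding plactic_equiv_def
proof (induction rule: equivclp_induct)
  case base
  show ?case by (simp add: option.rel_refl)
next
  case (step y z)
  have *: "phi n i y = phi n i z \<and> eps n i y = eps n i z \<and>
      rel_option (equivclp (knuth_step n)) (f_op n i y) (f_op n i z)"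
    using step.hyps(2)
  proof
    assume "knuth_step n y z"
    from knuth_step_f_op[OF this assms(2,3)] show ?thesis
      by (auto elim!: option.rel_mono_strong)
  next
    assume "knuth_step n z y"
    from knuth_step_f_op[OF this assms(2,3)] show ?thesis
      by (cases "f_op n i y"; cases "f_op n i z") (auto intro: equivclp_sym)
  qed
  show ?case using step.IH *
    by (cases "f_op n i u"; cases "f_op n i y"; cases "f_op n i z") (auto intro: equivclp_trans)
qed

lemma plactic_star:
  assumes "plactic_equiv n u v"
  shows "plactic_equiv n (star u) (star v)"
  using assms unfolding plactic_equiv_def
proof (induction rule: equivclp_induct)
  case (step y z)
  moreover have "equivclp (knuth_step n) (star y) (star z)" if "knuth_step n y z" for y z
    using that
  proof cases
    case (1 l r c d)
    have "star c \<in> words n" "star d \<in> words n" using 1 by (simp_all only: star_letters)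
    then show ?thesis
      using knuth_rel_star[OF 1(3)] knuth_step.intros[of n "star l" "star r" "star d" "star c"]
        knuth_step.intros[of n "star r" "star l" "star d" "star c"] 1
      by (auto simp: star_append intro: equivclp_sym)
  qed
  ultimately show ?case by (meson equivclp_sym equivclp_trans)
qed simp

lemma plactic_e_op:
  assumes "plactic_equiv n u v" "1 \<le> i" "i \<le> n"
  shows "rel_option (plactic_equiv n) (e_op n i u) (e_op n i v)"
  using plactic_f_op[OF plactic_star[OF assms(1)] assms(2,3)] assms(2,3)
  by (cases "e_op n i u"; cases "e_op n i v") (auto simp: f_op_star dest: plactic_star)

lemma plactic_wt:
  assumes "plactic_equiv n u v" "u \<in> words n"
  shows "wt u = wt v"
  using wt_eqI[of u n v] plactic_letters[OF assms(1)] plactic_f_op[OF assms(1)] assms(2) by blast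

section \<open>Split columns\<close>

text \<open>Integers beyond \<open>n\<close> are included, so this set is infinite and only its
  bounded parts are counted.\<close>

definition gaps :: "int list \<Rightarrow> int set" where
  "gaps C = {t. 0 < t \<and> t \<notin> set C \<and> - t \<notin> set C}"

definition pairs :: "int list \<Rightarrow> int set" where
  "pairs C = {z \<in> set C. 0 < z \<and> - z \<in> set C}"

lemma finite_gaps_below [simp]: "finite {t \<in> gaps C. t < b}"
  by (rule finite_subset[of _ "{0<..<b}"]) (auto simp: gaps_def)

lemma finite_pairs [simp]: "finite (pairs C)" by (simp add: pairs_def)

lemma length_split_letters_from: "length (split_letters_from C b zs) = length zs"
  by (induction zs arbitrary: b) (auto simp: Let_def)

lemma split_letters_from_props:
  assumes "sorted_wrt (>) zs" "length zs \<le> card {t \<in> gaps C. t < b}"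
    "\<And>z. z \<in> set zs \<Longrightarrow> length (filter (\<lambda>y. y \<le> z) zs) \<le> card {t \<in> gaps C. t < z}"
    and ts: "ts = split_letters_from C b zs"
  shows "set ts \<subseteq> {t \<in> gaps C. t < b} \<and> sorted_wrt (>) ts \<and>
    (\<forall>t\<in>gaps C. t < b \<and> t \<notin> set ts \<longrightarrow> length (filter ((<) t) zs) \<le> length (filter ((<) t) ts)) \<and>
    (\<forall>t. length (filter ((<) t) ts) \<le> length (filter ((<) t) zs))"
  using assms
proof (induction zs arbitrary: b ts)
  case Nil
  then show ?case by simp
next
  case (Cons z zs)
  define G where "G = {t \<in> gaps C. t < min b z}"
  have zs: "\<And>y. y \<in> set zs \<Longrightarrow> y < z" using Cons.prems(1) by auto
  have "filter (\<lambda>y. y \<le> z) (z # zs) = z # zs"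
    using zs by (intro filter_True) (auto simp: less_imp_le)
  then have "Suc (length zs) \<le> card {t \<in> gaps C. t < z}" using Cons.prems(3)[of z] by simp
  \<comment> \<open>The minimum of \<open>b\<close> and \<open>z\<close> is one of the two, and each
    has its own counting hypothesis.\<close>
  then have cG: "Suc (length zs) \<le> card G" using Cons.prems(2) by (simp add: G_def min_def)
  have fG: "finite G" unfolding G_def by (rule finite_subset[OF _ finite_gaps_below[of C b]]) auto
  then have neG: "G \<noteq> {}" using cG by auto
  define s where "s = Max G"
  have sG: "s \<in> G" "\<And>t. t \<in> G \<Longrightarrow> t \<le> s" using Max_in[OF fG neG] Max_ge[OF fG] by (auto simp: s_def)
  have "G = {t. 0 < t \<and> t < min b z \<and> t \<notin> set C \<and> - t \<notin> set C}" by (auto simp: G_def gaps_def)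
  then have ts: "ts = s # split_letters_from C s zs" using Cons.prems(4) by (simp add: Let_def s_def)
  have "{t \<in> gaps C. t < s} = G - {s}" using sG unfolding G_def by force
  then have c: "length zs \<le> card {t \<in> gaps C. t < s}" using cG sG(1) fG by simp
  have c': "length (filter (\<lambda>x. x \<le> y) zs) \<le> card {t \<in> gaps C. t < y}" if "y \<in> set zs" for y
    using Cons.prems(3)[of y] that zs[OF that] by simp
  have srt: "sorted_wrt (>) zs" using Cons.prems(1) by simp
  define ts' where "ts' = split_letters_from C s zs"
  note IH = Cons.IH[OF srt c c' ts'_def]
  have s: "s \<in> gaps C" "s < b" "s < z" using sG by (auto simp: G_def)
  have t1: "set ts \<subseteq> {t \<in> gaps C. t < b}" using IH s ts ts'_def by fastforce
  have t2: "sorted_wrt (>) ts" using IH ts ts'_def by auto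
  have t3: "length (filter ((<) t) (z # zs)) \<le> length (filter ((<) t) ts)"
    if t: "t \<in> gaps C" "t < b" "t \<notin> set ts" for t
  proof (cases "t < z")
    case True
    then have "t < s" using sG(2)[of t] t ts by (auto simp: G_def order_less_le)
    then show ?thesis using IH t ts ts'_def True by simp
  next
    case False
    then have "filter ((<) t) (z # zs) = []" using zs by (force simp: filter_empty_conv)
    then show ?thesis by (metis le0 list.size(3))
  qed
  have t4: "length (filter ((<) t) ts) \<le> length (filter ((<) t) (z # zs))" for t
  proof (cases "t < s")
    case True
    then show ?thesis using IH ts ts'_def s(3) by simp
  next
    case False
    then have "filter ((<) t) ts = []" using IH ts ts'_def by (force simp: filter_empty_conv)
    then show ?thesis by (metis le0 list.size(3))
  qed
  show ?case using t1 t2 t3 t4 by blast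
qed

definition matched :: "int list \<Rightarrow> int set" where
  "matched C = set (split_letters C)"

lemma pair_gap_count:
  "excess C q = int (card {z \<in> pairs C. z \<le> int q}) - int (card {t \<in> gaps C. t \<le> int q})"
proof (induction q)
  case 0
  have e: "{z \<in> pairs C. z \<le> int 0} = {}" "{t \<in> gaps C. t \<le> int 0} = {}" by (auto simp: pairs_def gaps_def)
  show ?case unfolding e by simp
next
  case (Suc q)
  have fin: "finite {t \<in> gaps C. t \<le> int q}"
    by (rule finite_subset[of _ "{0..int q}"]) (auto simp: gaps_def)
  have le: "z \<le> int (Suc q) \<longleftrightarrow> z = int q + 1 \<or> z \<le> int q" for z by auto
  have "{z \<in> pairs C. z \<le> int (Suc q)} = (if int q + 1 \<in> pairs C then insert (int q + 1) {z \<in> pairs C. z \<le> int q}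
     else {z \<in> pairs C. z \<le> int q})" unfolding le by auto
  then have 1: "int (card {z \<in> pairs C. z \<le> int (Suc q)}) = int (card {z \<in> pairs C. z \<le> int q}) + of_bool (int q + 1 \<in> pairs C)"
    by simp
  have "{z \<in> gaps C. z \<le> int (Suc q)} = (if int q + 1 \<in> gaps C then insert (int q + 1) {z \<in> gaps C. z \<le> int q}
     else {z \<in> gaps C. z \<le> int q})" unfolding le by auto
  then have 2: "int (card {z \<in> gaps C. z \<le> int (Suc q)}) = int (card {z \<in> gaps C. z \<le> int q}) + of_bool (int q + 1 \<in> gaps C)"
    using fin by simp
  have "excess C (Suc q) = excess C q + of_bool (int q + 1 \<in> pairs C) - of_bool (int q + 1 \<in> gaps C)"
    by (auto simp: excess_Suc pairs_def gaps_def minus_diff_commute)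
  then show ?case using Suc 1 2 by simp
qed

lemma paired_letters_props: "set (paired_letters C) = pairs C" "sorted_wrt (>) (paired_letters C)"
proof -
  show "set (paired_letters C) = pairs C" by (simp add: paired_letters_def pairs_def)
  have "sorted_wrt (<) (sorted_list_of_set {z \<in> set C. 0 < z \<and> - z \<in> set C})" by simp
  then show "sorted_wrt (>) (paired_letters C)" unfolding paired_letters_def by (simp add: sorted_wrt_rev)
qed

lemma sorted_greater_distinct: "sorted_wrt (>) (zs :: int list) \<Longrightarrow> distinct zs"
  by (induction zs) auto

lemma length_filter_card: "sorted_wrt (>) (zs :: int list) \<Longrightarrow> length (filter p zs) = card {z \<in> set zs. p z}"
  using distinct_card[of "filter p zs"] sorted_greater_distinct[of zs] by simp

lemma length_split_letters: "length (split_letters C) = length (paired_letters C)"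
  by (auto simp: split_letters_def length_split_letters_from simp del: split_letters_from.simps split: list.splits)

lemma split_letters_conj:
  assumes "admissible n C"
  shows "matched C \<subseteq> gaps C \<and> sorted_wrt (>) (split_letters C) \<and>
    (\<forall>t. t \<in> gaps C \<longrightarrow> t \<notin> matched C \<longrightarrow> card {z \<in> pairs C. t < z} \<le> card {s \<in> matched C. t < s}) \<and>
    (\<forall>t. card {s \<in> matched C. t < s} \<le> card {z \<in> pairs C. t < z}) \<and>
    matched C \<subseteq> {0<..int n}"
proof -
  have C: "is_column n C" "\<And>q. q \<le> n \<Longrightarrow> excess C q \<le> 0"
    using assms admissible_iff[of n C] by (auto simp: admissible_def)
  \<comment> \<open>\<open>excess\<close> \<le> 0 at \<open>z\<close> means that up to
    \<open>z\<close> there are at least as many gaps as pairs; \<open>z\<close> itself is no gap, so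
    the gaps are even below \<open>z\<close>.\<close>
  have hall: "card {y \<in> pairs C. y \<le> z} \<le> card {t \<in> gaps C. t < z}" if "z \<in> pairs C" for z
  proof -
    have z: "0 < z" "nat z \<le> n" using that C(1) by (auto simp: pairs_def is_column_def letters_def)
    have "{t \<in> gaps C. t \<le> z} = {t \<in> gaps C. t < z}" using that by (auto simp: pairs_def gaps_def order_less_le)
    then show ?thesis using C(2)[OF z(2)] z(1) by (simp add: pair_gap_count)
  qed
  show ?thesis
  proof (cases "paired_letters C")
    case Nil
    then have "pairs C = {}" "matched C = {}"
      using paired_letters_props[of C] by (auto simp: matched_def split_letters_def)
    then show ?thesis using Nil by (simp add: split_letters_def)
  next
    case (Cons z zs)
    have srt: "sorted_wrt (>) (z # zs)" and set: "set (z # zs) = pairs C"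
      using paired_letters_props[of C] Cons by auto
    have ts: "split_letters C = split_letters_from C z (z # zs)" using Cons by (simp add: split_letters_def)
    have z: "z \<in> pairs C" "\<And>y. y \<in> pairs C \<Longrightarrow> y \<le> z"
      using set srt by (auto simp flip: set)
    have c': "length (filter (\<lambda>x. x \<le> y) (z # zs)) \<le> card {t \<in> gaps C. t < y}" if "y \<in> set (z # zs)" for y
      using hall[of y] that unfolding length_filter_card[OF srt] set by simp
    have "filter (\<lambda>x. x \<le> z) (z # zs) = z # zs" using z set by (intro filter_True) auto
    then have c: "length (z # zs) \<le> card {t \<in> gaps C. t < z}" using c'[of z] by (metis list.set_intros(1))
    note p = split_letters_from_props[OF srt c c' ts]
    have srt': "sorted_wrt (>) (split_letters C)" using p by blast
    have big: "{y \<in> pairs C. t < y} = {}" if "\<not> t < z" for t using z(2) that by force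
    have "z \<le> int n" using z(1) C(1) by (auto simp: pairs_def is_column_def letters_def)
    then show ?thesis
      using p big unfolding length_filter_card[OF srt] length_filter_card[OF srt'] set matched_def
      by (fastforce simp: gaps_def)
  qed
qed

lemmas split_letters_props =
  split_letters_conj[THEN conjunct1]
  split_letters_conj[THEN conjunct2, THEN conjunct1]
  split_letters_conj[THEN conjunct2, THEN conjunct2, THEN conjunct1, rule_format]
  split_letters_conj[THEN conjunct2, THEN conjunct2, THEN conjunct2, THEN conjunct1, rule_format]
  split_letters_conj[THEN conjunct2, THEN conjunct2, THEN conjunct2, THEN conjunct2]

definition pending :: "int list \<Rightarrow> nat \<Rightarrow> int" where
  "pending C q = int (card {z \<in> pairs C. int q < z}) - int (card {s \<in> matched C. int q < s})"

lemma card_above_Suc: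
  fixes S :: "int set"
  assumes "finite S"
  shows "int (card {z \<in> S. int q < z}) = int (card {z \<in> S. int (Suc q) < z}) + of_bool (int q + 1 \<in> S)"
proof -
  have "int q < z \<longleftrightarrow> z = int q + 1 \<or> int (Suc q) < z" for z by auto
  then have "{z \<in> S. int q < z} = (if int q + 1 \<in> S then insert (int q + 1) {z \<in> S. int (Suc q) < z}
      else {z \<in> S. int (Suc q) < z})" by auto
  then show ?thesis using assms by simp
qed

lemma finite_matched [simp]: "finite (matched C)" by (simp add: matched_def)

lemma pending_Suc:
  "pending C q = pending C (Suc q) + of_bool (int q + 1 \<in> pairs C) - of_bool (int q + 1 \<in> matched C)"
  unfolding pending_def using card_above_Suc[of "pairs C" q] card_above_Suc[of "matched C" q] by simp

text \<open>Matching pairs with gaps is bracket matching, so that the number of pairs above \<open>q\<close> whose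
  partner is at most \<open>q\<close> is the height of a walk above its current position.\<close>

lemma pending_max:
  assumes "admissible n C" "q \<le> n"
  shows "(\<forall>z. q \<le> z \<and> z \<le> n \<longrightarrow> excess C z - excess C q \<le> pending C q) \<and>
    (\<exists>z. q \<le> z \<and> z \<le> n \<and> excess C z - excess C q = pending C q)"
  using assms(2)
proof (induction rule: inc_induct)
  case base
  have e: "{z \<in> pairs C. int n < z} = {}" "{z \<in> matched C. int n < z} = {}"
    using assms(1) split_letters_props(5)[OF assms(1)]
    by (auto simp: admissible_def is_column_def pairs_def letters_def)
  have "pending C n = 0" unfolding pending_def e by simp
  then show ?case by auto
next
  case (step q)
  note P = split_letters_props[OF assms(1)]
  have nonneg: "0 \<le> pending C p" for p using P(4)[of "int p"] by (simp add: pending_def)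
  have h: "excess C (Suc q) = excess C q + of_bool (int q + 1 \<in> pairs C) - of_bool (int q + 1 \<in> gaps C)"
    by (auto simp: excess_Suc pairs_def gaps_def minus_diff_commute)
  have disj: "\<not> (int q + 1 \<in> pairs C \<and> int q + 1 \<in> gaps C)" by (auto simp: pairs_def gaps_def)
  obtain z where z: "Suc q \<le> z" "z \<le> n" "excess C z - excess C (Suc q) = pending C (Suc q)" using step.IH by blast
  have ub: "excess C z - excess C (Suc q) \<le> pending C (Suc q)" if "Suc q \<le> z" "z \<le> n" for z using step.IH that by blast
  show ?case
  proof (cases "int q + 1 \<in> gaps C \<and> int q + 1 \<notin> matched C")
    case True
    then have "pending C (Suc q) \<le> 0" using P(3)[of "int q + 1"] by (simp add: pending_def add.commute)
    then have "pending C q = 0" using pending_Suc[of C q] nonneg[of "Suc q"] True disj by simp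
    moreover have "excess C z - excess C q \<le> 0" if "Suc q \<le> z" "z \<le> n" for z
      using ub[OF that] h True disj \<open>pending C (Suc q) \<le> 0\<close> by simp
    ultimately show ?thesis using step.hyps by (metis Suc_leI diff_self le_neq_implies_less order_refl less_imp_le)
  next
    case False
    then have eq: "pending C q = pending C (Suc q) + excess C (Suc q) - excess C q"
      using pending_Suc[of C q] h P(1) by (auto simp: of_bool_def)
    have "excess C z - excess C q \<le> pending C q" if "Suc q \<le> z" "z \<le> n" for z
      using ub[OF that] eq by simp
    moreover have "excess C z - excess C q = pending C q" using z eq by simp
    moreover have "excess C y - excess C q \<le> pending C q" if "q \<le> y" "y \<le> n" for y
      using calculation(1)[of y] that nonneg[of q] by (cases "y = q") auto
    ultimately show ?thesis using z(1,2) by (metis Suc_leD)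
  qed
qed

lemma card_matched:
  assumes "admissible n C"
  shows "card (matched C) = card (pairs C)"
proof -
  have "length (filter (\<lambda>_. True) (split_letters C)) = length (filter (\<lambda>_. True) (paired_letters C))"
    by (simp add: length_split_letters)
  then show ?thesis
    unfolding length_filter_card[OF split_letters_props(2)[OF assms]]
      length_filter_card[OF paired_letters_props(2)] paired_letters_props(1) matched_def by simp
qed

lemma split_map_image:
  assumes "admissible n C"
  shows "split_map C ` pairs C = matched C" "\<And>x. x \<notin> pairs C \<Longrightarrow> split_map C x = x"
proof -
  let ?zs = "paired_letters C" and ?ts = "split_letters C"
  have d: "distinct ?zs" using sorted_greater_distinct[OF paired_letters_props(2)] .
  have nth: "split_map C (?zs ! k) = ?ts ! k" if "k < length ?zs" for k
    using map_of_zip_nth[OF length_split_letters[symmetric] d] that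
    by (simp add: split_map_def length_split_letters)
  show "split_map C ` pairs C = matched C"
    using nth unfolding paired_letters_props(1)[symmetric] matched_def
    by (force simp: set_conv_nth length_split_letters image_iff)
  show "split_map C x = x" if "x \<notin> pairs C" for x
    using that unfolding paired_letters_props(1)[symmetric]
    by (simp add: split_map_def length_split_letters map_of_zip_is_None[THEN iffD2])
qed

lemma set_map_split_map:
  assumes "admissible n C"
  shows "set (map (split_map C) C) = (set C - pairs C) \<union> matched C"
proof -
  have "set C = (set C - pairs C) \<union> pairs C" by (auto simp: pairs_def)
  then have "set (map (split_map C) C) = split_map C ` (set C - pairs C) \<union> matched C"
    by (metis set_map image_Un split_map_image(1)[OF assms])
  also have "split_map C ` (set C - pairs C) = set C - pairs C"
    using split_map_image(2)[OF assms] by (auto simp: image_iff)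
  finally show ?thesis .
qed

lemma set_reorder: "0 \<notin> set C \<Longrightarrow> set (reorder C) = set C"
  by (auto simp: reorder_def) (metis linorder_neqE_linordered_idom)

lemma length_reorder: "0 \<notin> set C \<Longrightarrow> length (reorder C) = length C"
proof -
  assume "0 \<notin> set C"
  then have "filter (\<lambda>x. x < 0) C = filter (\<lambda>x. \<not> 0 < x) C"
    by (intro filter_cong) (auto simp: order_less_le)
  then show ?thesis unfolding reorder_def using sum_length_filter_compl[of "\<lambda>x. 0 < x" C] by simp
qed

lemma column_reorder:
  assumes "set C \<subseteq> letters n" "distinct C"
  shows "is_column n (reorder C)"
proof -
  have 0: "0 \<notin> set C" using assms(1) by (auto simp: letters_def)
  have s: "sorted_wrt (<) (sort (filter p C))" for p :: "int \<Rightarrow> bool"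
    using assms(2) by (simp add: strict_sorted_iff)
  have "sorted_wrt (\<prec>) (sort (filter (\<lambda>x. 0 < x) C))" "sorted_wrt (\<prec>) (sort (filter (\<lambda>x. x < 0) C))"
    by (rule sorted_wrt_mono_rel[OF _ s]; auto simp: letter_less_def)+
  then show ?thesis using assms(1) set_reorder[OF 0]
    unfolding is_column_def reorder_def by (auto simp: sorted_wrt_append letter_less_def)
qed

lemma left_column_props:
  assumes "admissible n C"
  shows "is_column n (left_column C)" "set (left_column C) = (set C - pairs C) \<union> matched C"
    "length (left_column C) = length C"
proof -
  have C: "is_column n C" using assms by (simp add: admissible_def)
  note P = split_letters_props[OF assms]
  let ?w = "map (split_map C) C"
  have sub: "pairs C \<subseteq> set C" by (auto simp: pairs_def)
  note w = set_map_split_map[OF assms]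
  have disj: "(set C - pairs C) \<inter> matched C = {}" using P(1) by (auto simp: gaps_def)
  have "card (set ?w) = card (set C) - card (pairs C) + card (pairs C)"
    unfolding w using card_Un_disjoint[OF _ _ disj] card_Diff_subset[OF _ sub] card_matched[OF assms] by simp
  then have "card (set ?w) = length ?w"
    using distinct_card[OF column_distinct[OF C]] card_mono[OF _ sub] by simp
  then have d: "distinct ?w" by (rule card_distinct)
  have l: "set ?w \<subseteq> letters n" unfolding w using C P(5) by (auto simp: is_column_def letters_def)
  then have "0 \<notin> set ?w" by (auto simp: letters_def)
  then show "is_column n (left_column C)" "set (left_column C) = (set C - pairs C) \<union> matched C"
    "length (left_column C) = length C"
    unfolding left_column_def using column_reorder[OF l d] set_reorder length_reorder w by auto
qed

lemma split_star: "gaps (star C) = gaps C" "pairs (star C) = pairs C" "split_map (star C) = split_map C"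
  "matched (star C) = matched C"
proof -
  have m: "t \<in> set (star C) \<longleftrightarrow> - t \<in> set C" for t
    by (auto simp: set_star image_iff) (metis minus_minus)
  show "gaps (star C) = gaps C" "pairs (star C) = pairs C" by (auto simp: gaps_def pairs_def m)
  have p: "paired_letters (star C) = paired_letters C"
    unfolding paired_letters_def by (rule arg_cong[where f = "\<lambda>S. rev (sorted_list_of_set S)"]) (auto simp: m)
  have f: "split_letters_from (star C) b zs = split_letters_from C b zs" for b zs
  proof (induction zs arbitrary: b)
    case (Cons z zs)
    have "{t. 0 < t \<and> t < min b z \<and> t \<notin> set (star C) \<and> - t \<notin> set (star C)} =
       {t. 0 < t \<and> t < min b z \<and> t \<notin> set C \<and> - t \<notin> set C}" by (auto simp: m)
    then show ?case using Cons by (simp only: split_letters_from.simps Let_def)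
  qed simp
  have "split_letters (star C) = split_letters C" by (simp only: split_letters_def p f)
  then show "split_map (star C) = split_map C" "matched (star C) = matched C"
    by (simp_all add: split_map_def p fun_eq_iff matched_def)
qed

lemma admissible_star: "admissible n C \<Longrightarrow> admissible n (star C)"
  using admissible_iff column_star by (metis admissible_def excess_star)

text \<open>Pairs, gaps and hence the split letters are invariant under \<open>star\<close>, so
  every statement on right columns reduces to one on left columns.\<close>

lemma right_column_star:
  assumes "admissible n C"
  shows "right_column C = star (left_column (star C))"
proof -
  note L = left_column_props[OF admissible_star[OF assms]]
  let ?w = "map (\<lambda>x. - split_map C (- x)) C"
  have C: "is_column n C" using assms by (simp add: admissible_def)
  have eq: "?w = rev (map uminus (map (split_map (star C)) (star C)))"
    unfolding split_star(3) by (simp add: star_def rev_map comp_def)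
  have m: "set (map (split_map (star C)) (star C)) = set (left_column (star C))"
    using set_map_split_map[OF admissible_star[OF assms]] L(2) by simp
  have w: "set ?w = set (star (left_column (star C)))" unfolding eq set_star m[symmetric] by (simp add: image_image)
  have l: "set ?w \<subseteq> letters n"
    unfolding w using column_star[OF L(1)] by (simp add: is_column_def)
  have "card (set ?w) = card (set (star (left_column (star C))))" using w by simp
  also have "\<dots> = length C" using distinct_card[OF column_distinct[OF column_star[OF L(1)]]] L(3) by simp
  finally have d: "distinct ?w" by (intro card_distinct) simp
  have "0 \<notin> set ?w" using l by (auto simp: letters_def)
  then have "set (right_column C) = set (star (left_column (star C)))"
    unfolding right_column_def using set_reorder w by metis
  moreover have "is_column n (right_column C)" unfolding right_column_def using column_reorder[OF l d] .
  ultimately show ?thesis using column_unique column_star[OF L(1)] by blast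
qed

text \<open>Replacing pairs by their smaller partners adds to the letters up to \<open>q\<close>
  exactly one for each pair above \<open>q\<close> whose partner is at most
  \<open>q\<close>.\<close>

lemma left_column_counts:
  assumes "admissible n C"
  shows "npos (left_column C) q = npos C q + pending C q" "nneg (left_column C) q = nneg C q"
proof -
  note L = left_column_props[OF assms] and P = split_letters_props[OF assms]
  have "set (left_column C) \<inter> {- int q..<0} = set C \<inter> {- int q..<0}"
    unfolding L(2) using P(5) by (auto simp: pairs_def)
  then show "nneg (left_column C) q = nneg C q" by (simp add: nneg_card)
  have split: "card S = card {s \<in> S. s \<le> int q} + card {s \<in> S. int q < s}" if "finite S" for S :: "int set"
  proof -
    have "S = {s \<in> S. s \<le> int q} \<union> {s \<in> S. int q < s}" by auto
    then show ?thesis using card_Un_disjoint[of "{s \<in> S. s \<le> int q}" "{s \<in> S. int q < s}"] that by fastforce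
  qed
  have e: "set (left_column C) \<inter> {0<..int q} =
      (set C \<inter> {0<..int q} - {s \<in> pairs C. s \<le> int q}) \<union> {s \<in> matched C. s \<le> int q}"
    unfolding L(2) using P(5) by auto
  have sub: "{s \<in> pairs C. s \<le> int q} \<subseteq> set C \<inter> {0<..int q}" by (auto simp: pairs_def)
  have "card (set (left_column C) \<inter> {0<..int q}) =
     card (set C \<inter> {0<..int q} - {s \<in> pairs C. s \<le> int q}) + card {s \<in> matched C. s \<le> int q}"
    unfolding e using P(1) by (intro card_Un_disjoint) (auto simp: gaps_def)
  also have "card (set C \<inter> {0<..int q} - {s \<in> pairs C. s \<le> int q}) =
      card (set C \<inter> {0<..int q}) - card {s \<in> pairs C. s \<le> int q}"
    using sub by (intro card_Diff_subset) auto
  finally show "npos (left_column C) q = npos C q + pending C q"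
    using split[of "pairs C"] split[of "matched C"] card_matched[OF assms] card_mono[OF _ sub]
    by (simp add: npos_card pending_def)
qed

lemma right_column_props:
  assumes "admissible n C"
  shows "is_column n (right_column C)" "length (right_column C) = length C"
    "npos (right_column C) q = npos C q" "nneg (right_column C) q = nneg C q + pending C q"
proof -
  note L = left_column_props[OF admissible_star[OF assms]]
    and K = left_column_counts[OF admissible_star[OF assms], of q]
  have pend: "pending (star C) q = pending C q" by (simp add: pending_def split_star)
  show "is_column n (right_column C)" "length (right_column C) = length C"
    using right_column_star[OF assms] L(1,3) column_star by simp_all
  show "npos (right_column C) q = npos C q" "nneg (right_column C) q = nneg C q + pending C q"
    using right_column_star[OF assms] K pend by (simp_all add: npos_star nneg_star)
qed

section \<open>Comparison of columns\<close>

definition col_le :: "int list \<Rightarrow> int list \<Rightarrow> bool" where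
  "col_le C D \<longleftrightarrow> length D \<le> length C \<and> (\<forall>r<length D. C ! r \<preceq> D ! r)"

lemma card_below_nth:
  fixes a :: "int list"
  assumes "sorted_wrt (<) a"
  shows "card {y \<in> set a. y \<le> x} = card {r. r < length a \<and> a ! r \<le> x}"
proof -
  have "distinct a" using assms by (simp add: strict_sorted_iff)
  then have "inj_on ((!) a) {r. r < length a \<and> a ! r \<le> x}" by (auto simp: inj_on_def nth_eq_iff_index_eq)
  moreover have "(!) a ` {r. r < length a \<and> a ! r \<le> x} = {y \<in> set a. y \<le> x}"
    unfolding set_conv_nth by blast
  ultimately show ?thesis using card_image by fastforce
qed

text \<open>If row \<open>r\<close> fails, the threshold \<open>b ! r\<close> sees at least
  \<open>r + 1\<close> entries of \<open>b\<close> but at most \<open>r\<close> of \<open>a\<close>.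
  Large thresholds take care of the lengths.\<close>

lemma dominance_counts:
  fixes a b :: "int list"
  assumes "sorted_wrt (<) a" "sorted_wrt (<) b"
  shows "length b \<le> length a \<and> (\<forall>r<length b. a ! r \<le> b ! r) \<longleftrightarrow>
     (\<forall>x. card {y \<in> set b. y \<le> x} \<le> card {y \<in> set a. y \<le> x})"
proof
  assume L: "length b \<le> length a \<and> (\<forall>r<length b. a ! r \<le> b ! r)"
  show "\<forall>x. card {y \<in> set b. y \<le> x} \<le> card {y \<in> set a. y \<le> x}"
    unfolding card_below_nth[OF assms(1)] card_below_nth[OF assms(2)]
    using L by (auto intro!: card_mono)
next
  assume R: "\<forall>x. card {y \<in> set b. y \<le> x} \<le> card {y \<in> set a. y \<le> x}"
  note R' = R[unfolded card_below_nth[OF assms(1)] card_below_nth[OF assms(2)], rule_format]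
  have "a ! r \<le> b ! r \<and> r < length a" if r: "r < length b" for r
  proof (rule ccontr)
    assume neg: "\<not> (a ! r \<le> b ! r \<and> r < length a)"
    have "{s. s < length a \<and> a ! s \<le> b ! r} \<subseteq> {..<r}"
    proof
      fix s assume s: "s \<in> {s. s < length a \<and> a ! s \<le> b ! r}"
      show "s \<in> {..<r}"
      proof (rule ccontr)
        assume "s \<notin> {..<r}"
        then have "r \<le> s" "r < length a" using s by auto
        then have "a ! r \<le> a ! s" using assms(1) s by (cases "r = s") (auto simp: sorted_wrt_iff_nth_less less_imp_le)
        then show False using neg s \<open>r < length a\<close> by auto
      qed
    qed
    then have "card {s. s < length a \<and> a ! s \<le> b ! r} \<le> r" using card_mono[of "{..<r}"] by fastforce
    moreover have "{..r} \<subseteq> {s. s < length b \<and> b ! s \<le> b ! r}"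
      using assms(2) r by (auto simp: sorted_wrt_iff_nth_less) (metis le_neq_implies_less less_imp_le order_refl)
    then have "card {..r} \<le> card {s. s < length b \<and> b ! s \<le> b ! r}" by (intro card_mono) auto
    ultimately show False using R'[of "b ! r"] by simp
  qed
  then show "length b \<le> length a \<and> (\<forall>r<length b. a ! r \<le> b ! r)"
    by (metis linorder_not_le order_less_irrefl)
qed

lemma col_le_pos:
  assumes "is_column n C" "is_column n D"
  shows "col_le C D \<longleftrightarrow> length (map (pos n) D) \<le> length (map (pos n) C) \<and>
    (\<forall>r<length (map (pos n) D). map (pos n) C ! r \<le> map (pos n) D ! r)"
proof -
  have "C ! r \<preceq> D ! r \<longleftrightarrow> pos n (C ! r) \<le> pos n (D ! r)" if "r < length C" "r < length D" for r
    using assms that by (intro pos_le_iff[symmetric]) (auto simp: is_column_def)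
  then show ?thesis by (auto simp: col_le_def)
qed

lemma pos_counts:
  assumes "is_column n C" "q \<le> n"
  shows "int (card {y \<in> set (map (pos n) C). y \<le> int q}) = npos C q"
    "int (card {y \<in> set (map (pos n) C). y \<le> 2 * int n - int q}) = int (length C) - nneg C q"
proof -
  have l: "set C \<subseteq> letters n" using assms by (simp add: is_column_def)
  have "{y \<in> set (map (pos n) C). y \<le> int q} = set C \<inter> {0<..int q}"
    using l assms(2) by (auto simp: pos_def letters_def image_iff subset_iff split: if_splits)
  then show "int (card {y \<in> set (map (pos n) C). y \<le> int q}) = npos C q" by (simp add: npos_card)
  have inj: "inj_on (pos n) (set C)" using l by (auto simp: inj_on_def pos_eq_iff subset_iff)
  have "{y \<in> set (map (pos n) C). y \<le> 2 * int n - int q} = pos n ` (set C - (set C \<inter> {- int q..<0}))"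
    using l assms(2) by (fastforce simp: pos_def letters_def split: if_splits)
  then have "card {y \<in> set (map (pos n) C). y \<le> 2 * int n - int q} = card (set C - (set C \<inter> {- int q..<0}))"
    using card_image[OF inj_on_subset[OF inj]] by (metis Diff_subset)
  also have "\<dots> = card (set C) - card (set C \<inter> {- int q..<0})" by (intro card_Diff_subset) auto
  finally show "int (card {y \<in> set (map (pos n) C). y \<le> 2 * int n - int q}) = int (length C) - nneg C q"
    using distinct_card[OF column_distinct[OF assms(1)]] card_mono[of "set C" "set C \<inter> {- int q..<0}"]
    by (simp add: nneg_card of_nat_diff)
qed

text \<open>Thresholds up to \<open>n\<close> count unbarred letters. Those from \<open>n\<close> to
  \<open>2 * n\<close>, written \<open>2 * n - q\<close>, count all letters except the bars of
  \<open>1\<close> to \<open>q\<close>, which gives the second family.\<close>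

lemma col_le_counts:
  assumes C: "is_column n C" and D: "is_column n D"
  shows "col_le C D \<longleftrightarrow>
    (\<forall>q\<le>n. npos D q \<le> npos C q \<and> int (length D) - nneg D q \<le> int (length C) - nneg C q)"
proof -
  let ?c = "\<lambda>E x. card {y \<in> set (map (pos n) E). y \<le> x}"
  have "col_le C D \<longleftrightarrow> (\<forall>x. ?c D x \<le> ?c C x)"
    unfolding col_le_pos[OF C D] using C D by (intro dominance_counts) (auto simp: is_column_pos)
  also have "\<dots> \<longleftrightarrow> (\<forall>q\<le>n. ?c D (int q) \<le> ?c C (int q) \<and> ?c D (2 * int n - int q) \<le> ?c C (2 * int n - int q))"
  proof (intro iffI allI)
    fix x
    assume A: "\<forall>q\<le>n. ?c D (int q) \<le> ?c C (int q) \<and> ?c D (2 * int n - int q) \<le> ?c C (2 * int n - int q)"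
    have range: "0 < y \<and> y \<le> 2 * int n" if "is_column n E" "y \<in> set (map (pos n) E)" for y E
      using that by (auto simp: is_column_def letters_def pos_def subset_iff)
    consider "x < 0" | "0 \<le> x" "x \<le> int n" | "int n < x" "x \<le> 2 * int n" | "2 * int n < x" by linarith
    then show "?c D x \<le> ?c C x"
    proof cases
      case 1
      then have "{y \<in> set (map (pos n) D). y \<le> x} = {}" using range[OF D] by force
      then show ?thesis by (metis card.empty le0)
    next
      case 2
      then show ?thesis using A[rule_format, of "nat x"] by simp
    next
      case 3
      then show ?thesis using A[rule_format, of "nat (2 * int n - x)"] by simp
    next
      case 4
      have e: "{y \<in> set (map (pos n) E). y \<le> x} = {y \<in> set (map (pos n) E). y \<le> 2 * int n - int 0}"
        if "is_column n E" for E using range[OF that] 4 by force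
      have "?c D (2 * int n - int 0) \<le> ?c C (2 * int n - int 0)" using A by blast
      then show ?thesis unfolding e[OF C] e[OF D] .
    qed
  qed blast
  also have "\<dots> \<longleftrightarrow> (\<forall>q\<le>n. npos D q \<le> npos C q \<and> int (length D) - nneg D q \<le> int (length C) - nneg C q)"
  proof -
    have "(?c D (int q) \<le> ?c C (int q) \<and> ?c D (2 * int n - int q) \<le> ?c C (2 * int n - int q)) \<longleftrightarrow>
      (npos D q \<le> npos C q \<and> int (length D) - nneg D q \<le> int (length C) - nneg C q)" if "q \<le> n" for q
      unfolding pos_counts[OF C that, symmetric] pos_counts[OF D that, symmetric] of_nat_le_iff ..
    then show ?thesis by blast
  qed
  finally show ?thesis .
qed

lemma letter_le_trans: "x \<preceq> y \<Longrightarrow> y \<preceq> z \<Longrightarrow> z \<noteq> 0 \<Longrightarrow> x \<preceq> z"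
  by (auto simp: letter_le_def letter_less_def)

lemma col_le_trans:
  assumes "col_le C D" "col_le D E" "is_column n E"
  shows "col_le C E"
proof -
  have "E ! r \<noteq> 0" if "r < length E" for r
    using assms(3) nth_mem[OF that] by (auto simp: is_column_def letters_def)
  then show ?thesis
    using assms(1,2) unfolding col_le_def by (metis letter_le_trans order_less_le_trans order_trans)
qed

text \<open>The condition \<open>rC \<le> lD\<close> after elimination of the split letters, for \<open>a = 0\<close> and
  \<open>b = length C - length D\<close>; the general form is the one that is invariant under \<open>star\<close>, which
  exchanges \<open>a\<close> and \<open>b\<close>.\<close>

definition kn_pair :: "nat \<Rightarrow> int \<Rightarrow> int \<Rightarrow> int list \<Rightarrow> int list \<Rightarrow> bool" where
  "kn_pair n a b C D \<longleftrightarrow> (\<forall>q z. q \<le> z \<and> z \<le> n \<longrightarrow>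
     excess D z - a \<le> npos C q + nneg D q - int q \<and> excess C z - b \<le> npos C q + nneg D q - int q)"

abbreviation kn_adj :: "nat \<Rightarrow> int list \<Rightarrow> int list \<Rightarrow> bool" where
  "kn_adj n C D \<equiv> kn_pair n 0 (int (length C) - int (length D)) C D"

text \<open>By \<open>pending_max\<close> an upper bound for \<open>pending\<close> is the same as a
  bound for every \<open>z\<close>, so the greedily chosen letters disappear.\<close>

lemma right_left_le_iff:
  assumes "admissible n C" "admissible n D"
  shows "col_le (right_column C) (left_column D) \<longleftrightarrow> kn_adj n C D"
proof -
  note R = right_column_props[OF assms(1)] and L = left_column_props[OF assms(2)] left_column_counts[OF assms(2)]
  have pend: "pending E q \<le> x \<longleftrightarrow> (\<forall>z. q \<le> z \<and> z \<le> n \<longrightarrow> excess E z - excess E q \<le> x)"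
    if "admissible n E" "q \<le> n" for E q x
    using pending_max[OF that] by (metis order_trans)
  have P: "npos D q + pending D q \<le> npos C q \<longleftrightarrow>
      (\<forall>z. q \<le> z \<and> z \<le> n \<longrightarrow> excess D z \<le> npos C q + nneg D q - int q)" if "q \<le> n" for q
    using pend[OF assms(2) that, of "npos C q - npos D q"] by (auto simp: excess_def algebra_simps)
  have N: "int (length D) - nneg D q \<le> int (length C) - (nneg C q + pending C q) \<longleftrightarrow>
      (\<forall>z. q \<le> z \<and> z \<le> n \<longrightarrow> excess C z - (int (length C) - int (length D)) \<le> npos C q + nneg D q - int q)" if "q \<le> n" for q
    using pend[OF assms(1) that, of "int (length C) - nneg C q - int (length D) + nneg D q"]
    by (auto simp: excess_def algebra_simps)
  show ?thesis
    unfolding col_le_counts[OF R(1) L(1)] R(2-4) L(3-5) kn_pair_def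
    using P N by (auto simp del: of_nat_diff)
qed

lemma left_column_le: "admissible n C \<Longrightarrow> col_le (left_column C) C"
  and right_column_ge: "admissible n C \<Longrightarrow> col_le C (right_column C)"
proof -
  assume adm: "admissible n C"
  then have C: "is_column n C" by (simp add: admissible_def)
  have p: "0 \<le> pending C q" if "q \<le> n" for q using pending_max[OF adm that] that by fastforce
  show "col_le (left_column C) C"
    unfolding col_le_counts[OF left_column_props(1)[OF adm] C]
    using p left_column_props(3)[OF adm] left_column_counts[OF adm] by simp
  show "col_le C (right_column C)"
    unfolding col_le_counts[OF C right_column_props(1)[OF adm]]
    using p right_column_props[OF adm] by simp
qed

lemma semistandard_iff:
  "semistandard n T \<longleftrightarrow> (\<forall>C\<in>set T. C \<noteq> [] \<and> is_column n C) \<and> successively col_le T"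
proof -
  have "successively col_le T \<longleftrightarrow> sorted_wrt col_le T" if "\<forall>C\<in>set T. is_column n C"
    by (rule successively_iff_sorted_wrt_strong) (use that col_le_trans in blast)
  then show ?thesis unfolding semistandard_def col_le_def[abs_def] by blast
qed

lemma split_form_Cons: "split_form (C # T) = left_column C # right_column C # split_form T"
  by (simp add: split_form_def)

text \<open>For an admissible column lC \<le> C \<le> rC always holds. Thus only rC \<le> lD for
  neighbours is a condition, and it already implies C \<le> D; both semistandardness conditions
  become local.\<close>

lemma KN_tableau_iff:
  "KN_tableau n T \<longleftrightarrow> (\<forall>C\<in>set T. C \<noteq> [] \<and> admissible n C) \<and>
     successively (kn_adj n) T"
proof (cases "\<forall>C\<in>set T. C \<noteq> [] \<and> admissible n C")
  case True
  have lr: "col_le (left_column C) (right_column C)" if "admissible n C" for C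
    using col_le_trans[OF left_column_le[OF that] right_column_ge[OF that]] right_column_props(1)[OF that] by blast
  have S: "successively col_le (split_form T) \<longleftrightarrow>
      successively (kn_adj n) T"
    using True
  proof (induction T rule: induct_list012)
    case 1 then show ?case by (simp add: split_form_def)
  next
    case (2 C) then show ?case using lr by (simp add: split_form_def)
  next
    case (3 C D T)
    then show ?case using lr[of C] right_left_le_iff[of n C D] by (simp add: split_form_Cons)
  qed
  have "semistandard n (split_form T)" if "successively col_le (split_form T)"
  proof -
    have "E \<noteq> [] \<and> is_column n E" if E: "E \<in> set (split_form T)" for E
    proof -
      obtain C where C: "C \<in> set T" "E = left_column C \<or> E = right_column C"
        using E by (auto simp: split_form_def)
      then show ?thesis using True left_column_props[of n C] right_column_props[of n C]
        by (metis length_0_conv)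
    qed
    then show ?thesis using that by (simp add: semistandard_iff)
  qed
  moreover have "semistandard n T" if "successively (kn_adj n) T"
  proof -
    have "col_le C D" if "admissible n C" "admissible n D" "kn_adj n C D" for C D
    proof -
      have "col_le C (left_column D)"
        using right_left_le_iff[OF that(1,2)] that(3) col_le_trans[OF right_column_ge[OF that(1)]]
          left_column_props(1)[OF that(2)] by blast
      then show ?thesis
        using col_le_trans[OF _ left_column_le[OF that(2)]] that(2) by (auto simp: admissible_def)
    qed
    then have "successively col_le T"
      using that True by (induction T rule: induct_list012) auto
    then show ?thesis using True by (auto simp: semistandard_iff admissible_def)
  qed
  ultimately show ?thesis using True S unfolding KN_tableau_def semistandard_iff[of n "split_form T"] by blast
next
  case False
  then show ?thesis by (auto simp: KN_tableau_def semistandard_def)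
qed

section \<open>Stability of tableaux under the crystal operators\<close>

lemma npos_pred: "1 \<le> i \<Longrightarrow> npos C i = npos C (i - 1) + of_bool (int i \<in> set C)"
  and nneg_pred: "1 \<le> i \<Longrightarrow> nneg C i = nneg C (i - 1) + of_bool (- int i \<in> set C)"
  by (cases i; simp add: add.commute minus_diff_commute)+

lemma up_bar_excess:
  assumes "up_bar i C C'" "1 \<le> i"
  shows "excess C' i = excess C (i - 1) \<or> excess C' i = excess C (i + 1)"
  using assms excess_pred[OF assms(2), of C] excess_next[of C i] up_bar_counts[OF assms, of i]
  by (auto simp: up_bar_def excess_def[of C'] excess_def[of C i])

lemma admissible_f_op:
  assumes "admissible n C" "f_op n i C = Some C'" "1 \<le> i" "i \<le> n"
  shows "admissible n C'"
proof -
  have C: "is_column n C" "\<And>q. q \<le> n \<Longrightarrow> excess C q \<le> 0"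
    using assms(1) admissible_iff[of n C] by (auto simp: admissible_def)
  note f = f_op_column[OF C(1) assms(2-4)]
  have "excess C' q \<le> 0" if q: "q \<le> n" for q
    using f
  proof (elim conjE disjE)
    assume u: "up_i i C C'"
    then show ?thesis using up_i_counts[OF u assms(3), of q] C(2)[OF q] by (auto simp: excess_def of_bool_def split: if_splits)
  next
    assume u: "up_bar i C C'" "i < n"
    then have "excess C (i - 1) \<le> 0" "excess C (i + 1) \<le> 0" by (auto intro!: C(2))
    then show ?thesis using up_bar_counts[OF u(1) assms(3), of q] C(2)[OF q] up_bar_excess[OF u(1) assms(3)]
      by (cases "q = i") (auto simp: excess_def)
  next
    assume u: "up_n n C C'" "i = n"
    then show ?thesis using up_n_counts[OF u(1) _ q] C(2)[OF q] assms(3) by (auto simp: excess_def)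
  qed
  then show ?thesis using admissible_iff[of n C'] f by blast
qed

lemma kn_pair_star: "kn_pair n a b C D \<longleftrightarrow> kn_pair n b a (star D) (star C)"
  by (auto simp: kn_pair_def excess_star npos_star nneg_star add.commute)

text \<open>Under \<open>up_bar\<close> the only left-hand side that can outgrow its right-hand side
  is \<open>excess D i\<close> for \<open>q < i\<close>. Its new value is the old one at
  \<open>i - 1\<close> or \<open>i + 1\<close>, where the hypothesis provides the bound.\<close>

lemma kn_pair_f_right:
  assumes K: "kn_pair n a b C D" and D: "is_column n D" and f: "f_op n i D = Some D'" and i: "1 \<le> i" "i \<le> n"
  shows "kn_pair n a b C D'"
  unfolding kn_pair_def
proof (intro allI impI)
  fix q z assume qz: "q \<le> z \<and> z \<le> n"
  note k = K[unfolded kn_pair_def, rule_format]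
  note kqz = k[OF qz]
  show "excess D' z - a \<le> npos C q + nneg D' q - int q \<and> excess C z - b \<le> npos C q + nneg D' q - int q"
    using f_op_column[OF D f i]
  proof (elim conjE disjE)
    assume u: "up_i i D D'"
    then show ?thesis using up_i_counts[OF u i(1)] kqz by (auto simp: excess_def of_bool_def split: if_splits)
  next
    assume u: "up_bar i D D'" "i < n"
    note cnt = up_bar_counts[OF u(1) i(1)]
    have "excess D' z - a \<le> npos C q + nneg D' q - int q"
    proof (cases "z = i \<and> q < i")
      case True
      then have le: "q \<le> i - 1 \<and> i - 1 \<le> n" "q \<le> i + 1 \<and> i + 1 \<le> n" using qz u(2) by linarith+
      show ?thesis using up_bar_excess[OF u(1) i(1)] k[OF le(1)] k[OF le(2)] True cnt by auto
    next
      case False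
      then show ?thesis using cnt kqz qz by (auto simp: excess_def)
    qed
    then show ?thesis using cnt kqz by (auto simp: of_bool_def)
  next
    assume u: "up_n n D D'" "i = n"
    then show ?thesis using up_n_counts[OF u(1), of q] up_n_counts[OF u(1), of z] i qz kqz by (auto simp: excess_def of_bool_def)
  qed
qed

text \<open>Here one unit must be gained: under \<open>up_i\<close> and \<open>up_n\<close> the
  right-hand side at \<open>q = i\<close> drops by one, under \<open>up_bar\<close> the value
  \<open>excess C i\<close> grows by one. The unit comes from the inequalities at
  \<open>i - 1\<close> or, for \<open>i < n\<close>, at \<open>i + 1\<close>. In the critical cases
  \<open>eps n i C = 0\<close>, so \<open>le\<close> gives \<open>phi n i D = 0\<close>, and the
  letters this forbids in \<open>D\<close> decide which neighbour to use.\<close>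

lemma kn_pair_f_left:
  assumes K: "kn_pair n a b C D" and C: "is_column n C" and D: "is_column n D"
    and ab: "b - a = int (length C) - int (length D)"
    and f: "f_op n i C = Some C'" and i: "1 \<le> i" "i \<le> n" and le: "phi n i D \<le> eps n i C"
  shows "kn_pair n a b C' D"
  unfolding kn_pair_def
proof (intro allI impI)
  fix q z assume qz: "q \<le> z \<and> z \<le> n"
  note k = K[unfolded kn_pair_def, rule_format]
  note kqz = k[OF qz]
  note pred = npos_pred[OF i(1), of C] npos_pred[OF i(1), of D] nneg_pred[OF i(1), of C] nneg_pred[OF i(1), of D]
  have nxt: "npos E (i + 1) = npos E i + of_bool (int i + 1 \<in> set E)"
    "nneg E (i + 1) = nneg E i + of_bool (- int i - 1 \<in> set E)" for E by simp_all
  have i1: "int (i - 1) = int i - 1" using i by simp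
  show "excess D z - a \<le> npos C' q + nneg D q - int q \<and> excess C' z - b \<le> npos C' q + nneg D q - int q"
    using f_op_column[OF C f i]
  proof (elim conjE disjE)
    assume u: "up_i i C C'" "i < n"
    note cnt = up_i_counts[OF u(1) i(1)]
    have st: "int i \<in> set C" "int i + 1 \<notin> set C" using u by (auto simp: up_i_def)
    have phi0: "phi n i D = 0"
      using le eps_column[OF C i(1) u(2)] u(1) by (auto simp: up_i_def)
    show ?thesis
    proof (cases "q = i")
      case True
      show ?thesis
      proof (cases "- int i \<in> set D")
        case bar: True
        have "excess D z - a \<le> npos C i + nneg D i - int i - 1 \<and> excess C z - b \<le> npos C i + nneg D i - int i - 1"
          using k[of "i - 1" z] qz True pred st bar i1 by simp
        then show ?thesis using cnt True by (auto simp: excess_def of_bool_def)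
      next
        case bar: False
        then have D0: "- int i - 1 \<notin> set D" "int i \<notin> set D \<or> int i + 1 \<in> set D"
          using phi0 phi_column[OF D i(1) u(2)] by auto
        show ?thesis
        proof (cases "z = i")
          case zi: True
          have "npos D i - a \<le> npos C i - 1"
            using D0(2)
          proof
            assume "int i \<notin> set D"
            then show ?thesis using k[of "i - 1" "i - 1"] i(2) pred st by (simp add: excess_def)
          next
            assume "int i + 1 \<in> set D"
            then show ?thesis using k[of "i + 1" "i + 1"] u(2) nxt[of C] nxt[of D] st by (simp add: excess_def)
          qed
          then show ?thesis using cnt True zi kqz by (auto simp: excess_def)
        next
          case False
          then have "excess D z - a \<le> npos C i + nneg D i - int i - 1 \<and> excess C z - b \<le> npos C i + nneg D i - int i - 1"
            using k[of "i + 1" z] qz True nxt[of C] nxt[of D] st D0 by simp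
          then show ?thesis using cnt True by (auto simp: excess_def of_bool_def)
        qed
      qed
    next
      case False
      then show ?thesis using cnt kqz by (auto simp: excess_def of_bool_def)
    qed
  next
    assume u: "up_bar i C C'" "i < n"
    note cnt = up_bar_counts[OF u(1) i(1)]
    have st: "- int i - 1 \<in> set C" "- int i \<notin> set C" "int i \<in> set C \<longrightarrow> int i + 1 \<in> set C"
      using u by (auto simp: up_bar_def)
    have "excess C i + 1 - b \<le> npos C q + nneg D q - int q" if zi: "z = i"
    proof (cases "int i + 1 \<in> set C")
      case True
      then show ?thesis using k[of q "i + 1"] qz zi u(2) excess_next[of C i] st by simp
    next
      case False
      then have hp: "excess C i = excess C (i - 1) - 1" using st excess_pred[OF i(1), of C] by simp
      show ?thesis
      proof (cases "q = i")
        case True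
        have "phi n i D = 0" using le eps_column[OF C i(1) u(2)] st False by auto
        then have "- int i - 1 \<notin> set D \<or> - int i \<in> set D" using phi_column[OF D i(1) u(2)] by auto
        then have "nneg C i + 1 - b \<le> nneg D i"
        proof
          assume "- int i - 1 \<notin> set D"
          then show ?thesis using k[of "i + 1" "i + 1"] u(2) nxt[of C] nxt[of D] st by (simp add: excess_def)
        next
          assume "- int i \<in> set D"
          then show ?thesis using k[of "i - 1" "i - 1"] i(2) pred st by (simp add: excess_def)
        qed
        then show ?thesis using True by (simp add: excess_def)
      next
        case False
        then have "q \<le> i - 1 \<and> i - 1 \<le> n" using qz zi by linarith
        from k[OF this] show ?thesis using hp by simp
      qed
    qed
    then show ?thesis using cnt kqz by (cases "z = i") (auto simp: excess_def)
  next
    assume u: "up_n n C C'" "i = n"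
    note cnt = up_n_counts[OF u(1)]
    have st: "int n \<in> set C" "- int n \<notin> set C" using u by (auto simp: up_n_def)
    have phi0: "phi n n D = 0" using le eps_column_n[OF C] u(2) i st by auto
    then have D0: "- int n \<in> set D \<or> int n \<notin> set D" using phi_column_n[OF D] i u(2) by auto
    have hcC': "excess C' z = excess C z" using cnt[of z] i u(2) qz by (simp add: excess_def)
    show ?thesis
    proof (cases "q = n")
      case True
      then have zn: "z = n" using qz by simp
      have "excess D n - a \<le> npos C n + nneg D n - int n - 1 \<and> excess C n - b \<le> npos C n + nneg D n - int n - 1"
      proof (cases "- int n \<in> set D")
        case bar: True
        then show ?thesis using k[of "n - 1" n] pred st i1 u(2) by simp
      next
        case False
        then have "int n \<notin> set D" using D0 by blast
        then have "npos D n - a \<le> npos C n - 1"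
          using k[of "n - 1" "n - 1"] pred st u(2) by (simp add: excess_def)
        \<comment> \<open>At \<open>q = z = n\<close> the two inequalities are equivalent, because
          \<open>b - a\<close> is the difference of the lengths.\<close>
        then show ?thesis using length_column[OF C] length_column[OF D] ab by (simp add: excess_def)
      qed
      then show ?thesis using cnt[of n] i u(2) True zn hcC' by simp
    next
      case False
      then show ?thesis using cnt[of q] i u(2) qz kqz hcC' by simp
    qed
  qed
qed

lemma kn_pair_e_left:
  assumes "kn_pair n a b C D" "is_column n C" "e_op n i C = Some C'" "1 \<le> i" "i \<le> n"
  shows "kn_pair n a b C' D"
  using kn_pair_f_right[of n b a "star D" "star C" i "star C'"] assms column_star
  by (simp add: f_op_star kn_pair_star[of n a b])

lemma kn_pair_e_right:
  assumes "kn_pair n a b C D" "is_column n C" "is_column n D"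
    "b - a = int (length C) - int (length D)"
    "e_op n i D = Some D'" "1 \<le> i" "i \<le> n" "eps n i C \<le> phi n i D"
  shows "kn_pair n a b C D'"
  using kn_pair_f_left[of n b a "star D" "star C" i "star D'"] assms column_star
  by (simp add: f_op_star kn_pair_star[of n a b] phi_star eps_star)

lemma f_op_concat:
  assumes "f_op n i (concat cs) = Some w'"
  obtains a c c' b where "cs = a @ c # b" "f_op n i c = Some c'" "w' = concat (a @ c' # b)"
    "phi n i (concat a) \<le> eps n i c" "eps n i (concat b) < phi n i c"
  using assms
proof (induction cs arbitrary: w' thesis)
  case (Cons c cs)
  show ?case
  proof (cases "phi n i c > eps n i (concat cs)")
    case True
    then obtain c' where "f_op n i c = Some c'" "w' = c' @ concat cs"
      using Cons.prems(2) by (auto simp: f_op_append)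
    then show ?thesis using Cons.prems(1)[of "[]" c cs c'] True by simp
  next
    case False
    then obtain v where v: "f_op n i (concat cs) = Some v" "w' = c @ v"
      using Cons.prems(2) by (auto simp: f_op_append)
    obtain a x x' b where ab: "cs = a @ x # b" "f_op n i x = Some x'" "v = concat (a @ x' # b)"
      "phi n i (concat a) \<le> eps n i x" "eps n i (concat b) < phi n i x"
      using Cons.IH[OF _ v(1)] by blast
    have "phi n i (concat (c # a)) \<le> eps n i x"
      using False ab(4,5) by (auto simp: ab(1) phi_append eps_append)
    then show ?thesis using Cons.prems(1)[of "c # a" x b x'] ab v by simp
  qed
qed simp

lemma star_concat: "star (concat cs) = concat (rev (map star cs))"
  by (induction cs) (auto simp: star_append)

lemma e_op_concat:
  assumes "e_op n i (concat cs) = Some w'" "1 \<le> i" "i \<le> n"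
  obtains a c c' b where "cs = a @ c # b" "e_op n i c = Some c'" "w' = concat (a @ c' # b)"
    "eps n i (concat b) \<le> phi n i c"
proof -
  have "f_op n i (concat (rev (map star cs))) = Some (star w')"
    using assms by (simp add: star_concat[symmetric] f_op_star)
  then obtain a c c' b where ab: "rev (map star cs) = a @ c # b" "f_op n i c = Some c'"
    "star w' = concat (a @ c' # b)" "phi n i (concat a) \<le> eps n i c" by (rule f_op_concat)
  have ss: "map star (map star xs) = xs" for xs by (induction xs) auto
  have "rev (rev (map star cs)) = rev (a @ c # b)" using ab(1) by simp
  then have "map star cs = rev b @ c # rev a" by simp
  then have "map star (map star cs) = map star (rev b) @ star c # map star (rev a)" by simp
  then have cs: "cs = map star (rev b) @ star c # map star (rev a)" by (simp only: ss)
  have "star (star w') = concat (rev (map star (a @ c' # b)))" using ab(3) by (simp only: star_concat)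
  then have w': "w' = concat (map star (rev b) @ star c' # map star (rev a))" by (simp add: rev_map)
  have "concat (map star (rev a)) = star (concat a)" by (simp add: star_concat rev_map)
  then have "eps n i (concat (map star (rev a))) \<le> phi n i (star c)"
    using ab(4) assms(2) by (simp add: eps_star phi_star)
  moreover have "e_op n i (star c) = Some (star c')" using ab(2) assms(2,3) by (simp add: e_op_star)
  ultimately show ?thesis using that cs w' by blast
qed

lemma KN_replace:
  assumes "KN_tableau n (A @ C # B)" "length C' = length C" "admissible n C'"
    "A \<noteq> [] \<Longrightarrow> kn_adj n (last A) C \<Longrightarrow>
       admissible n (last A) \<Longrightarrow>
       kn_adj n (last A) C'"
    "B \<noteq> [] \<Longrightarrow> kn_adj n C (hd B) \<Longrightarrow>
       admissible n (hd B) \<Longrightarrow>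
       kn_adj n C' (hd B)"
  shows "KN_tableau n (A @ C' # B)"
  using assms unfolding KN_tableau_iff
  by (auto simp: successively_append_iff successively_Cons)

text \<open>A single column \<open>c\<close> changes. As columns are read from right to left, its
  right neighbour is the last factor of \<open>a\<close>, and the tensor product rule bounds
  \<open>phi\<close> of that factor by \<open>eps n i c\<close>, as \<open>kn_pair_f_left\<close>
  requires.\<close>

lemma KN_f_op:
  assumes "KN_tableau n T" "f_op n i (column_reading T) = Some w'" "1 \<le> i" "i \<le> n"
  obtains T' where "KN_tableau n T'" "column_reading T' = w'" "map length T' = map length T"
proof -
  obtain a c c' b where ab: "rev T = a @ c # b" "f_op n i c = Some c'" "w' = concat (a @ c' # b)"
    "phi n i (concat a) \<le> eps n i c"
    using assms(2) unfolding column_reading_def by (rule f_op_concat)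
  have "rev (rev T) = rev (a @ c # b)" using ab(1) by simp
  then have T: "T = rev b @ c # rev a" by simp
  have adm: "admissible n c" using assms(1) T by (simp add: KN_tableau_iff)
  then have c: "is_column n c" by (simp add: admissible_def)
  have KN': "KN_tableau n (rev b @ c' # rev a)"
  proof (rule KN_replace[OF assms(1)[unfolded T] length_f_op[OF ab(2)] admissible_f_op[OF adm ab(2) assms(3,4)]])
    assume "kn_adj n (last (rev b)) c"
    then show "kn_adj n (last (rev b)) c'"
      using kn_pair_f_right[OF _ c ab(2) assms(3,4)] length_f_op[OF ab(2)] by simp
  next
    assume a: "rev a \<noteq> []" "kn_adj n c (hd (rev a))"
      "admissible n (hd (rev a))"
    have "concat a = concat (butlast a) @ last a"
      using a(1) by (metis append_butlast_last_id concat.simps concat_append rev_is_Nil_conv append_Nil2)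
    then have "phi n i (last a) \<le> eps n i c" using ab(4) by (simp add: phi_append)
    then show "kn_adj n c' (hd (rev a))"
      using kn_pair_f_left[OF a(2) c _ _ ab(2) assms(3,4)] a length_f_op[OF ab(2)]
      by (simp add: admissible_def hd_rev)
  qed
  show ?thesis
    by (rule that[OF KN']) (use ab T length_f_op[OF ab(2)] in \<open>simp_all add: column_reading_def\<close>)
qed

lemma KN_e_op:
  assumes "KN_tableau n T" "e_op n i (column_reading T) = Some w'" "1 \<le> i" "i \<le> n"
  obtains T' where "KN_tableau n T'" "column_reading T' = w'" "map length T' = map length T"
proof -
  obtain a c c' b where ab: "rev T = a @ c # b" "e_op n i c = Some c'" "w' = concat (a @ c' # b)"
    "eps n i (concat b) \<le> phi n i c"
    using assms(2) unfolding column_reading_def by (rule e_op_concat[OF _ assms(3,4)])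
  have "rev (rev T) = rev (a @ c # b)" using ab(1) by simp
  then have T: "T = rev b @ c # rev a" by simp
  have adm: "admissible n c" using assms(1) T by (simp add: KN_tableau_iff)
  then have c: "is_column n c" by (simp add: admissible_def)
  have adm': "admissible n c'"
    using admissible_star[OF admissible_f_op[OF admissible_star[OF adm], of i "star c'"]] ab(2) assms(3,4)
    by (simp add: f_op_star)
  have KN': "KN_tableau n (rev b @ c' # rev a)"
  proof (rule KN_replace[OF assms(1)[unfolded T] length_e_op[OF ab(2)] adm'])
    assume b: "rev b \<noteq> []" "kn_adj n (last (rev b)) c"
      "admissible n (last (rev b))"
    have "concat b = hd b @ concat (tl b)" using b(1) by (cases b) auto
    then have "eps n i (hd b) \<le> phi n i c" using ab(4) by (simp add: eps_append)
    then show "kn_adj n (last (rev b)) c'"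
      using kn_pair_e_right[OF b(2) _ c _ ab(2) assms(3,4)] b length_e_op[OF ab(2)]
      by (simp add: admissible_def last_rev)
  next
    assume "kn_adj n c (hd (rev a))"
    then show "kn_adj n c' (hd (rev a))"
      using kn_pair_e_left[OF _ c ab(2) assms(3,4)] length_e_op[OF ab(2)] by simp
  qed
  show ?thesis
    by (rule that[OF KN']) (use ab T length_e_op[OF ab(2)] in \<open>simp_all add: column_reading_def\<close>)
qed

section \<open>Yamanouchi columns\<close>

definition ycol :: "nat \<Rightarrow> int list" where
  "ycol h = map int [1..<Suc h]"

definition yword :: "nat list \<Rightarrow> int list" where
  "yword hs = concat (map ycol hs)"

lemma length_ycol [simp]: "length (ycol h) = h" by (simp add: ycol_def)

lemma set_ycol: "set (ycol h) = {1..int h}"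
  by (auto simp: ycol_def image_int_atLeastLessThan simp del: upt_Suc)

lemma ycol_0 [simp]: "ycol 0 = []" by (simp add: ycol_def)
lemma ycol_Suc: "ycol (Suc h) = ycol h @ [int (Suc h)]" by (simp add: ycol_def)

lemma nth_ycol: "r < h \<Longrightarrow> ycol h ! r = int r + 1"
  by (simp add: ycol_def del: upt_Suc)

lemma column_ycol: "h \<le> n \<Longrightarrow> is_column n (ycol h)"
proof -
  assume "h \<le> n"
  moreover have "sorted_wrt (\<prec>) (ycol h)"
    unfolding ycol_def sorted_wrt_map
    by (rule sorted_wrt_mono_rel[OF _ sorted_wrt_upt]) (auto simp: letter_less_def)
  ultimately show ?thesis by (auto simp: is_column_def set_ycol letters_def)
qed

lemma ycol_letters: "h \<le> n \<Longrightarrow> ycol h \<in> words n"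
  using column_ycol[of h n] by (auto simp: is_column_def)

lemma counts_ycol: "npos (ycol h) q = int (min q h)" "nneg (ycol h) q = 0"
  by (induction q) (auto simp: set_ycol)

lemma admissible_ycol: "h \<le> n \<Longrightarrow> admissible n (ycol h)"
  by (simp add: admissible_iff column_ycol excess_def counts_ycol)

lemma eps_ycol: "1 \<le> i \<Longrightarrow> i \<le> n \<Longrightarrow> h \<le> n \<Longrightarrow> eps n i (ycol h) = 0"
  using eps_column[of n "ycol h" i] eps_column_n[of n "ycol h"] column_ycol[of h n]
  by (cases "i = n") (auto simp: set_ycol)

lemma phi_ycol: "1 \<le> i \<Longrightarrow> i \<le> n \<Longrightarrow> h \<le> n \<Longrightarrow> phi n i (ycol h) = of_bool (h = i)"
  using phi_column[of n "ycol h" i] phi_column_n[of n "ycol h"] column_ycol[of h n]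
  by (cases "i = n") (auto simp: set_ycol)

lemma yword_simps [simp]: "yword [] = []" "yword (h # hs) = ycol h @ yword hs"
  "yword (hs @ gs) = yword hs @ yword gs"
  by (simp_all add: yword_def)

lemma yword_letters: "set hs \<subseteq> {1..n} \<Longrightarrow> yword hs \<in> words n"
proof (induction hs)
  case (Cons h hs)
  then have "ycol h \<in> words n" by (intro ycol_letters) auto
  then show ?case using Cons by simp
qed simp

lemma eps_yword: "1 \<le> i \<Longrightarrow> i \<le> n \<Longrightarrow> set hs \<subseteq> {1..n} \<Longrightarrow> eps n i (yword hs) = 0"
  by (induction hs) (auto simp: eps_append eps_ycol)

lemma phi_yword: "1 \<le> i \<Longrightarrow> i \<le> n \<Longrightarrow> set hs \<subseteq> {1..n} \<Longrightarrow> phi n i (yword hs) = count_list hs i"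
  by (induction hs) (auto simp: phi_append eps_yword phi_ycol)

lemma reading_ycols: "column_reading (map ycol hs) = yword (rev hs)"
  by (simp add: column_reading_def yword_def rev_map)

lemma KN_ycols:
  assumes "set hs \<subseteq> {1..n}" "sorted_wrt (\<ge>) hs"
  shows "KN_tableau n (map ycol hs)" "KN_tableau n (map (\<lambda>h. star (ycol h)) hs)"
proof -
  have pair: "kn_pair n 0 (int g - int h) (ycol g) (ycol h)"
    "kn_pair n 0 (int g - int h) (star (ycol g)) (star (ycol h))" if "h \<le> g" for g h
    unfolding kn_pair_def using that
    by (auto simp: excess_def npos_star nneg_star counts_ycol)
  have ne: "h \<noteq> 0" "h \<le> n" if "h \<in> set hs" for h using assms(1) that by auto
  have l: "ycol h \<noteq> []" "star (ycol h) \<noteq> []" if "h \<noteq> 0" for h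
    using that by (metis length_0_conv length_ycol length_star)+
  have "successively (\<ge>) hs" using assms(2) by (rule successively_if_sorted_wrt)
  then have "successively (\<lambda>g h. kn_pair n 0 (int g - int h) (ycol g) (ycol h)) hs"
    "successively (\<lambda>g h. kn_pair n 0 (int g - int h) (star (ycol g)) (star (ycol h))) hs"
    by (auto elim!: successively_mono intro: pair)
  then show "KN_tableau n (map ycol hs)" "KN_tableau n (map (\<lambda>h. star (ycol h)) hs)"
    unfolding KN_tableau_iff using ne l
    by (auto simp: successively_map admissible_ycol admissible_star)
qed

lemma KN_lengths:
  assumes "KN_tableau n T"
  shows "sorted_wrt (\<ge>) (map length T)" "set (map length T) \<subseteq> {1..n}"
proof -
  show "sorted_wrt (\<ge>) (map length T)"
    using assms unfolding KN_tableau_def semistandard_def sorted_wrt_map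
    by (auto elim!: sorted_wrt_mono_rel[rotated])
  have "length C \<noteq> 0 \<and> length C \<le> n" if "C \<in> set T" for C
  proof -
    have C: "admissible n C" "C \<noteq> []" using assms that by (auto simp: KN_tableau_iff)
    then have "excess C n \<le> 0" using admissible_iff[of n C] by (auto simp: admissible_def)
    then show ?thesis using C length_column[of n C] by (simp add: excess_def admissible_def)
  qed
  then show "set (map length T) \<subseteq> {1..n}" by (auto simp: Suc_le_eq)
qed

definition highest :: "nat \<Rightarrow> int list \<Rightarrow> bool" where
  "highest n w \<longleftrightarrow> (\<forall>i\<in>{1..n}. eps n i w = 0)"

lemma highest_prefix: "highest n (u @ v) \<Longrightarrow> highest n u"
  by (simp add: highest_def eps_append)

lemma highest_snoc: "highest n (u @ [x]) \<Longrightarrow> i \<in> {1..n} \<Longrightarrow> minus_of n i x \<le> phi n i u"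
  by (auto simp: highest_def eps_append)

text \<open>The entries are determined in reading order. If some column further right has more than
  \<open>r\<close> rows, comparing rows bounds the next entry \<open>x\<close> by
  \<open>r + 1\<close>. Otherwise the word read so far has \<open>phi\<close> equal to
  \<open>0\<close> at all indices above \<open>r\<close>, which excludes unbarred letters above
  \<open>r + 1\<close>; and a letter \<open>- int j\<close> with \<open>j\<close> \<le>
  \<open>r\<close> would join \<open>1\<close>, ..., \<open>j\<close> and make the excess at
  \<open>j\<close> positive.\<close>

lemma KN_highest:
  assumes "KN_tableau n T" "highest n (column_reading T)"
  shows "T = map ycol (map length T)"
  using assms
proof (induction T)
  case (Cons C T)
  have read: "column_reading (C # T) = column_reading T @ C" by (simp add: column_reading_def)
  have KN: "KN_tableau n T" using Cons.prems(1) by (auto simp: KN_tableau_iff successively_Cons)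
  have T: "T = map ycol (map length T)"
    using Cons.IH[OF KN] highest_prefix Cons.prems(2) unfolding read by blast
  define hs where "hs = map length T"
  have hs: "set hs \<subseteq> {1..n}" "T = map ycol hs" using KN_lengths[OF KN] T by (auto simp: hs_def)
  have adm: "admissible n C" and C: "is_column n C"
    using Cons.prems(1) by (auto simp: KN_tableau_iff admissible_def)
  have le: "length D \<le> length C \<and> (\<forall>r<length D. C ! r \<preceq> D ! r)" if "D \<in> set T" for D
    using Cons.prems(1) that by (auto simp: KN_tableau_def semistandard_def)
  have "r \<le> length C \<Longrightarrow> take r C = ycol r" for r
  proof (induction r)
    case (Suc r)
    then have IH: "take r C = ycol r" and r: "r < length C" by auto
    define x where "x = C ! r"
    have Csplit: "C = ycol r @ x # drop (Suc r) C"
      using id_take_nth_drop[OF r] IH by (simp add: x_def)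
    have xl: "x \<in> letters n" using C r by (auto simp: is_column_def x_def)
    have rn: "r < n"
    proof -
      have "length C \<le> n" using KN_lengths(2)[OF Cons.prems(1)] by simp
      then show ?thesis using r by simp
    qed
    have posx: "int r < pos n x"
    proof (cases r)
      case 0
      then show ?thesis using xl by (auto simp: pos_def letters_def)
    next
      case (Suc s)
      have "is_column n (ycol r @ x # drop (Suc r) C)" using C Csplit by simp
      then have "pos n (int r) < pos n x"
        unfolding column_append using Suc by (auto simp: set_ycol)
      then show ?thesis using Suc by (simp add: pos_def)
    qed
    have hi: "highest n ((column_reading T @ ycol r) @ [x])"
      using Cons.prems(2) highest_prefix[of n "(column_reading T @ ycol r) @ [x]" "drop (Suc r) C"] Csplit
      unfolding read by simp
    have phi: "phi n i (column_reading T @ ycol r) = of_bool (r = i) + count_list (rev hs) i" if "i \<in> {1..n}" for i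
      using that hs rn by (simp add: reading_ycols phi_append phi_yword phi_ycol eps_ycol)
    have "x = int r + 1"
    proof (cases "\<exists>h\<in>set hs. r < h")
      case True
      then obtain h where h: "h \<in> set hs" "r < h" by blast
      then have "ycol h \<in> set T" using hs(2) by auto
      then have "x \<preceq> int r + 1" using le h(2) nth_ycol[OF h(2)] unfolding x_def by (metis length_ycol)
      moreover have "int r + 1 \<in> letters n" using rn by (auto simp: letters_def)
      ultimately have "pos n x \<le> int r + 1" using xl pos_le_iff by (metis pos_def of_nat_0_le_iff zle_add1_eq_le le_imp_less_Suc int_Suc add.commute of_nat_Suc of_nat_0_less_iff zero_less_Suc)
      then show ?thesis using posx xl rn by (auto simp: pos_def letters_def split: if_splits)
    next
      case False
      then have cnt: "count_list (rev hs) i = 0" if "r < i" for i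
        using that by (auto simp: count_list_0_iff)
      show ?thesis
      proof (cases "0 < x")
        case True
        show ?thesis
        proof (rule ccontr)
          assume ne: "x \<noteq> int r + 1"
          define k where "k = nat (x - 1)"
          have k: "x = int k + 1" "r < k" "k < n" "1 \<le> k"
            using True ne posx xl by (auto simp: pos_def letters_def k_def)
          then have "minus_of n k x = 1" by (simp add: minus_of_iff)
          then show False using highest_snoc[OF hi, of k] phi[of k] cnt[of k] k by simp
        qed
      next
        case False
        define j where "j = nat (- x)"
        have j: "x = - int j" "1 \<le> j" "j \<le> n" using False xl by (auto simp: letters_def j_def)
        then have "minus_of n j x = 1" by (simp add: minus_of_iff)
        then have "j \<le> r" using highest_snoc[OF hi, of j] phi[of j] cnt[of j] j by (cases "r < j") auto
        have "{1..int j} \<subseteq> set C \<inter> {0<..int j}" using \<open>j \<le> r\<close> by (subst Csplit) (auto simp: set_ycol)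
        then have "card {1..int j} \<le> card (set C \<inter> {0<..int j})" by (intro card_mono) auto
        then have "int j \<le> npos C j" by (simp add: npos_card)
        moreover have "{x} \<subseteq> set C \<inter> {- int j..<0}" using j nth_mem[OF r] by (auto simp: x_def)
        then have "card {x} \<le> card (set C \<inter> {- int j..<0})" by (intro card_mono) auto
        then have "1 \<le> nneg C j" by (simp add: nneg_card)
        moreover have "excess C j \<le> 0" using adm admissible_iff[OF C] j by blast
        ultimately show ?thesis by (simp add: excess_def)
      qed
    qed
    then show ?case using IH r by (simp add: take_Suc_conv_app_nth x_def ycol_Suc add.commute)
  qed simp
  from this[of "length C"] have "C = ycol (length C)" by simp
  then show ?case using T by simp
qed simp

section \<open>Existence and uniqueness of the tableau of a word\<close>

lemma upt_letters: "1 \<le> j \<Longrightarrow> k \<le> Suc n \<Longrightarrow> map int [j..<k] \<in> words n"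
  by (auto simp: in_lists_conv_set letters_def)

lemma nat_letters: "1 \<le> k \<Longrightarrow> k \<le> n \<Longrightarrow> int k \<in> letters n"
  by (auto simp: letters_def)

text \<open>Repeated R1a: the letter \<open>k\<close> passes \<open>m + 1\<close> thanks to the
  \<open>m\<close> standing before both.\<close>

lemma plactic_move_left:
  assumes "1 \<le> k" "k \<le> m" "m \<le> n"
  shows "plactic_equiv n (map int [k..<Suc m] @ [int k]) (int k # map int [k..<Suc m])"
  using assms(2,3)
proof (induction m rule: dec_induct)
  case (step m)
  have "knuth_rel n [int m, int (Suc m), int k] [int m, int k, int (Suc m)]"
    using step assms(1) by (intro knuth_rel.R1a) (auto simp: letter_le_def letter_less_def letters_def)
  from plactic_context[OF plactic_rel[OF this] upt_letters, of k m "[]"]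
  have "plactic_equiv n (map int [k..<m] @ [int m, int (Suc m), int k]) (map int [k..<m] @ [int m, int k, int (Suc m)])"
    using assms(1) step by simp
  also have "map int [k..<m] @ [int m, int k, int (Suc m)] = (map int [k..<Suc m] @ [int k]) @ [int (Suc m)]"
    using step by simp
  also have "plactic_equiv n \<dots> ((int k # map int [k..<Suc m]) @ [int (Suc m)])"
    using plactic_context[OF step.IH, of "[]" "[int (Suc m)]"] step nat_letters[of "Suc m" n] by simp
  finally show ?case using step by simp
qed simp

text \<open>Repeated R1b: the letter \<open>k\<close> passes \<open>p\<close> thanks to the
  \<open>p + 1\<close> standing after both.\<close>

lemma plactic_move_front:
  assumes "1 \<le> j" "j \<le> k" "k \<le> n"
  shows "plactic_equiv n (map int [j..<k] @ [int k, int k]) (int k # map int [j..<Suc k])"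
  using assms(2,1)
proof (induction j rule: inc_induct)
  case (step p)
  have p: "[p..<k] = p # [Suc p..<k]" "[p..<Suc k] = p # Suc p # [Suc (Suc p)..<Suc k]"
    "[Suc p..<Suc k] = Suc p # [Suc (Suc p)..<Suc k]"
    using step.hyps by (simp_all add: upt_conv_Cons)
  have "plactic_equiv n (map int [p..<k] @ [int k, int k]) ([int p] @ (int k # map int [Suc p..<Suc k]))"
    using plactic_context[OF step.IH, of "[int p]" "[]"] step nat_letters[of p n] assms(3) p(1)
    by (simp del: upt_Suc)
  also have "[int p] @ (int k # map int [Suc p..<Suc k]) = [int p, int k, int (Suc p)] @ map int [Suc (Suc p)..<Suc k]"
    unfolding p(3) by simp
  also have "plactic_equiv n \<dots> ([int k, int p, int (Suc p)] @ map int [Suc (Suc p)..<Suc k])"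
  proof -
    have "knuth_rel n [int p, int k, int (Suc p)] [int k, int p, int (Suc p)]"
      using step assms by (intro knuth_rel.R1b) (auto simp: letter_le_def letter_less_def letters_def)
    from plactic_context[OF plactic_rel[OF this], of "[]" "map int [Suc (Suc p)..<Suc k]"]
    show ?thesis using upt_letters[of "Suc (Suc p)" "Suc k" n] assms(3) by simp
  qed
  also have "[int k, int p, int (Suc p)] @ map int [Suc (Suc p)..<Suc k] = int k # map int [p..<Suc k]"
    unfolding p(2) by simp
  finally show ?case .
qed simp

lemma ycol_split: "1 \<le> k \<Longrightarrow> k \<le> h \<Longrightarrow> ycol h = map int [1..<k] @ map int [k..<Suc h]"
  unfolding ycol_def using upt_add_eq_append[of 1 k "Suc h - k"] by (simp del: upt_Suc flip: map_append)

lemma plactic_ycol_letter: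
  assumes "1 \<le> k" "k \<le> h" "h \<le> n"
  shows "plactic_equiv n (ycol h @ [int k]) (int k # ycol h)"
proof -
  have L: "map int [1..<k] \<in> words n" "map int [Suc k..<Suc h] \<in> words n"
    using assms upt_letters[of 1 k n] upt_letters[of "Suc k" "Suc h" n] by auto
  have up: "[k..<Suc h] = k # [Suc k..<Suc h]" using assms by (simp add: upt_conv_Cons)
  have "plactic_equiv n (ycol h @ [int k]) (map int [1..<k] @ int k # map int [k..<Suc h])"
    using plactic_context[OF plactic_move_left[OF assms] L(1), of "[]"] ycol_split[OF assms(1,2)] by simp
  also have "map int [1..<k] @ int k # map int [k..<Suc h] =
      (map int [1..<k] @ [int k, int k]) @ map int [Suc k..<Suc h]" unfolding up by simp
  also have "plactic_equiv n \<dots> ((int k # map int [1..<Suc k]) @ map int [Suc k..<Suc h])"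
    using plactic_context[OF plactic_move_front[of 1 k n], of "[]"] assms L(2) by simp
  also have "(int k # map int [1..<Suc k]) @ map int [Suc k..<Suc h] = int k # ycol h"
    using ycol_split[of "Suc k" h] assms(2) unfolding ycol_def
    by (cases "k = h") (auto simp del: upt_Suc)
  finally show ?thesis .
qed

lemma plactic_ycol_commute:
  assumes "g \<le> n" "h \<le> n"
  shows "plactic_equiv n (ycol h @ ycol g) (ycol g @ ycol h)"
proof -
  have main: "g \<le> h \<Longrightarrow> h \<le> n \<Longrightarrow> plactic_equiv n (ycol h @ ycol g) (ycol g @ ycol h)" for g h
  proof (induction g)
    case (Suc g)
    have L: "ycol g \<in> words n" "[int (Suc g)] \<in> words n"
      using Suc.prems ycol_letters[of g n] nat_letters[of "Suc g" n] by auto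
    have "plactic_equiv n ((ycol h @ ycol g) @ [int (Suc g)]) ((ycol g @ ycol h) @ [int (Suc g)])"
      using plactic_context[OF Suc.IH, of "[]" "[int (Suc g)]"] Suc.prems L by simp
    also have "(ycol g @ ycol h) @ [int (Suc g)] = ycol g @ (ycol h @ [int (Suc g)]) @ []" by simp
    also have "plactic_equiv n \<dots> (ycol g @ (int (Suc g) # ycol h) @ [])"
      using plactic_context[OF plactic_ycol_letter[of "Suc g" h n] L(1), of "[]"] Suc.prems by simp
    finally show ?case by (simp add: ycol_Suc)
  qed simp
  show ?thesis
    using main[of g h] main[of h g] assms plactic_sym by (cases "g \<le> h") auto
qed

lemma plactic_ycol_yword:
  assumes "h \<le> n" "set hs \<subseteq> {1..n}"
  shows "plactic_equiv n (ycol h @ yword hs) (yword hs @ ycol h)"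
  using assms(2)
proof (induction hs)
  case (Cons g hs)
  have L: "ycol g \<in> words n" "yword hs \<in> words n"
    using Cons.prems ycol_letters[of g n] yword_letters[of hs n] by auto
  have "plactic_equiv n ((ycol h @ ycol g) @ yword hs) ((ycol g @ ycol h) @ yword hs)"
    using plactic_context[OF plactic_ycol_commute[of g n h], of "[]"] L assms Cons.prems by simp
  also have "(ycol g @ ycol h) @ yword hs = ycol g @ (ycol h @ yword hs) @ []" by simp
  also have "plactic_equiv n \<dots> (ycol g @ (yword hs @ ycol h) @ [])"
    using plactic_context[OF Cons.IH L(1), of "[]"] Cons.prems by simp
  finally show ?case by simp
qed simp

lemma plactic_yword_perm:
  assumes "mset hs = mset gs" "set hs \<subseteq> {1..n}"
  shows "plactic_equiv n (yword hs) (yword gs)"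
  using assms
proof (induction hs arbitrary: gs)
  case (Cons h hs)
  have "h \<in> set gs" using Cons.prems(1) by (metis list.set_intros(1) set_mset_mset)
  then obtain a b where gs: "gs = a @ h # b" by (meson split_list)
  have m: "mset hs = mset (a @ b)" using Cons.prems(1) gs by simp
  have "set hs = set a \<union> set b" using mset_eq_setD[OF m] by simp
  then have sub: "set a \<subseteq> {1..n}" "set b \<subseteq> {1..n}" "h \<le> n" using Cons.prems(2) by auto
  have L: "ycol h \<in> words n" "yword b \<in> words n"
    using ycol_letters[OF sub(3)] yword_letters[OF sub(2)] by auto
  have "plactic_equiv n (ycol h @ yword hs @ []) (ycol h @ yword (a @ b) @ [])"
    using plactic_context[OF Cons.IH[OF m] L(1), of "[]"] Cons.prems by simp
  also have "ycol h @ yword (a @ b) @ [] = [] @ (ycol h @ yword a) @ yword b" by simp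
  also have "plactic_equiv n \<dots> ([] @ (yword a @ ycol h) @ yword b)"
    using plactic_context[OF plactic_ycol_yword[OF sub(3,1)], of "[]"] L by simp
  finally show ?case by (simp add: gs)
qed simp

text \<open>The excess of this column vanishes below \<open>j\<close> and is \<open>1\<close> at
  \<open>j\<close>, so R3 applies with \<open>j\<close> as the contracted letter.\<close>

lemma plactic_contract:
  assumes "1 \<le> j" "j \<le> n"
  shows "plactic_equiv n (ycol j @ [- int j]) (ycol (j - 1))"
proof -
  have col: "is_column n (ycol j @ [- int j])"
    using column_ycol[OF assms(2)] assms nat_letters[OF assms]
    by (auto simp: column_append column_Cons set_ycol pos_def is_column_def[of n "[]"])
  have P: "npos (ycol j @ [- int j]) q = int (min q j)" for q
    using assms by (induction q) (auto simp: set_ycol)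
  have N: "nneg (ycol j @ [- int j]) q = of_bool (j \<le> q)" for q
    using assms by (induction q) (auto simp: set_ycol)
  have "contraction n (ycol j @ [- int j]) j"
    using col assms by (auto simp: contraction_def excess_def P N)
  moreover have "del_pair j (ycol j @ [- int j]) = ycol (j - 1)"
  proof -
    have j: "ycol j = ycol (j - 1) @ [int j]" using ycol_Suc[of "j - 1"] assms by simp
    have "filter (\<lambda>x. x \<noteq> int j \<and> x \<noteq> - int j) (ycol (j - 1)) = ycol (j - 1)"
      using assms by (intro filter_True) (auto simp: set_ycol)
    then show ?thesis unfolding j by simp
  qed
  ultimately show ?thesis using contraction_knuth_rel plactic_rel by metis
qed

lemma plactic_yword_remove:
  assumes "j \<in> set hs" "set hs \<subseteq> {1..n}"
  obtains gs where "plactic_equiv n (yword hs) (yword gs @ ycol j)" "set gs \<subseteq> {1..n}"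
proof -
  obtain a b where hs: "hs = a @ j # b" using assms(1) by (meson split_list)
  have "plactic_equiv n (yword hs) (yword ((a @ b) @ [j]))"
    by (rule plactic_yword_perm) (use hs assms in auto)
  then show ?thesis using that[of "a @ b"] hs assms by simp
qed

text \<open>When a letter is appended to a product of columns \<open>ycol\<close>, the letter
  \<open>1\<close> opens a column, \<open>j + 1\<close> lengthens a column of height
  \<open>j\<close>, and \<open>- j\<close> shortens one. Such a column exists: \<open>phi\<close> at
  \<open>j\<close> counts the columns of height \<open>j\<close>, and it must be positive for the
  longer word to be highest. Commutation brings that column to the end.\<close>

lemma highest_plactic_yword:
  assumes "w \<in> words n" "highest n w"
  shows "\<exists>hs. set hs \<subseteq> {1..n} \<and> plactic_equiv n w (yword hs)"
  using assms
proof (induction w rule: rev_induct)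
  case Nil
  then show ?case by (intro exI[of _ "[]"]) simp
next
  case (snoc x w)
  have w: "w \<in> words n" "x \<in> letters n" using snoc.prems by auto
  obtain hs where hs: "set hs \<subseteq> {1..n}" "plactic_equiv n w (yword hs)"
    using snoc.IH w highest_prefix snoc.prems(2) by blast
  have mem: "i \<in> set hs" if "i \<in> {1..n}" "minus_of n i x = 1" for i
    using highest_snoc[OF snoc.prems(2) that(1)] that plactic_f_op[OF hs(2), of i] phi_yword[of i n hs] hs(1)
      count_notin[of i hs] by fastforce
  have wx: "plactic_equiv n (w @ [x]) (v @ [x])" if "plactic_equiv n (yword hs) v" for v
    using plactic_context[OF plactic_trans[OF hs(2) that], of "[]" "[x]"] w by simp
  have ex: ?case if "plactic_equiv n (yword hs) (yword gs @ ycol j)" "set gs \<subseteq> {1..n}"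
    "plactic_equiv n (ycol j @ [x]) (yword g)" "set g \<subseteq> {1..n}" for gs j g
  proof (intro exI conjI)
    have "plactic_equiv n (w @ [x]) (yword gs @ (ycol j @ [x]) @ [])" using wx[OF that(1)] by simp
    also have "plactic_equiv n \<dots> (yword gs @ yword g @ [])"
      by (rule plactic_context[OF that(3) yword_letters[OF that(2)]]) simp
    finally show "plactic_equiv n (w @ [x]) (yword (gs @ g))" by simp
    show "set (gs @ g) \<subseteq> {1..n}" using that by simp
  qed
  consider "x = 1" | j where "x = int j + 1" "1 \<le> j" "j < n" | j where "x = - int j" "1 \<le> j" "j \<le> n"
  proof -
    have x: "x \<noteq> 0" "\<bar>x\<bar> \<le> int n" using w(2) by (simp_all add: letters_def)
    consider "x = 1" | "x > 1" | "x < 0" using x(1) by linarith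
    then show ?thesis
    proof cases
      case 1 then show ?thesis by (rule that(1))
    next
      case 2 then show ?thesis using x(2) by (intro that(2)[of "nat (x - 1)"]) linarith+
    next
      case 3 then show ?thesis using x(2) by (intro that(3)[of "nat (- x)"]) linarith+
    qed
  qed
  then show ?case
  proof cases
    case 1
    then have "[x] = ycol 1" "1 \<le> n" using w(2) by (auto simp: ycol_def letters_def)
    then show ?thesis using wx[of "yword hs"] hs(1) by (intro exI[of _ "hs @ [1]"]) simp
  next
    case (2 j)
    then have "j \<in> set hs" by (intro mem) (auto simp: minus_of_iff)
    then obtain gs where gs: "plactic_equiv n (yword hs) (yword gs @ ycol j)" "set gs \<subseteq> {1..n}"
      using hs(1) by (rule plactic_yword_remove)
    have "ycol j @ [x] = yword [Suc j]" using 2 by (simp add: ycol_Suc add.commute)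
    then show ?thesis using ex[OF gs, of "[Suc j]"] 2 by simp
  next
    case (3 j)
    then have "j \<in> set hs" by (intro mem) (auto simp: minus_of_iff)
    then obtain gs where gs: "plactic_equiv n (yword hs) (yword gs @ ycol j)" "set gs \<subseteq> {1..n}"
      using hs(1) by (rule plactic_yword_remove)
    show ?thesis
    proof (rule ex[OF gs])
      show "plactic_equiv n (ycol j @ [x]) (yword (if j = 1 then [] else [j - 1]))"
        using plactic_contract[OF 3(2,3)] 3(1) by (cases "j = 1") simp_all
      show "set (if j = 1 then [] else [j - 1]) \<subseteq> {1..n}" using 3 by auto
    qed
  qed
qed

text \<open>The measure for climbing to a highest weight word: \<open>e_op\<close> lowers the
  position of one letter by one.\<close>

definition height :: "nat \<Rightarrow> int list \<Rightarrow> nat" where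
  "height n w = sum_list (map (\<lambda>x. nat (pos n x)) w)"

lemma height_e_op:
  assumes "e_op n i w = Some w'" "1 \<le> i" "i \<le> n"
  shows "height n w' < height n w"
proof -
  have "f_op n i w' = Some w" using e_op_inverse[OF assms] by blast
  then obtain a x b where ab: "w' = a @ x # b" "w = a @ lower_letter n i x # b" "plus_of n i x = Suc 0"
    by (rule f_op_decomp)
  have x: "x \<in> letters n" using lower_letter_props(4)[of n i x] ab(3) assms by simp
  have "pos n (lower_letter n i x) = pos n x + 1" using pos_lower[OF x assms(2,3) ab(3)] .
  moreover have "0 < pos n x" using x by (auto simp: pos_def letters_def)
  ultimately show ?thesis by (simp add: height_def ab)
qed

lemma not_highest:
  assumes "\<not> highest n w"
  obtains i w' where "1 \<le> i" "i \<le> n" "e_op n i w = Some w'"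
proof -
  obtain i where "i \<in> {1..n}" "eps n i w \<noteq> 0" using assms by (auto simp: highest_def)
  then show ?thesis using that[of i] e_op_None_iff[of n i w] by auto
qed

lemma KN_exists:
  assumes "w \<in> words n"
  shows "\<exists>T. KN_tableau n T \<and> plactic_equiv n (column_reading T) w"
  using assms
proof (induction "height n w" arbitrary: w rule: less_induct)
  case less
  show ?case
  proof (cases "highest n w")
    case True
    then obtain hs where hs: "set hs \<subseteq> {1..n}" "plactic_equiv n w (yword hs)"
      using highest_plactic_yword[OF less.prems] by blast
    define gs where "gs = rev (sort hs)"
    have gs: "set gs \<subseteq> {1..n}" "sorted_wrt (\<ge>) gs" using hs(1) by (auto simp: gs_def sorted_wrt_rev)
    have "plactic_equiv n (yword hs) (yword (rev gs))"
      by (rule plactic_yword_perm[OF _ hs(1)]) (simp add: gs_def)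
    then show ?thesis
      using KN_ycols(1)[OF gs] plactic_trans[OF hs(2)] plactic_sym
      by (metis reading_ycols)
  next
    case False
    then obtain i w1 where i: "1 \<le> i" "i \<le> n" and w1: "e_op n i w = Some w1" by (rule not_highest)
    obtain T1 where T1: "KN_tableau n T1" "plactic_equiv n (column_reading T1) w1"
      using less.hyps[OF height_e_op[OF w1 i]] e_op_letters[OF w1 i less.prems] by blast
    have "f_op n i w1 = Some w" using e_op_inverse[OF w1 i] by blast
    then obtain v where v: "f_op n i (column_reading T1) = Some v" "plactic_equiv n v w"
      using plactic_f_op[OF T1(2) i] by (auto simp: option_rel_Some2)
    obtain T where "KN_tableau n T" "column_reading T = v" using KN_f_op[OF T1(1) v(1) i] .
    then show ?thesis using v(2) by blast
  qed
qed

lemma KN_reading_letters: "KN_tableau n T \<Longrightarrow> column_reading T \<in> words n"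
  by (auto simp: KN_tableau_iff admissible_def is_column_def column_reading_def in_lists_conv_set)

lemma reading_inject:
  assumes "column_reading T = column_reading T'" "map length T = map length T'"
  shows "T = T'"
proof -
  have "rev T = rev T'"
  proof (rule concat_injective)
    show "concat (rev T) = concat (rev T')" using assms(1) by (simp add: column_reading_def)
    show len: "length (rev T) = length (rev T')" using assms(2) by (metis length_map length_rev)
    have "map length (rev T) = map length (rev T')" using assms(2) by (simp add: rev_map[symmetric])
    then show "\<forall>(x, y)\<in>set (zip (rev T) (rev T')). length x = length y"
      using len by (auto simp: set_zip) (metis length_rev nth_map)
  qed
  then show ?thesis by simp
qed

text \<open>Both tableaux climb by the same operators. At the top \<open>phi\<close> at
  \<open>i\<close> counts the columns of length \<open>i\<close>, which fixes the shape. On the way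
  back the readings agree, and \<open>reading_inject\<close> recovers the tableau from them because
  the operators keep the column lengths.\<close>

lemma KN_unique:
  assumes "KN_tableau n T" "KN_tableau n T'" "plactic_equiv n (column_reading T) (column_reading T')"
  shows "T = T'"
  using assms
proof (induction "height n (column_reading T)" arbitrary: T T' rule: less_induct)
  case less
  show ?case
  proof (cases "highest n (column_reading T)")
    case True
    then have True': "highest n (column_reading T')"
      using plactic_f_op[OF less.prems(3)] by (simp add: highest_def)
    define hs gs where "hs = map length T" and "gs = map length T'"
    have T: "T = map ycol hs" "T' = map ycol gs"
      using KN_highest less.prems(1,2) True True' hs_def gs_def by metis+
    have H: "sorted_wrt (\<ge>) hs" "set hs \<subseteq> {1..n}" "sorted_wrt (\<ge>) gs" "set gs \<subseteq> {1..n}"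
      using KN_lengths less.prems(1,2) by (simp_all only: hs_def gs_def)
    have "count_list (rev hs) i = count_list (rev gs) i" for i
    proof (cases "i \<in> {1..n}")
      case True
      then show ?thesis
        using plactic_f_op[OF less.prems(3), of i] phi_yword[of i n "rev hs"] phi_yword[of i n "rev gs"] H
        by (simp add: T reading_ycols)
    next
      case False
      then have "i \<notin> set hs" "i \<notin> set gs" using H by auto
      then show ?thesis by (simp add: count_list_0_iff)
    qed
    then have "mset (rev hs) = mset (rev gs)"
      by (intro multiset_eqI) (metis count_mset)
    moreover have "sorted (rev hs)" "sorted (rev gs)" using H by (simp_all add: sorted_wrt_rev)
    ultimately have "rev hs = rev gs" using properties_for_sort by metis
    then show ?thesis by (simp add: T)
  next
    case False
    then obtain i v where i: "1 \<le> i" "i \<le> n" and v: "e_op n i (column_reading T) = Some v" by (rule not_highest)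
    obtain v' where v': "e_op n i (column_reading T') = Some v'" "plactic_equiv n v v'"
      using plactic_e_op[OF less.prems(3) i] v by (auto simp: option_rel_Some1)
    obtain T1 where T1: "KN_tableau n T1" "column_reading T1 = v" "map length T1 = map length T"
      using KN_e_op[OF less.prems(1) v i] .
    obtain T1' where T1': "KN_tableau n T1'" "column_reading T1' = v'" "map length T1' = map length T'"
      using KN_e_op[OF less.prems(2) v'(1) i] .
    have "T1 = T1'"
      using less.hyps[of T1 T1'] height_e_op[OF v i] T1 T1' v'(2) by simp
    then have "v = v'" using T1 T1' by simp
    then have "column_reading T = column_reading T'"
      using e_op_inverse[OF v i] e_op_inverse[OF v'(1) i] by simp
    then show ?thesis using reading_inject T1(3) T1'(3) \<open>T1 = T1'\<close> by metis
  qed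
qed

lemma P_tableau_eq:
  assumes "KN_tableau n T" "plactic_equiv n (column_reading T) w"
  shows "P_tableau n w = T"
  unfolding P_tableau_def
proof (rule the_equality)
  show "KN_tableau n T \<and> plactic_equiv n (column_reading T) w" using assms by blast
  show "T' = T" if "KN_tableau n T' \<and> plactic_equiv n (column_reading T') w" for T'
    using KN_unique that assms plactic_trans plactic_sym by metis
qed

lemma P_tableau_props:
  assumes "w \<in> words n"
  shows "KN_tableau n (P_tableau n w)" "plactic_equiv n (column_reading (P_tableau n w)) w"
  using KN_exists[OF assms] P_tableau_eq by metis+

section \<open>Connected components\<close>

abbreviation arrow :: "nat \<Rightarrow> int list \<Rightarrow> int list \<Rightarrow> bool" where
  "arrow n \<equiv> crystal_arrow n (word_crystal n)"

abbreviation conn :: "nat \<Rightarrow> int list \<Rightarrow> int list \<Rightarrow> bool" where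
  "conn n \<equiv> equivclp (arrow n)"

lemma arrow_iff:
  "arrow n u v \<longleftrightarrow> u \<in> words n \<and> v \<in> words n \<and> (\<exists>i\<ge>1. i \<le> n \<and> f_op n i u = Some v)"
  by (auto simp: crystal_arrow_def word_crystal_def)

lemma conn_f_op:
  assumes "u \<in> words n" "f_op n i u = Some v" "1 \<le> i" "i \<le> n"
  shows "conn n u v"
  using f_op_letters[OF assms(2-4,1)] assms by (intro r_into_equivclp) (auto simp: arrow_iff)

lemma conn_e_op:
  assumes "u \<in> words n" "e_op n i u = Some v" "1 \<le> i" "i \<le> n"
  shows "conn n u v"
  using conn_f_op[of v n i u] e_op_letters[OF assms(2-4,1)] e_op_inverse[OF assms(2-4)] assms(3,4)
  by (auto intro: equivclp_sym)

lemma conn_induct [consumes 2, case_names base f e]: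
  assumes "conn n u v" "u \<in> words n" "P u"
    and f: "\<And>x y i. conn n u x \<Longrightarrow> x \<in> words n \<Longrightarrow> P x \<Longrightarrow> f_op n i x = Some y \<Longrightarrow> 1 \<le> i \<Longrightarrow> i \<le> n \<Longrightarrow> P y"
    and e: "\<And>x y i. conn n u x \<Longrightarrow> x \<in> words n \<Longrightarrow> P x \<Longrightarrow> e_op n i x = Some y \<Longrightarrow> 1 \<le> i \<Longrightarrow> i \<le> n \<Longrightarrow> P y"
  shows "P v \<and> v \<in> words n"
  using assms(1)
proof (induction rule: equivclp_induct)
  case base
  then show ?case using assms(2,3) by simp
next
  case (step y z)
  from step.hyps(2) show ?case
  proof
    assume "arrow n y z"
    then show ?thesis using f[OF step.hyps(1)] step.IH by (auto simp: arrow_iff)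
  next
    assume "arrow n z y"
    then obtain i where i: "1 \<le> i" "i \<le> n" "f_op n i z = Some y" and z: "z \<in> words n"
      by (auto simp: arrow_iff)
    then have "e_op n i y = Some z" using f_op_inverse[OF i(3,1,2)] by blast
    then show ?thesis using e[OF step.hyps(1) _ _ _ i(1,2)] step.IH z by blast
  qed
qed

lemma conn_letters: "conn n u v \<Longrightarrow> u \<in> words n \<Longrightarrow> v \<in> words n"
  using conn_induct[of n u v "\<lambda>_. True"] by blast

lemma conn_star:
  assumes "conn n u v"
  shows "conn n (star u) (star v)"
  using assms
proof (induction rule: equivclp_induct)
  case (step y z)
  have "arrow n (star b) (star a)" if ab: "arrow n a b" for a b
  proof -
    obtain i where i: "1 \<le> i" "i \<le> n" "f_op n i a = Some b" using ab by (auto simp: arrow_iff)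
    then have "f_op n i (star b) = Some (star a)"
      using f_op_inverse[OF i(3,1,2)] by (simp add: f_op_star)
    moreover have "star a \<in> words n" "star b \<in> words n"
      using ab unfolding arrow_iff star_letters by blast+
    ultimately show ?thesis using i unfolding arrow_iff by blast
  qed
  then show ?case using step by (meson equivclp_into_equivclp)
qed simp

text \<open>The walk from \<open>u\<close> to \<open>v\<close> is copied from \<open>u'\<close>
  operator by operator.\<close>

lemma conn_plactic:
  assumes "conn n u v" "u \<in> words n" "plactic_equiv n u u'"
  shows "\<exists>v'. conn n u' v' \<and> plactic_equiv n v v'"
proof -
  have u': "u' \<in> words n" using plactic_letters[OF assms(3)] assms(2) by simp
  have "(\<exists>v'. conn n u' v' \<and> plactic_equiv n v v') \<and> v \<in> words n"
    using assms(1,2)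
  proof (induction rule: conn_induct)
    case base
    show ?case using assms(3) by (intro exI[of _ u']) simp
  next
    case (f x y i)
    then obtain x' where x': "conn n u' x'" "plactic_equiv n x x'" by blast
    obtain y' where y': "f_op n i x' = Some y'" "plactic_equiv n y y'"
      using plactic_f_op[OF x'(2) \<open>1 \<le> i\<close> \<open>i \<le> n\<close>] \<open>f_op n i x = Some y\<close> by (auto simp: option_rel_Some1)
    have "conn n x' y'" using conn_f_op[OF _ y'(1) \<open>1 \<le> i\<close> \<open>i \<le> n\<close>] conn_letters[OF x'(1) u'] by blast
    then show ?case using x' y' equivclp_trans by metis
  next
    case (e x y i)
    then obtain x' where x': "conn n u' x'" "plactic_equiv n x x'" by blast
    obtain y' where y': "e_op n i x' = Some y'" "plactic_equiv n y y'"
      using plactic_e_op[OF x'(2) \<open>1 \<le> i\<close> \<open>i \<le> n\<close>] \<open>e_op n i x = Some y\<close> by (auto simp: option_rel_Some1)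
    have "conn n x' y'" using conn_e_op[OF _ y'(1) \<open>1 \<le> i\<close> \<open>i \<le> n\<close>] conn_letters[OF x'(1) u'] by blast
    then show ?case using x' y' equivclp_trans by metis
  qed
  then show ?thesis by blast
qed

section \<open>Column lengths along a component and uniqueness of highest weight words\<close>

definition heights :: "nat \<Rightarrow> int list \<Rightarrow> nat list" where
  "heights n w = map length (P_tableau n w)"

lemma heights_f_op:
  assumes "u \<in> words n" "f_op n i u = Some v" "1 \<le> i" "i \<le> n"
  shows "heights n v = heights n u"
proof -
  note P = P_tableau_props[OF assms(1)]
  obtain x where x: "f_op n i (column_reading (P_tableau n u)) = Some x" "plactic_equiv n x v"
    using plactic_f_op[OF P(2) assms(3,4)] assms(2) by (auto simp: option_rel_Some2)
  obtain T where T: "KN_tableau n T" "column_reading T = x" "map length T = map length (P_tableau n u)"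
    using KN_f_op[OF P(1) x(1) assms(3,4)] .
  then have "P_tableau n v = T" using P_tableau_eq x(2) by metis
  then show ?thesis using T(3) by (simp add: heights_def)
qed

lemma heights_conn:
  assumes "conn n u v" "u \<in> words n"
  shows "heights n v = heights n u"
proof -
  have "heights n v = heights n u \<and> v \<in> words n"
    using assms
  proof (induction rule: conn_induct)
    case (f x y i)
    then show ?case using heights_f_op by metis
  next
    case (e x y i)
    then show ?case using heights_f_op[of y n i x] e_op_inverse[OF \<open>e_op n i x = Some y\<close> \<open>1 \<le> i\<close> \<open>i \<le> n\<close>] e_op_letters[OF \<open>e_op n i x = Some y\<close> \<open>1 \<le> i\<close> \<open>i \<le> n\<close> \<open>x \<in> words n\<close>] by simp
  qed simp
  then show ?thesis by blast
qed

lemma plactic_highest: "plactic_equiv n u v \<Longrightarrow> highest n u \<longleftrightarrow> highest n v"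
  using plactic_f_op[of n u v] by (simp add: highest_def)

lemma P_tableau_highest:
  assumes "w \<in> words n" "highest n w"
  shows "P_tableau n w = map ycol (heights n w)"
  unfolding heights_def
  using KN_highest P_tableau_props[OF assms(1)] plactic_highest assms(2) by blast

text \<open>By the tensor product rule an operator on the whole word either acts as the same
  operator on the first \<open>k\<close> letters or leaves them unchanged.\<close>

lemma conn_take:
  assumes "conn n u v" "u \<in> words n"
  shows "conn n (take k u) (take k v)"
proof -
  have step: "conn n (take k x) (take k y)"
    if x: "x \<in> words n" and xy: "f_op n i x = Some y" and i: "1 \<le> i" "i \<le> n" for x y i
  proof -
    have t: "take k x \<in> words n" using x by (auto dest: in_set_takeD)
    have "f_op n i (take k x @ drop k x) = Some y" using xy by simp
    then consider a where "f_op n i (take k x) = Some a" "y = a @ drop k x"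
      | a where "f_op n i (drop k x) = Some a" "y = take k x @ a"
      by (auto simp: f_op_append simp del: append_take_drop_id split: if_splits)
    then show ?thesis
    proof cases
      case (1 a)
      then have "take k y = a"
        using length_f_op[OF 1(1)] by (cases "k \<le> length x") auto
      then show ?thesis using conn_f_op[OF t _ i] 1(1) by simp
    next
      case (2 a)
      then have "take k y = take k x"
        using length_f_op[OF 2(1)] by (cases "k \<le> length x") auto
      then show ?thesis by simp
    qed
  qed
  have "conn n (take k u) (take k v) \<and> v \<in> words n"
    using assms
  proof (induction rule: conn_induct)
    case (f x y i)
    then show ?case using step equivclp_trans by metis
  next
    case (e x y i)
    have "conn n (take k y) (take k x)"
      using step[of y i x] e_op_inverse[OF \<open>e_op n i x = Some y\<close> \<open>1 \<le> i\<close> \<open>i \<le> n\<close>] e_op_letters[OF \<open>e_op n i x = Some y\<close> \<open>1 \<le> i\<close> \<open>i \<le> n\<close> \<open>x \<in> words n\<close>] e by blast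
    then show ?case using \<open>conn n (take k u) (take k x)\<close> equivclp_trans equivclp_sym by metis
  qed simp
  then show ?thesis by blast
qed

lemma length_conn:
  assumes "conn n u v" "u \<in> words n"
  shows "length v = length u"
proof -
  have "length v = length u \<and> v \<in> words n"
    using assms by (induction rule: conn_induct) (auto dest: length_f_op length_e_op)
  then show ?thesis by blast
qed

lemma wt_singleton_inject:
  assumes "wt [x] = wt [y]" "x \<noteq> 0" "y \<noteq> 0"
  shows "x = y"
proof -
  have "wt [x] (nat \<bar>x\<bar>) = wt [y] (nat \<bar>x\<bar>)" using assms(1) by simp
  then show ?thesis using assms(2,3) by (auto simp: wt_def abs_if split: if_splits)
qed

text \<open>The shapes of the tableaux of all prefixes (the Q-symbol) are constant on a component, and a
  highest weight word is read off from the weights of its prefixes.\<close>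

lemma highest_conn_unique:
  assumes "conn n u v" "u \<in> words n" "highest n u" "highest n v"
  shows "u = v"
proof -
  have v: "v \<in> words n" using conn_letters assms(1,2) by blast
  have len: "length v = length u" using length_conn assms(1,2) by blast
  have tl: "take k x \<in> words n" if "x \<in> words n" for k x
    using that by (auto dest: in_set_takeD)
  have th: "highest n (take k x)" if "highest n x" for k x
    using highest_prefix[of n "take k x" "drop k x"] that by simp
  have wt: "wt (take k u) = wt (take k v)" for k
  proof -
    have "P_tableau n (take k u) = P_tableau n (take k v)"
      using P_tableau_highest[OF tl[OF assms(2)] th[OF assms(3)], of k]
        P_tableau_highest[OF tl[OF v] th[OF assms(4)], of k]
        heights_conn[OF conn_take[OF assms(1,2)] tl[OF assms(2)], of k] by simp
    then have "plactic_equiv n (take k u) (take k v)"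
      using P_tableau_props(2)[OF tl[OF assms(2)], of k] P_tableau_props(2)[OF tl[OF v], of k]
        plactic_trans plactic_sym by metis
    then show ?thesis using plactic_wt tl assms(2) by blast
  qed
  show ?thesis
  proof (rule nth_equalityI)
    show "length u = length v" using len by simp
    fix k assume k: "k < length u"
    have "wt [u ! k] = wt [v ! k]"
    proof
      fix i
      have "wt (take k u @ [u ! k]) i = wt (take k v @ [v ! k]) i"
        using wt[of "Suc k"] k len by (simp add: take_Suc_conv_app_nth)
      then show "wt [u ! k] i = wt [v ! k] i" using wt[of k] by (simp add: wt_append)
    qed
    moreover have "u ! k \<in> letters n" "v ! k \<in> letters n" using assms(2) v k len by (auto simp: in_lists_conv_set)
    ultimately show "u ! k = v ! k" using wt_singleton_inject by (auto simp: letters_def)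
  qed
qed

text \<open>Equal raising operators apply to both words until they are highest, where
  \<open>highest_conn_unique\<close> decides; \<open>f_op\<close> inverts \<open>e_op\<close> on the
  way back.\<close>

lemma plactic_conn_unique:
  assumes "plactic_equiv n u v" "conn n u v" "u \<in> words n"
  shows "u = v"
  using assms
proof (induction "height n u" arbitrary: u v rule: less_induct)
  case less
  show ?case
  proof (cases "highest n u")
    case True
    then show ?thesis using highest_conn_unique less.prems plactic_highest by blast
  next
    case False
    then obtain i u1 where i: "1 \<le> i" "i \<le> n" and u1: "e_op n i u = Some u1" by (rule not_highest)
    obtain v1 where v1: "e_op n i v = Some v1" "plactic_equiv n u1 v1"
      using plactic_e_op[OF less.prems(1) i] u1 by (auto simp: option_rel_Some1)
    have v: "v \<in> words n" using conn_letters less.prems by blast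
    have "conn n u1 v1"
      using conn_e_op[OF less.prems(3) u1 i] conn_e_op[OF v v1(1) i] less.prems(2)
      by (meson equivclp_sym equivclp_trans)
    then have "u1 = v1"
      using less.hyps[OF height_e_op[OF u1 i]] v1(2) e_op_letters[OF u1 i less.prems(3)] by blast
    then show ?thesis using e_op_inverse[OF u1 i] e_op_inverse[OF v1(1) i] by simp
  qed
qed

text \<open>Raising stays among the tableaux with the same column lengths, and a highest one among
  them has the columns \<open>ycol h\<close>. Thus all tableaux of one shape lie in one
  component.\<close>

lemma KN_conn_ycols:
  assumes "KN_tableau n T"
  shows "conn n (column_reading T) (column_reading (map ycol (map length T)))"
  using assms
proof (induction "height n (column_reading T)" arbitrary: T rule: less_induct)
  case less
  show ?case
  proof (cases "highest n (column_reading T)")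
    case True
    then show ?thesis using KN_highest[OF less.prems] by (metis equivclp_refl)
  next
    case False
    then obtain i v where i: "1 \<le> i" "i \<le> n" and v: "e_op n i (column_reading T) = Some v" by (rule not_highest)
    obtain T1 where T1: "KN_tableau n T1" "column_reading T1 = v" "map length T1 = map length T"
      using KN_e_op[OF less.prems v i] .
    have "conn n (column_reading T1) (column_reading (map ycol (map length T1)))"
      using less.hyps[of T1] height_e_op[OF v i] T1 by simp
    then show ?thesis
      using conn_e_op[OF KN_reading_letters[OF less.prems] v i] T1(2,3) equivclp_trans by metis
  qed
qed

text \<open>The tableau with columns \<open>star (ycol h)\<close> is the lowest weight tableau of its shape, and its
  image under \<open>star\<close> is again a Yamanouchi word with the same column lengths: this is the
  combinatorial form of $w_0 = -1$ in type C.\<close>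

lemma heights_star:
  assumes "w \<in> words n"
  shows "heights n (star w) = heights n w"
proof -
  define hs where "hs = heights n w"
  note P = P_tableau_props[OF assms]
  have hs: "set hs \<subseteq> {1..n}" "sorted_wrt (\<ge>) hs" using KN_lengths[OF P(1)] by (auto simp: hs_def heights_def)
  define L where "L = map (\<lambda>h. star (ycol h)) hs"
  have L: "KN_tableau n L" "map length L = hs"
    using KN_ycols(2)[OF hs] by (auto simp: L_def comp_def)
  \<comment> \<open>Both tableaux have the column lengths \<open>hs\<close>, so both are connected
    to the same Yamanouchi tableau.\<close>
  have "conn n (column_reading (P_tableau n w)) (column_reading L)"
    using KN_conn_ycols[OF P(1)] KN_conn_ycols[OF L(1)] L(2)
    by (metis heights_def hs_def equivclp_sym equivclp_trans)
  then obtain v where v: "conn n w v" "plactic_equiv n (column_reading L) v"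
    using conn_plactic[OF _ KN_reading_letters[OF P(1)] P(2)] by blast
  have "star (column_reading L) = yword hs"
    by (simp add: L_def column_reading_def star_concat yword_def rev_map comp_def)
  \<comment> \<open>The reading and \<open>star\<close> each reverse the order of the columns, so
    the heights come out as \<open>hs\<close>, whereas a tableau of this shape reads them as
    \<open>rev hs\<close>; commutation of columns repairs this.\<close>
  then have "plactic_equiv n (star v) (yword (rev hs))"
    using plactic_trans[OF plactic_sym[OF plactic_star[OF v(2)]]] plactic_yword_perm[of hs "rev hs" n] hs(1) by simp
  then have "P_tableau n (star v) = map ycol hs"
    using P_tableau_eq[OF KN_ycols(1)[OF hs]] plactic_sym by (metis reading_ycols)
  then have "heights n (star v) = hs" by (simp add: heights_def comp_def)
  moreover have "heights n (star v) = heights n (star w)"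
    using heights_conn[OF conn_star[OF v(1)]] assms by (metis star_letters)
  ultimately show ?thesis by (simp add: hs_def)
qed

lemma heights_conn_plactic:
  assumes "u \<in> words n" "w \<in> words n" "heights n u = heights n w"
  shows "\<exists>v. conn n w v \<and> plactic_equiv n u v"
proof -
  note U = P_tableau_props[OF assms(1)] and W = P_tableau_props[OF assms(2)]
  have "conn n (column_reading (P_tableau n w)) (column_reading (P_tableau n u))"
    using KN_conn_ycols[OF U(1)] KN_conn_ycols[OF W(1)] assms(3) unfolding heights_def
    by (metis equivclp_sym equivclp_trans)
  then show ?thesis
    using conn_plactic[OF _ KN_reading_letters[OF W(1)] W(2)] U(2) plactic_trans plactic_sym by metis
qed

section \<open>The isomorphism between components and the duality\<close>

abbreviation (input) wcomp :: "nat \<Rightarrow> int list \<Rightarrow> int list crystal" where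
  "wcomp n \<equiv> component n (word_crystal n)"

lemma component_simps:
  "vert (wcomp n w) = {u. conn n w u}"
  "wgt (wcomp n w) = wt"
  "cr_e (wcomp n w) = e_op n"
  "cr_f (wcomp n w) = f_op n"
  by (simp_all add: component_def word_crystal_def[of n, THEN arg_cong[where f = wgt]]
      word_crystal_def[of n, THEN arg_cong[where f = cr_e]]
      word_crystal_def[of n, THEN arg_cong[where f = cr_f]])

text \<open>The map \<open>g\<close> follows plactic equivalence. Images and preimages exist by
  \<open>conn_plactic\<close>; independence of the choice, injectivity and compatibility with the
  operators all rest on \<open>plactic_conn_unique\<close>.\<close>

lemma component_isomorphic:
  assumes "u \<in> words n" "w \<in> words n" "heights n u = heights n w"
  shows "crystal_isomorphic n (wcomp n u) (wcomp n w)"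
proof -
  obtain v0 where v0: "conn n w v0" "plactic_equiv n u v0"
    using heights_conn_plactic[OF assms] by blast
  have v0l: "v0 \<in> words n" using conn_letters v0(1) assms(2) by blast
  define g where "g x = (SOME y. conn n w y \<and> plactic_equiv n x y)" for x
  have g: "conn n w (g x) \<and> plactic_equiv n x (g x)" if "conn n u x" for x
  proof -
    have "\<exists>y. conn n w y \<and> plactic_equiv n x y"
      using conn_plactic[OF that assms(1) v0(2)] equivclp_trans[OF v0(1)] by blast
    then show ?thesis unfolding g_def by (rule someI_ex)
  qed
  have ul: "x \<in> words n" if "conn n u x" for x using conn_letters that assms(1) by blast
  have wl: "y \<in> words n" if "conn n w y" for y using conn_letters that assms(2) by blast
  have uniq: "g x = y" if "conn n u x" "conn n w y" "plactic_equiv n x y" for x y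
  proof (rule plactic_conn_unique)
    show "plactic_equiv n (g x) y" using g[OF that(1)] that(3) plactic_trans plactic_sym by metis
    show "conn n (g x) y" using g[OF that(1)] that(2) equivclp_trans equivclp_sym by metis
    show "g x \<in> words n" using g[OF that(1)] wl by blast
  qed
  have "bij_betw g {x. conn n u x} {y. conn n w y}"
  proof (rule bij_betwI')
    fix x x' assume x: "x \<in> {x. conn n u x}" "x' \<in> {x. conn n u x}"
    show "g x = g x' \<longleftrightarrow> x = x'"
    proof
      assume "g x = g x'"
      then have "plactic_equiv n x x'" using x g[of x] g[of x'] plactic_trans plactic_sym by (metis mem_Collect_eq)
      moreover have "conn n x x'" using x equivclp_trans equivclp_sym by (metis mem_Collect_eq)
      ultimately show "x = x'" using plactic_conn_unique ul x by blast
    qed simp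
  next
    fix x assume "x \<in> {x. conn n u x}"
    then show "g x \<in> {y. conn n w y}" using g by blast
  next
    fix y assume y: "y \<in> {y. conn n w y}"
    then have "conn n v0 y" using v0(1) equivclp_trans equivclp_sym by (metis mem_Collect_eq)
    then obtain x where x: "conn n u x" "plactic_equiv n y x"
      using conn_plactic[OF _ v0l plactic_sym[OF v0(2)]] by blast
    then have "g x = y" using uniq y plactic_sym by blast
    then show "\<exists>x\<in>{x. conn n u x}. y = g x" using x(1) by blast
  qed
  moreover have "wt (g x) = wt x \<and> (\<forall>i\<in>{1..n}. e_op n i (g x) = map_option g (e_op n i x) \<and>
      f_op n i (g x) = map_option g (f_op n i x))" if x: "conn n u x" for x
  proof (intro conjI ballI)
    note p = g[OF x, THEN conjunct2] and c = g[OF x, THEN conjunct1]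
    show "wt (g x) = wt x" using plactic_wt[OF p ul[OF x]] by simp
    fix i assume "i \<in> {1..n}"
    then have i: "1 \<le> i" "i \<le> n" by auto
    show "e_op n i (g x) = map_option g (e_op n i x)"
    proof (cases "e_op n i x")
      case None
      then show ?thesis using plactic_e_op[OF p i] by simp
    next
      case (Some x')
      then obtain y' where y': "e_op n i (g x) = Some y'" "plactic_equiv n x' y'"
        using plactic_e_op[OF p i] by (auto simp: option_rel_Some1)
      have "g x' = y'"
        using uniq[OF _ _ y'(2)] conn_e_op[OF ul[OF x] Some i] conn_e_op[OF wl[OF c] y'(1) i] x c
        by (meson equivclp_trans)
      then show ?thesis using Some y' by simp
    qed
    show "f_op n i (g x) = map_option g (f_op n i x)"
    proof (cases "f_op n i x")
      case None
      then show ?thesis using plactic_f_op[OF p i] by simp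
    next
      case (Some x')
      then obtain y' where y': "f_op n i (g x) = Some y'" "plactic_equiv n x' y'"
        using plactic_f_op[OF p i] by (auto simp: option_rel_Some1)
      have "g x' = y'"
        using uniq[OF _ _ y'(2)] conn_f_op[OF ul[OF x] Some i] conn_f_op[OF wl[OF c] y'(1) i] x c
        by (meson equivclp_trans)
      then show ?thesis using Some y' by simp
    qed
  qed
  ultimately have "crystal_iso n g (wcomp n u) (wcomp n w)"
    unfolding crystal_iso_def component_simps by blast
  then show ?thesis unfolding crystal_isomorphic_def by blast
qed

lemma shape_eqI:
  assumes "map length T = map length T'"
  shows "shape T = shape T'"
proof -
  have len: "length T = length T'" using assms by (metis length_map)
  have "length (T ! c) = length (T' ! c)" if "c < length T" for c
    using assms that len by (metis nth_map)
  then show ?thesis using len by (auto simp: shape_def)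
qed

lemma tableau_wt_P:
  assumes "w \<in> words n"
  shows "tableau_wt (P_tableau n w) = wt w"
  unfolding tableau_wt_def
  using plactic_wt[OF P_tableau_props(2)[OF assms] KN_reading_letters[OF P_tableau_props(1)[OF assms]]] .

lemma star_dual_component:
  "crystal_iso n star (dual_crystal (wcomp n w)) (wcomp n (star w))"
proof -
  have "bij_betw star {u. conn n w u} {u. conn n (star w) u}"
  proof (rule bij_betw_byWitness[where f' = star])
    show "star ` {u. conn n w u} \<subseteq> {u. conn n (star w) u}" using conn_star by blast
    show "star ` {u. conn n (star w) u} \<subseteq> {u. conn n w u}" using conn_star[of n "star w"] by fastforce
  qed simp_all
  then show ?thesis
    unfolding crystal_iso_def dual_crystal_def
    by (auto simp: component_simps wt_star e_op_star f_op_star)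
qed

theorem theorem5p9:
  fixes n :: nat and w :: "int list"
  assumes "w \<in> lists (letters n)"
  shows "crystal_isomorphic n (component n (word_crystal n) w)
                              (component n (word_crystal n) (star w))
    \<and> (shape (P_tableau n w) = shape (P_tableau n (star w)) \<and>
       tableau_wt (P_tableau n (star w)) = (\<lambda>i. - tableau_wt (P_tableau n w) i))
    \<and> crystal_iso n star (dual_crystal (component n (word_crystal n) w))
                         (component n (word_crystal n) (star w))"
proof (intro conjI)
  have s: "star w \<in> words n" using assms by (simp only: star_letters)
  show "crystal_isomorphic n (wcomp n w) (wcomp n (star w))"
    using component_isomorphic[OF assms s] heights_star[OF assms] by simp
  show "shape (P_tableau n w) = shape (P_tableau n (star w))"
    using heights_star[OF assms] unfolding heights_def by (intro shape_eqI) simp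
  show "tableau_wt (P_tableau n (star w)) = (\<lambda>i. - tableau_wt (P_tableau n w) i)"
    by (simp add: tableau_wt_P[OF assms] tableau_wt_P[OF s] wt_star)
  show "crystal_iso n star (dual_crystal (wcomp n w)) (wcomp n (star w))"
    by (rule star_dual_component)
qed

end
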